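(* In the regression setting of the context (Assumptions 1, 2, 3 and the kernel conditions stated there), let $\alpha\in(0,1)$ and let $(d_n)$ be a deterministic sequence with $d_n\to\infty$ and $d_n/\sqrt{\log n}\to\infty$. Let $h_{\mathrm{nv}}=n^{-\frac1{2S+1}}$, $$\widehat C_{V,0}=nh_{\mathrm{nv}}\sum_{i=1}^nW^2_{ih_{\mathrm{nv}}}(0)\big(Y_i-\hat m_{h_{\mathrm{nv}}}(0)\big)^2,\qquad \hat r(t)=d_n\Big(\frac{2\log(1/t)\widehat C_{V,0}}{n}\Big)^{\frac S{2S+1}} .$$ Then $$\inf_{m\in\Theta_0(M_S,r_S,\psi_n)}\mathbb P\big(m(0)\le\hat m_{h_{\mathrm{nv}}}(0)+\hat r(\alpha)\big)\ge1-\alpha-\mathrm{CE}_n,$$ $$\inf_{m\in\Theta_0(M_S,r_S,\psi_n)}\mathbb P\big(m(0)\ge\hat m_{h_{\mathrm{nv}}}(0)-\hat r(\alpha)\big)\ge1-\alpha-\mathrm{CE}_n,$$ $$\inf_{m\in\Theta_0(M_S,r_S,\psi_n)}\mathbb P\big(m(0)\in[\hat m_{h_{\mathrm{nv}}}(0)-\hat r(\alpha/2),\ \hat m_{h_{\mathrm{nv}}}(0)+\hat r(\alpha/2)]\big)\ge1-\alpha-\mathrm{CE}'_n,$$ where $\max\{\mathrm{CE}_n,\mathrm{CE}_n'\}=o(n^{-\frac{2S}{2S+1}})$ as $n\to\infty$. Moreover, if the $\varepsilon_i$ are sub-Gaussian, then $\max\{\mathrm{CE}_n,\mathrm{CE}_n'\}=O(e^{-n^\kappa})$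 for some $\kappa>0$.
   Context: Let $S\ge1$ be an integer and $Y_i=m(X_i)+V^{1/2}(X_i)\varepsilon_i$, $i=1,\dots,n$, with $\mathbb E[\varepsilon_i|X_i]=0$, $\mathbb E[\varepsilon_i^2|X_i]=1$. The target is $m(0)$. Assumption 1: the pairs $(X_i,Y_i)$ are mutually independent; the $X_i$ are i.i.d. with values in $[a,b]$ and a Lipschitz continuous density $f_X$ (constant $L_f$) with $\inf_{[a,b]}f_X>0$; $[a,b]=[-1,1]$ (0 is an interior point) or $[a,b]=[0,1]$ (0 is a boundary point). Assumption 2: with $\psi_n=n^{-1/(2S+1)}\log n$, $m\in\Theta_0(M_S,r_S,\psi_n)$, the set of functions $\theta$ on $[a,b]$ such that $\big|\theta(\epsilon)-\theta(0)-\sum_{s=1}^S\frac{\theta^{(s)}(0)}{s!}\epsilon^s\big|\le M_S\,r_S(|\epsilon|)\,|\epsilon|^S$ for all $|\epsilon|\le\psi_n$ (with $\epsilon\in[a,b]$), where $\theta^{(s)}(0)$ is the ordinary (one-sided at a boundary point) derivative; $r_S:[0,\infty)\to[0,\infty)$ is nondecreasing, does not depend on $\theta$, and $r_S(t)\to0$ as $t\downarrow0$; $M_S>0$ is a constant not depending on $\theta,n,h$. $L_m$ denotes the local Lipschitz constant of $m$ at $0$. The variance function $V$ is Lipschitz on $[a,b]$ (constant $L_V$) and $V(0)>0$. Assumption 3: for some constant $\varsigma>4+\frac1S$, $\max_{1\le i\le n}\mathbb E[|\varepsilon_i|^\varsigma|X_i]\le E_\varsigma<\infty$ a.s., where $E_\varsigma>0$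 does not depend on $n$. Kernel: $K$ is a kernel supported on $[-1,1]$, $\|K\|_\infty\le1$, Lipschitz continuous, continuously differentiable on $[-1,1]$ except at finitely many points, with bounded first derivative on each differentiability interval. With $r(u)=(1,u,\dots,u^S)^\top$ the matrices $\int_{-1}^1K(u)r(u)r(u)^\top du$ and $\int_0^1K(u)r(u)r(u)^\top du$ are assumed non-singular. Local polynomial estimator of order $S$: $\hat m_h(x)=\sum_{i=1}^nW_{ih}(x)Y_i$, $W_{ih}(x)=\mathbf e_0^\top \mathbf M_{1h}^{-1}K(\frac{X_i-x}h)r(\frac{X_i-x}h)$, $\mathbf M_{1h}=\sum_{i=1}^nK(\frac{X_i-x}h)r(\frac{X_i-x}h)r^\top(\frac{X_i-x}h)$, $\mathbf e_0=(1,0,\dots,0)^\top\in\mathbb R^{S+1}$. The infimum is over the regression function $m$, all other features of the model being fixed. *)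

theory Defs
  imports
    "HOL-Probability.Probability"
    "HOL-Library.Landau_Symbols"
    "Jordan_Normal_Form.Gauss_Jordan_Elimination"
begin

unbundle no vec_syntax

section \<open>The smoothness class\<close>

text \<open>Iterated derivative relative to an interval \<open>J\<close>; at an endpoint of \<open>J\<close> it is one-sided.\<close>

primrec deriv_within :: "real set \<Rightarrow> nat \<Rightarrow> (real \<Rightarrow> real) \<Rightarrow> real \<Rightarrow> real" where
  "deriv_within J 0 f = f"
| "deriv_within J (Suc s) f = (\<lambda>x. vector_derivative (deriv_within J s f) (at x within J))"

text \<open>The derivatives at \<open>0\<close> up to order \<open>S\<close> exist in the ordinary sense: those of order below \<open>S\<close>
  exist near \<open>0\<close>, the one of order \<open>S\<close> exists at \<open>0\<close>.\<close>

definition differentiable_at0 :: "real set \<Rightarrow> nat \<Rightarrow> (real \<Rightarrow> real) \<Rightarrow> bool" where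
  "differentiable_at0 J S f \<longleftrightarrow>
     (\<forall>s<S. deriv_within J s f differentiable (at 0 within J)) \<and>
     (\<forall>s. Suc s < S \<longrightarrow>
        (\<forall>\<^sub>F x in at 0 within J. deriv_within J s f differentiable (at x within J)))"

text \<open>Functions on \<open>J\<close> are represented by their extensions to the reals; only the values on \<open>J\<close>
  matter. Borel measurability is needed for \<open>m(X\<^sub>i)\<close> to be a random variable.\<close>

definition Theta0 :: "real set \<Rightarrow> nat \<Rightarrow> real \<Rightarrow> (real \<Rightarrow> real) \<Rightarrow> real \<Rightarrow> (real \<Rightarrow> real) set" where
  "Theta0 J S M\<^sub>S r\<^sub>S \<psi> =
     {\<theta>. \<theta> \<in> borel_measurable (restrict_space borel J) \<and> differentiable_at0 J S \<theta> \<and>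
         (\<forall>e\<in>J. \<bar>e\<bar> \<le> \<psi> \<longrightarrow>
            \<bar>\<theta> e - \<theta> 0 - (\<Sum>s=1..S. deriv_within J s \<theta> 0 / fact s * e ^ s)\<bar>
              \<le> M\<^sub>S * r\<^sub>S \<bar>e\<bar> * \<bar>e\<bar> ^ S)}"

definition psi_n :: "nat \<Rightarrow> nat \<Rightarrow> real" where
  "psi_n S n = real n powr (- (1 / (2 * real S + 1))) * ln (real n)"

section \<open>The kernel\<close>

definition kernel_moment_mat :: "nat \<Rightarrow> (real \<Rightarrow> real) \<Rightarrow> real set \<Rightarrow> real mat" where
  "kernel_moment_mat S K A =
     Matrix.mat (S + 1) (S + 1) (\<lambda>(s, t). LINT u:A|lborel. K u * u ^ s * u ^ t)"

text \<open>Lipschitz continuity is required on the support only, so that \<open>K\<close> may jump at \<open>\<plusminus>1\<close>, as the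
  uniform kernel does. As there are finitely many exceptional points, a derivative bounded on each of
  the complementary intervals is the same as a derivative bounded on their union.\<close>

definition kernel_cond :: "nat \<Rightarrow> (real \<Rightarrow> real) \<Rightarrow> bool" where
  "kernel_cond S K \<longleftrightarrow>
     (\<forall>u. u \<notin> {-1..1} \<longrightarrow> K u = 0) \<and>
     (\<forall>u. \<bar>K u\<bar> \<le> 1) \<and>
     (\<exists>L. L-lipschitz_on {-1..1} K) \<and>
     (\<exists>D K'. finite D \<and>
        (\<forall>u\<in>{-1..1} - D. (K has_real_derivative K' u) (at u within {-1..1})) \<and>
        continuous_on ({-1..1} - D) K' \<and> bounded (K' ` ({-1..1} - D))) \<and>
     invertible_mat (kernel_moment_mat S K {-1..1}) \<and>
     invertible_mat (kernel_moment_mat S K {0..1})"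

section \<open>Local polynomial estimation from data \<open>(x\<^sub>i, y\<^sub>i)\<close>, \<open>i = 1, \<dots>, n\<close>\<close>

definition monomials :: "nat \<Rightarrow> real \<Rightarrow> real Matrix.vec" where
  "monomials S u = Matrix.vec (S + 1) (\<lambda>s. u ^ s)"

definition design_mat ::
  "nat \<Rightarrow> (real \<Rightarrow> real) \<Rightarrow> nat \<Rightarrow> real \<Rightarrow> (nat \<Rightarrow> real) \<Rightarrow> real \<Rightarrow> real mat" where
  "design_mat S K n h x x0 =
     Matrix.mat (S + 1) (S + 1) (\<lambda>(s, t). \<Sum>i=1..n.
       let u = (x i - x0) / h
       in K u * vec_index (monomials S u) s * vec_index (monomials S u) t)"

text \<open>If the design matrix is singular, all weights are \<open>0\<close> by convention.\<close>

definition lp_weight ::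
  "nat \<Rightarrow> (real \<Rightarrow> real) \<Rightarrow> nat \<Rightarrow> real \<Rightarrow> (nat \<Rightarrow> real) \<Rightarrow> real \<Rightarrow> nat \<Rightarrow> real" where
  "lp_weight S K n h x x0 i =
     (case mat_inverse (design_mat S K n h x x0) of
        None \<Rightarrow> 0
      | Some B \<Rightarrow>
          (let u = (x i - x0) / h
           in scalar_prod (unit_vec (S + 1) 0) (B *\<^sub>v (K u \<cdot>\<^sub>v monomials S u))))"

definition lp_est ::
  "nat \<Rightarrow> (real \<Rightarrow> real) \<Rightarrow> nat \<Rightarrow> real \<Rightarrow> (nat \<Rightarrow> real) \<Rightarrow> (nat \<Rightarrow> real) \<Rightarrow> real \<Rightarrow> real" where
  "lp_est S K n h x y x0 = (\<Sum>i=1..n. lp_weight S K n h x x0 i * y i)"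

definition h_nv :: "nat \<Rightarrow> nat \<Rightarrow> real" where
  "h_nv S n = real n powr (- (1 / (2 * real S + 1)))"

definition m_hat ::
  "nat \<Rightarrow> (real \<Rightarrow> real) \<Rightarrow> nat \<Rightarrow> (nat \<Rightarrow> real) \<Rightarrow> (nat \<Rightarrow> real) \<Rightarrow> real" where
  "m_hat S K n x y = lp_est S K n (h_nv S n) x y 0"

definition CV_hat ::
  "nat \<Rightarrow> (real \<Rightarrow> real) \<Rightarrow> nat \<Rightarrow> (nat \<Rightarrow> real) \<Rightarrow> (nat \<Rightarrow> real) \<Rightarrow> real" where
  "CV_hat S K n x y =
     real n * h_nv S n *
       (\<Sum>i=1..n. (lp_weight S K n (h_nv S n) x 0 i)\<^sup>2 * (y i - m_hat S K n x y)\<^sup>2)"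

definition r_hat ::
  "nat \<Rightarrow> (real \<Rightarrow> real) \<Rightarrow> (nat \<Rightarrow> real) \<Rightarrow> nat \<Rightarrow> (nat \<Rightarrow> real) \<Rightarrow> (nat \<Rightarrow> real) \<Rightarrow> real \<Rightarrow> real" where
  "r_hat S K d n x y t =
     d n * (2 * ln (1 / t) * CV_hat S K n x y / real n) powr (real S / (2 * real S + 1))"

section \<open>The regression model\<close>

definition response ::
  "(real \<Rightarrow> real) \<Rightarrow> (nat \<Rightarrow> 'a \<Rightarrow> real) \<Rightarrow> (nat \<Rightarrow> 'a \<Rightarrow> real) \<Rightarrow> (real \<Rightarrow> real) \<Rightarrow> 'a \<Rightarrow> nat \<Rightarrow> real" where
  "response V X eps m \<omega> i = m (X i \<omega>) + sqrt (V (X i \<omega>)) * eps i \<omega>"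

text \<open>For each sample size \<open>n\<close> the observations \<open>i = 1, \<dots>, n\<close> live on a probability space \<open>M n\<close> of
  their own; a single infinite sequence of observations is the case where \<open>M\<close>, \<open>X\<close> and \<open>eps\<close> do not
  depend on \<open>n\<close>. All constants, the design density and the variance function are common to all \<open>n\<close>.\<close>

locale regression_model =
  fixes S :: nat
    and J :: "real set"
    and M :: "nat \<Rightarrow> 'a measure"
    and X eps :: "nat \<Rightarrow> nat \<Rightarrow> 'a \<Rightarrow> real"
    and fX V r\<^sub>S :: "real \<Rightarrow> real"
    and Lf LV M\<^sub>S q E\<^sub>q :: real
  assumes S_pos: "1 \<le> S"
    and J_cases: "J = {-1..1} \<or> J = {0..1}"
    and prob_space_M: "\<And>n. prob_space (M n)"
    and X_measurable: "\<And>n i. i \<in> {1..n} \<Longrightarrow> X n i \<in> borel_measurable (M n)"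
    and eps_measurable: "\<And>n i. i \<in> {1..n} \<Longrightarrow> eps n i \<in> borel_measurable (M n)"
    and X_in_J: "\<And>n i \<omega>. i \<in> {1..n} \<Longrightarrow> \<omega> \<in> space (M n) \<Longrightarrow> X n i \<omega> \<in> J"
    and X_density: "\<And>n i. i \<in> {1..n} \<Longrightarrow>
          distributed (M n) lborel (X n i) (\<lambda>x. ennreal (fX x * indicator J x))"
    and fX_lipschitz: "Lf-lipschitz_on J fX"
    and fX_inf_pos: "0 < (INF x\<in>J. fX x)"
    and r_S_nonneg: "\<And>t. 0 \<le> t \<Longrightarrow> 0 \<le> r\<^sub>S t"
    and r_S_mono: "mono_on {0..} r\<^sub>S"
    and r_S_tendsto: "(r\<^sub>S \<longlongrightarrow> 0) (at_right 0)"
    and Mbound_pos: "0 < M\<^sub>S"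
    and V_nonneg: "\<And>x. x \<in> J \<Longrightarrow> 0 \<le> V x"
    and V_lipschitz: "LV-lipschitz_on J V"
    and V_0_pos: "0 < V 0"
    and pairs_indep: "\<And>n m. m \<in> Theta0 J S M\<^sub>S r\<^sub>S (psi_n S n) \<Longrightarrow>
          prob_space.indep_vars (M n) (\<lambda>_. borel \<Otimes>\<^sub>M borel)
            (\<lambda>i \<omega>. (X n i \<omega>, response V (X n) (eps n) m \<omega> i)) {1..n}"
    and eps_integrable: "\<And>n i. i \<in> {1..n} \<Longrightarrow> integrable (M n) (eps n i)"
    and eps_sq_integrable: "\<And>n i. i \<in> {1..n} \<Longrightarrow> integrable (M n) (\<lambda>\<omega>. (eps n i \<omega>)\<^sup>2)"
    and eps_cond_mean: "\<And>n i. i \<in> {1..n} \<Longrightarrow>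
          AE \<omega> in M n. real_cond_exp (M n) (vimage_algebra (space (M n)) (X n i) borel)
            (eps n i) \<omega> = 0"
    and eps_cond_var: "\<And>n i. i \<in> {1..n} \<Longrightarrow>
          AE \<omega> in M n. real_cond_exp (M n) (vimage_algebra (space (M n)) (X n i) borel)
            (\<lambda>\<omega>. (eps n i \<omega>)\<^sup>2) \<omega> = 1"
    and moment_order: "4 + 1 / real S < q"
    and E_pos: "0 < E\<^sub>q"
    and eps_cond_moment: "\<And>n.
          AE \<omega> in M n. \<forall>i\<in>{1..n}.
            nn_cond_exp (M n) (vimage_algebra (space (M n)) (X n i) borel)
              (\<lambda>\<omega>. ennreal (\<bar>eps n i \<omega>\<bar> powr q)) \<omega> \<le> ennreal E\<^sub>q"

text \<open>Sub-Gaussian errors, with a variance proxy that depends neither on \<open>i\<close> nor on \<open>n\<close>.\<close>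

definition sub_gaussian_errors ::
  "(nat \<Rightarrow> 'a measure) \<Rightarrow> (nat \<Rightarrow> nat \<Rightarrow> 'a \<Rightarrow> real) \<Rightarrow> bool" where
  "sub_gaussian_errors M eps \<longleftrightarrow>
     (\<exists>\<sigma>>0. \<forall>n. \<forall>i\<in>{1..n}. \<forall>l::real.
        (\<integral>\<^sup>+ \<omega>. ennreal (exp (l * eps n i \<omega>)) \<partial>M n) \<le> ennreal (exp (l\<^sup>2 * \<sigma>\<^sup>2 / 2)))"

end

theory Submission
  imports Defs "Jordan_Normal_Form.Determinant"
begin

text \<open>
  Write \<open>h = n\<^bsup>-1/(2S+1)\<^esup>\<close> for the bandwidth. Then \<open>n h = h\<^bsup>-2S\<^esup>\<close>, so bias and standard
  deviation of the local polynomial estimator are both of order \<open>h\<^bsup>S\<^esup>\<close>, while the half-width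
  \<open>r_hat\<close> equals \<open>d\<^sub>n h\<^bsup>S\<^esup>\<close> up to the factor \<open>(2 log(1/t) C)\<^bsup>S/(2S+1)\<^esup>\<close>, where \<open>C\<close> is the
  variance estimate. Since \<open>d\<^sub>n\<close> tends to infinity, the coverage tends to \<open>1\<close>, uniformly over the
  smoothness class, as soon as the estimation error is \<open>O\<^sub>P(h\<^bsup>S\<^esup>)\<close> and \<open>C\<close> stays away from
  \<open>0\<close> in probability. As \<open>1 - \<alpha> < 1\<close>, the coverage exceeds \<open>1 - \<alpha>\<close> from some sample size on,
  and the coverage error may be taken to be exactly \<open>0\<close> from there on. Such a sequence is negligible
  at every rate, the exponential one included.

  The \<^emph>\<open>estimation error\<close> (\<open>lp_est_error\<close>) splits into three parts. The weights reproduce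
  polynomials of degree at most \<open>S\<close>, so the Taylor polynomial contributes nothing, however large its
  coefficients. The Taylor remainder is at most a constant times \<open>h\<^bsup>S\<^esup>\<close> in the window
  \<open>\<bar>x\<bar> \<le> h\<close>, and the absolute values of the weights sum to a bounded number. The noise enters through
  the \<open>S + 1\<close> sums \<open>\<Sum>\<^sub>i K(u\<^sub>i) u\<^sub>i\<^bsup>s\<^esup> e\<^sub>i\<close>, \<open>u\<^sub>i = X\<^sub>i / h\<close>, each a sum of independent centred
  variables with total variance \<open>O(n h)\<close>, multiplied by entries of the inverse design matrix. The
  design matrix divided by \<open>n h\<close> converges to an invertible matrix, so these entries are under control.

  The \<^emph>\<open>variance estimate\<close> (\<open>CV_lower_bound\<close>) needs an argument that is uniform over the class,
  because the derivatives of the regression function at \<open>0\<close> are unbounded there and the residuals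
  \<open>Y\<^sub>i - m_hat\<close> contain a polynomial \<open>p(u\<^sub>i)\<close> of degree at most \<open>S\<close> over which there is no control.
  Such a polynomial has constant sign on at least one of any \<open>S + 1\<close> disjoint intervals
  (\<open>polynomial_constant_sign\<close>). On that interval the errors of the same sign can only be enlarged by
  it, and a fixed fraction of the errors there is bounded away from \<open>0\<close> with that sign. Choosing the
  intervals inside a region where the equivalent kernel does not vanish
  (\<open>equivalent_kernel_nonzero\<close>) gives the lower bound. The fraction of large errors of either sign is
  bounded below by an inequality between the indicator of a half-line and a polynomial of degree four
  (\<open>quartic_indicator_bound\<close>), which turns conditional moments into a tail bound.

  All the probabilistic input is Chebyshev's inequality for sums of independent variables
  (\<open>indep_sum_Chebyshev\<close>), applied to finitely many sums over the window. It shows that the sample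
  has the deterministic properties collected in \<open>regular_sample\<close> with probability at least
  \<open>1 - \<alpha>\<close> for large \<open>n\<close>.
\<close>

section \<open>Continuity and measurability of matrix inversion\<close>

text \<open>The Leibniz formula exhibits the determinant as a polynomial in the entries. The same formula gives
  measurability below, and cofactors reduce the adjugate to determinants of smaller matrices.\<close>

lemma tendsto_det:
  fixes A :: "'b \<Rightarrow> real mat"
  assumes A: "\<And>k. A k \<in> carrier_mat n n" and B: "B \<in> carrier_mat n n"
    and lim: "\<And>i j. i < n \<Longrightarrow> j < n \<Longrightarrow> ((\<lambda>k. A k $$ (i, j)) \<longlongrightarrow> B $$ (i, j)) F"
  shows "((\<lambda>k. det (A k)) \<longlongrightarrow> det B) F"
proof -
  have "i < n \<Longrightarrow> p permutes {0..<n} \<Longrightarrow> p i < n" for i p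
    using permutes_in_image[of p "{0..<n}" i] by auto
  then show ?thesis
    unfolding det_def'[OF A] det_def'[OF B] by (intro tendsto_intros lim) auto
qed

lemma mat_delete_entries:
  assumes "A \<in> carrier_mat n n" "i < n" "j < n"
  shows "mat_delete A i j \<in> carrier_mat (n - 1) (n - 1)"
    and "\<And>k l. k < n - 1 \<Longrightarrow> l < n - 1 \<Longrightarrow>
      mat_delete A i j $$ (k, l) = A $$ (if k < i then k else Suc k, if l < j then l else Suc l)"
  using assms by (auto simp: mat_delete_def)

lemma tendsto_adj_mat:
  fixes A :: "'b \<Rightarrow> real mat"
  assumes A: "\<And>k. A k \<in> carrier_mat n n" and B: "B \<in> carrier_mat n n"
    and lim: "\<And>i j. i < n \<Longrightarrow> j < n \<Longrightarrow> ((\<lambda>k. A k $$ (i, j)) \<longlongrightarrow> B $$ (i, j)) F"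
    and ij: "i < n" "j < n"
  shows "((\<lambda>k. adj_mat (A k) $$ (i, j)) \<longlongrightarrow> adj_mat B $$ (i, j)) F"
proof -
  have dims: "dim_row (A k) = n" "dim_col (A k) = n" "dim_row B = n" "dim_col B = n" for k
    using A[of k] B by auto
  have "((\<lambda>k. det (mat_delete (A k) j i)) \<longlongrightarrow> det (mat_delete B j i)) F"
    using mat_delete_entries[OF A ij(2,1)] mat_delete_entries[OF B ij(2,1)]
    by (intro tendsto_det[where n = "n - 1"]) (auto intro!: lim)
  then show ?thesis
    using ij by (simp add: adj_mat_def dims cofactor_def tendsto_mult_left)
qed

lemma borel_measurable_det:
  fixes A :: "'b \<Rightarrow> real mat"
  assumes A: "\<And>\<omega>. A \<omega> \<in> carrier_mat n n"
    and meas: "\<And>i j. i < n \<Longrightarrow> j < n \<Longrightarrow> (\<lambda>\<omega>. A \<omega> $$ (i, j)) \<in> borel_measurable M"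
  shows "(\<lambda>\<omega>. det (A \<omega>)) \<in> borel_measurable M"
proof -
  have "i < n \<Longrightarrow> p permutes {0..<n} \<Longrightarrow> p i < n" for i p
    using permutes_in_image[of p "{0..<n}" i] by auto
  then show ?thesis
    unfolding det_def'[OF A]
    by (intro borel_measurable_sum borel_measurable_times borel_measurable_prod
        borel_measurable_const meas) auto
qed

lemma borel_measurable_adj_mat:
  fixes A :: "'b \<Rightarrow> real mat"
  assumes A: "\<And>\<omega>. A \<omega> \<in> carrier_mat n n"
    and meas: "\<And>i j. i < n \<Longrightarrow> j < n \<Longrightarrow> (\<lambda>\<omega>. A \<omega> $$ (i, j)) \<in> borel_measurable M"
    and ij: "i < n" "j < n"
  shows "(\<lambda>\<omega>. adj_mat (A \<omega>) $$ (i, j)) \<in> borel_measurable M"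
proof -
  have dims: "dim_row (A \<omega>) = n" "dim_col (A \<omega>) = n" for \<omega>
    using A[of \<omega>] by auto
  have "(\<lambda>\<omega>. det (mat_delete (A \<omega>) j i)) \<in> borel_measurable M"
    using mat_delete_entries[OF A ij(2,1)]
    by (intro borel_measurable_det[where n = "n - 1"]) (auto intro!: meas)
  then show ?thesis
    using ij by (simp add: adj_mat_def dims cofactor_def)
qed

text \<open>Cramer's rule: an inverse is the adjugate divided by the determinant. All statements about inverse
  design matrices are phrased with this quotient, which is explicit enough to be continuous and
  measurable in the entries.\<close>

lemma right_inverse_entry:
  fixes A B :: "real mat"
  assumes A: "A \<in> carrier_mat n n" and B: "B \<in> carrier_mat n n" and AB: "A * B = 1\<^sub>m n"
  shows "det A \<noteq> 0" and "i < n \<Longrightarrow> j < n \<Longrightarrow> B $$ (i, j) = adj_mat A $$ (i, j) / det A"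
proof -
  have "det A * det B = 1"
    using det_mult[OF A B] AB by simp
  then show nz: "det A \<noteq> 0" by auto
  assume ij: "i < n" "j < n"
  have "adj_mat A = adj_mat A * (A * B)"
    using AB adj_mat(1)[OF A] by simp
  also have "\<dots> = (adj_mat A * A) * B"
    using A B adj_mat(1)[OF A] by simp
  also have "\<dots> = det A \<cdot>\<^sub>m B"
    using adj_mat(3)[OF A] B mult_smult_assoc_mat[OF one_carrier_mat B, of "det A"] by simp
  finally have "adj_mat A $$ (i, j) = det A * B $$ (i, j)"
    using ij B by simp
  then show "B $$ (i, j) = adj_mat A $$ (i, j) / det A"
    using nz by simp
qed

lemma mat_inverse_eq_Some:
  fixes A :: "real mat"
  assumes A: "A \<in> carrier_mat n n" and nz: "det A \<noteq> 0"
  obtains B where "mat_inverse A = Some B" "B \<in> carrier_mat n n" "A * B = 1\<^sub>m n" "B * A = 1\<^sub>m n"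
proof (cases "mat_inverse A")
  case None
  have "A \<in> Units (ring_mat TYPE(real) n ())"
    using det_non_zero_imp_unit[OF A nz] .
  with mat_inverse(1)[OF A None, of "()"] show ?thesis by blast
next
  case (Some B)
  then show ?thesis using mat_inverse(2)[OF A Some] that by blast
qed

text \<open>Dimensions of matrices are values and not types, so there is no topology on the matrices to refer to.
  A sequence of counterexamples with \<open>\<delta> = 1 / (k + 1)\<close> would converge entrywise to \<open>G\<close>, against
  the convergence of determinants and adjugates.\<close>

lemma inverse_entries_continuous:
  fixes G :: "real mat"
  assumes G: "G \<in> carrier_mat n n" and nz: "det G \<noteq> 0" and "\<epsilon> > 0"
  shows "\<exists>\<delta>>0. \<forall>A\<in>carrier_mat n n. (\<forall>i<n. \<forall>j<n. \<bar>A $$ (i, j) - G $$ (i, j)\<bar> \<le> \<delta>) \<longrightarrow>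
           det A \<noteq> 0 \<and> (\<forall>i<n. \<forall>j<n.
             \<bar>adj_mat A $$ (i, j) / det A - adj_mat G $$ (i, j) / det G\<bar> < \<epsilon>)"
proof (rule ccontr)
  let ?near = "\<lambda>\<delta> A. \<forall>i<n. \<forall>j<n. \<bar>A $$ (i, j) - G $$ (i, j)\<bar> \<le> (\<delta>::real)"
  let ?good = "\<lambda>A. det A \<noteq> 0 \<and> (\<forall>i<n. \<forall>j<n.
             \<bar>adj_mat A $$ (i, j) / det A - adj_mat G $$ (i, j) / det G\<bar> < \<epsilon>)"
  assume "\<not> ?thesis"
  then have "\<exists>A\<in>carrier_mat n n. ?near (1 / Suc k) A \<and> \<not> ?good A" for k
    by (metis of_nat_0_less_iff zero_less_Suc zero_less_divide_1_iff)
  then obtain A where A: "\<And>k. A k \<in> carrier_mat n n"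
    and near: "\<And>k. ?near (1 / Suc k) (A k)" and bad: "\<And>k. \<not> ?good (A k)"
    by metis
  have lim: "(\<lambda>k. A k $$ (i, j)) \<longlonglongrightarrow> G $$ (i, j)" if "i < n" "j < n" for i j
  proof (rule LIM_zero_cancel, rule tendsto_rabs_zero_cancel, rule tendsto_sandwich[OF _ _ tendsto_const])
    show "\<forall>\<^sub>F k in sequentially. \<bar>A k $$ (i, j) - G $$ (i, j)\<bar> \<le> 1 / Suc k"
      using near that by (intro always_eventually) blast
    show "(\<lambda>k. 1 / Suc k :: real) \<longlonglongrightarrow> 0"
      using LIMSEQ_inverse_real_of_nat by (simp add: inverse_eq_divide)
  qed auto
  note det_lim = tendsto_det[OF A G lim]
  have det_nz: "\<forall>\<^sub>F k in sequentially. det (A k) \<noteq> 0"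
    using tendsto_imp_eventually_ne[OF det_lim nz] .
  have "\<forall>\<^sub>F k in sequentially. \<bar>adj_mat (A k) $$ (i, j) / det (A k) - adj_mat G $$ (i, j) / det G\<bar> < \<epsilon>"
    if "i < n" "j < n" for i j
  proof -
    have "(\<lambda>k. adj_mat (A k) $$ (i, j) / det (A k)) \<longlonglongrightarrow> adj_mat G $$ (i, j) / det G"
      by (intro tendsto_divide det_lim nz tendsto_adj_mat[OF A G lim that])
    from tendstoD[OF this \<open>\<epsilon> > 0\<close>] show ?thesis by (simp add: dist_real_def)
  qed
  then have "\<forall>\<^sub>F k in sequentially. \<forall>i\<in>{..<n}. \<forall>j\<in>{..<n}.
      \<bar>adj_mat (A k) $$ (i, j) / det (A k) - adj_mat G $$ (i, j) / det G\<bar> < \<epsilon>"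
    by (intro eventually_ball_finite ballI) auto
  with det_nz have "\<forall>\<^sub>F k in sequentially. ?good (A k)"
    by eventually_elim auto
  then show False using bad by auto
qed

lemma inverse_entry_smult:
  fixes A :: "real mat"
  assumes A: "A \<in> carrier_mat n n" and "c \<noteq> 0" and nz: "det (c \<cdot>\<^sub>m A) \<noteq> 0" and ij: "i < n" "j < n"
  shows "det A \<noteq> 0" and "adj_mat A $$ (i, j) / det A
    = c * (adj_mat (c \<cdot>\<^sub>m A) $$ (i, j) / det (c \<cdot>\<^sub>m A))"
proof -
  have cA: "c \<cdot>\<^sub>m A \<in> carrier_mat n n" using A by simp
  obtain B where B: "B \<in> carrier_mat n n" "(c \<cdot>\<^sub>m A) * B = 1\<^sub>m n"
    using mat_inverse_eq_Some[OF cA nz] by metis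
  have "A * (c \<cdot>\<^sub>m B) = 1\<^sub>m n"
    using B(2) mult_smult_distrib[OF A B(1), of c] mult_smult_assoc_mat[OF A B(1), of c] by simp
  note inv = right_inverse_entry[OF A smult_carrier_mat[OF B(1)] this]
  show "det A \<noteq> 0" by (rule inv(1))
  have "adj_mat A $$ (i, j) / det A = c * B $$ (i, j)"
    using inv(2)[OF ij] ij B(1) by simp
  then show "adj_mat A $$ (i, j) / det A
    = c * (adj_mat (c \<cdot>\<^sub>m A) $$ (i, j) / det (c \<cdot>\<^sub>m A))"
    by (simp only: right_inverse_entry(2)[OF cA B ij])
qed

lemma invertible_mat_det_nonzero:
  fixes A :: "real mat"
  assumes "A \<in> carrier_mat n n" "invertible_mat A"
  shows "det A \<noteq> 0"
proof -
  obtain B where B: "A * B = 1\<^sub>m n" "B * A = 1\<^sub>m (dim_row B)"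
    using assms by (auto simp: invertible_mat_def inverts_mat_def)
  have "dim_col B = n" using B(1) by (metis index_mult_mat(3) index_one_mat(3))
  moreover have "dim_row B = n"
    using B(2) assms(1) by (metis carrier_matD(2) index_mult_mat(3) index_one_mat(3))
  ultimately show ?thesis using right_inverse_entry(1)[OF assms(1) _ B(1)] by blast
qed

section \<open>The weights of the local polynomial estimator\<close>

lemma design_mat_carrier: "design_mat S K n h x x0 \<in> carrier_mat (S + 1) (S + 1)"
  by (simp add: design_mat_def)

lemma design_mat_entry:
  assumes "s \<le> S" "t \<le> S"
  shows "design_mat S K n h x x0 $$ (s, t) =
    (\<Sum>i=1..n. K ((x i - x0) / h) * ((x i - x0) / h) ^ s * ((x i - x0) / h) ^ t)"
  using assms by (simp add: design_mat_def monomials_def Let_def)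

lemma lp_weight_inverse:
  assumes "det (design_mat S K n h x x0) \<noteq> 0"
  shows "lp_weight S K n h x x0 i =
    (\<Sum>s\<le>S. adj_mat (design_mat S K n h x x0) $$ (0, s) / det (design_mat S K n h x x0)
       * (K ((x i - x0) / h) * ((x i - x0) / h) ^ s))"
proof -
  let ?D = "design_mat S K n h x x0" and ?u = "(x i - x0) / h"
  obtain B where B: "mat_inverse ?D = Some B" "B \<in> carrier_mat (S + 1) (S + 1)" "?D * B = 1\<^sub>m (S + 1)"
    using mat_inverse_eq_Some[OF design_mat_carrier assms] by blast
  have "lp_weight S K n h x x0 i
      = scalar_prod (unit_vec (S + 1) 0) (B *\<^sub>v (K ?u \<cdot>\<^sub>v monomials S ?u))"
    by (simp add: lp_weight_def B(1) Let_def)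
  also have "\<dots> = (B *\<^sub>v (K ?u \<cdot>\<^sub>v monomials S ?u)) $ 0"
    using B(2) by (intro scalar_prod_left_unit) (auto simp: monomials_def)
  also have "\<dots> = (\<Sum>s\<in>{0..<S+1}. B $$ (0, s) * (K ?u * ?u ^ s))"
    using B(2) by (simp add: scalar_prod_def monomials_def)
  also have "\<dots> = (\<Sum>s\<le>S. B $$ (0, s) * (K ?u * ?u ^ s))"
    by (intro sum.cong) auto
  finally show ?thesis
    using right_inverse_entry(2)[OF design_mat_carrier B(2,3)] by simp
qed

lemma lp_weight_singular:
  assumes "det (design_mat S K n h x x0) = 0"
  shows "lp_weight S K n h x x0 i = 0"
proof (cases "mat_inverse (design_mat S K n h x x0)")
  case (Some B)
  then show ?thesis
    using mat_inverse(2)[OF design_mat_carrier Some] right_inverse_entry(1)[OF design_mat_carrier] assms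
    by blast
qed (simp add: lp_weight_def)

text \<open>A weighted least squares fit of degree \<open>S\<close> returns polynomials of degree at most \<open>S\<close> unchanged:
  the left-hand side is the entry \<open>(0, t)\<close> of the inverse design matrix times the design matrix.\<close>

lemma lp_weight_reproduces:
  assumes nz: "det (design_mat S K n h x x0) \<noteq> 0" and "t \<le> S"
  shows "(\<Sum>i=1..n. lp_weight S K n h x x0 i * ((x i - x0) / h) ^ t) = (if t = 0 then 1 else 0)"
proof -
  let ?D = "design_mat S K n h x x0" and ?u = "\<lambda>i. (x i - x0) / h"
  let ?b = "\<lambda>s. adj_mat ?D $$ (0, s) / det ?D"
  have "(\<Sum>i=1..n. lp_weight S K n h x x0 i * ?u i ^ t)
      = (\<Sum>i=1..n. \<Sum>s\<le>S. ?b s * (K (?u i) * ?u i ^ s * ?u i ^ t))"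
    by (simp add: lp_weight_inverse[OF nz] sum_distrib_right mult.assoc)
  also have "\<dots> = (\<Sum>s\<le>S. ?b s * ?D $$ (s, t))"
    using \<open>t \<le> S\<close> by (subst sum.swap) (simp add: sum_distrib_left design_mat_entry)
  also have "\<dots> = (\<Sum>s\<le>S. adj_mat ?D $$ (0, s) * ?D $$ (s, t)) / det ?D"
    by (simp add: sum_divide_distrib)
  also have "(\<Sum>s\<le>S. adj_mat ?D $$ (0, s) * ?D $$ (s, t)) = (adj_mat ?D * ?D) $$ (0, t)"
    using \<open>t \<le> S\<close> adj_mat(1)[OF design_mat_carrier, of S K n h x x0]
      design_mat_carrier[of S K n h x x0]
    by (auto simp: scalar_prod_def times_mat_def atLeast0_atMost_Suc atMost_atLeast0 atLeastLessThanSuc_atLeastAtMost)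
  also have "\<dots> = (if t = 0 then det ?D else 0)"
    using \<open>t \<le> S\<close> by (simp add: adj_mat(3)[OF design_mat_carrier])
  finally show ?thesis using nz by simp
qed

lemma kernel_moment_mat_carrier: "kernel_moment_mat S K A \<in> carrier_mat (S + 1) (S + 1)"
  by (simp add: kernel_moment_mat_def)

lemma kernel_measurable:
  assumes "kernel_cond S K"
  shows "K \<in> borel_measurable borel"
proof -
  have Ksupp: "K u = 0" if "u \<notin> {-1..1}" for u
    using assms that unfolding kernel_cond_def by blast
  obtain L where "L-lipschitz_on {-1..1} K" using assms by (auto simp: kernel_cond_def)
  then have "continuous_on {-1..1} K" by (rule lipschitz_on_continuous_on)
  then have "(\<lambda>u. indicator {-1..1} u *\<^sub>R K u) \<in> borel_measurable borel"
    by (intro borel_measurable_continuous_on_indicator) auto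
  moreover have "(\<lambda>u. indicator {-1..1} u *\<^sub>R K u) = K"
  proof (rule ext)
    fix u
    show "indicator {-1..1} u *\<^sub>R K u = K u"
      using Ksupp[of u] by (cases "u \<in> {-1..1}") auto
  qed
  ultimately show ?thesis by simp
qed

text \<open>The function \<open>K(u) \<Sum>\<^sub>s b\<^sub>s u\<^bsup>s\<^esup>\<close>, with \<open>b\<close> the first row of the inverse limiting design matrix, is
  the limit of the rescaled weights (the equivalent kernel). It integrates to \<open>1 / f0\<close> over \<open>J\<close>, by the
  entry \<open>(0, 0)\<close> of the identity \<open>G\<^bsup>-1\<^esup> G = 1\<close>. Hence it is nonzero at some point of \<open>J\<close> and, by
  continuity, bounded away from \<open>0\<close> on a nondegenerate interval.\<close>

lemma equivalent_kernel_nonzero: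
  assumes K: "kernel_cond S K" and J: "J = {-1..1} \<or> J = {0..1}" and f0: "0 < f0"
    and G: "G = f0 \<cdot>\<^sub>m kernel_moment_mat S K J" and det: "det G \<noteq> 0"
  obtains \<kappa> c1 c2 where "0 < \<kappa>" "c1 < c2" "{c1..c2} \<subseteq> J"
    "\<And>u. u \<in> {c1..c2} \<Longrightarrow> \<kappa> \<le> \<bar>K u * (\<Sum>s\<le>S. adj_mat G $$ (0, s) / det G * u ^ s)\<bar>"
proof -
  define b where "b s = adj_mat G $$ (0, s) / det G" for s
  define g where "g u = K u * (\<Sum>s\<le>S. b s * u ^ s)" for u
  have Gc: "G \<in> carrier_mat (S + 1) (S + 1)" by (simp add: G kernel_moment_mat_def)
  have J1: "J \<subseteq> {-1..1}" "J \<in> sets lborel" "emeasure lborel J < \<infinity>" using J by auto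
  have Kcont: "continuous_on {-1..1} K"
    using K lipschitz_on_continuous_on by (auto simp: kernel_cond_def)
  have int: "set_integrable lborel J (\<lambda>u. K u * u ^ s)" for s
  proof -
    have "compact J" using J by auto
    moreover have "continuous_on J (\<lambda>u. K u * u ^ s)"
      by (intro continuous_intros continuous_on_subset[OF Kcont J1(1)])
    ultimately show ?thesis
      using borel_integrable_compact[of J "\<lambda>u. K u * u ^ s"] by (simp add: set_integrable_def)
  qed
  have "\<exists>u\<in>J. g u \<noteq> 0"
  proof (rule ccontr)
    assume "\<not> ?thesis"
    then have "(\<lambda>u. indicator J u *\<^sub>R g u) = (\<lambda>u. 0)"
      by (auto simp: indicator_def)
    then have "(LINT u:J|lborel. g u) = 0"
      by (simp add: set_lebesgue_integral_def)
    moreover have "(LINT u:J|lborel. g u) = (LINT u:J|lborel. (\<Sum>s\<le>S. b s * (K u * u ^ s)))"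
      by (simp add: g_def sum_distrib_left mult_ac)
    also have "\<dots> = (LINT u|lborel. (\<Sum>s\<le>S. b s * (indicator J u *\<^sub>R (K u * u ^ s))))"
      by (simp add: set_lebesgue_integral_def sum_distrib_left mult_ac)
    also have "\<dots> = (\<Sum>s\<le>S. b s * (LINT u:J|lborel. K u * u ^ s))"
      using int unfolding set_integrable_def set_lebesgue_integral_def
      by (subst Bochner_Integration.integral_sum) auto
    finally have "(\<Sum>s\<le>S. b s * (LINT u:J|lborel. K u * u ^ s)) = 0" by simp
    moreover have "f0 * (\<Sum>s\<le>S. b s * (LINT u:J|lborel. K u * u ^ s)) = (\<Sum>s\<le>S. b s * G $$ (s, 0))"
      by (simp add: G kernel_moment_mat_def sum_distrib_left mult_ac)
    moreover have "(\<Sum>s\<le>S. b s * G $$ (s, 0)) = (adj_mat G * G) $$ (0, 0) / det G"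
      using adj_mat(1)[OF Gc] Gc
      by (auto simp: b_def scalar_prod_def times_mat_def sum_divide_distrib atLeast0_atMost_Suc
          atMost_atLeast0 atLeastLessThanSuc_atLeastAtMost)
    moreover have "(adj_mat G * G) $$ (0, 0) = det G"
      by (simp add: adj_mat(3)[OF Gc])
    ultimately show False using det by simp
  qed
  then obtain u0 where u0: "u0 \<in> J" "g u0 \<noteq> 0" by blast
  have "continuous_on J g"
    unfolding g_def by (intro continuous_intros continuous_on_subset[OF Kcont J1(1)])
  then obtain \<epsilon> where eps: "0 < \<epsilon>" "\<And>u. u \<in> J \<Longrightarrow> \<bar>u - u0\<bar> < \<epsilon> \<Longrightarrow> \<bar>g u - g u0\<bar> < \<bar>g u0\<bar> / 2"
    using u0 unfolding continuous_on_iff dist_real_def by (metis half_gt_zero zero_less_abs_iff)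
  define d where "d = min 1 (\<epsilon> / 2)"
  have d: "0 < d" "d \<le> 1" "d < \<epsilon>" using eps(1) by (auto simp: d_def min_def)
  \<comment> \<open>The interval extends to the right of \<open>u0\<close>, except when \<open>u0\<close> is the right endpoint of \<open>J\<close>.\<close>
  define c1 c2 where "c1 = (if u0 < 1 then u0 else 1 - d)" and "c2 = min 1 (c1 + d)"
  have c: "c1 < c2" "{c1..c2} \<subseteq> J" "\<And>u. u \<in> {c1..c2} \<Longrightarrow> \<bar>u - u0\<bar> < \<epsilon>"
    using d u0(1) J by (auto simp: c1_def c2_def min_def abs_if split: if_splits)
  show ?thesis
  proof (rule that[of "\<bar>g u0\<bar> / 2" c1 c2])
    fix u assume "u \<in> {c1..c2}"
    then have "\<bar>g u - g u0\<bar> < \<bar>g u0\<bar> / 2" using eps(2) c(2,3) by blast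
    then have "\<bar>g u0\<bar> / 2 \<le> \<bar>g u\<bar>" by linarith
    then show "\<bar>g u0\<bar> / 2 \<le> \<bar>K u * (\<Sum>s\<le>S. adj_mat G $$ (0, s) / det G * u ^ s)\<bar>"
      by (simp add: g_def b_def)
  qed (use u0 c in auto)
qed

section \<open>Estimation error and variance estimate on a fixed sample\<close>

text \<open>Without a constant sign on \<open>I j\<close> the polynomial has a zero there, by connectedness. Zeros in all
  \<open>S + 1\<close> disjoint sets would be more than the degree allows.\<close>

lemma polynomial_constant_sign:
  fixes \<beta> :: "nat \<Rightarrow> real" and I :: "nat \<Rightarrow> real set"
  assumes disj: "\<And>i j. i \<le> S \<Longrightarrow> j \<le> S \<Longrightarrow> i \<noteq> j \<Longrightarrow> I i \<inter> I j = {}"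
    and conn: "\<And>j. j \<le> S \<Longrightarrow> connected (I j)"
  shows "\<exists>j\<le>S. \<exists>\<sigma>\<in>{1, -1}. \<forall>u\<in>I j. 0 \<le> \<sigma> * (\<Sum>s\<le>S. \<beta> s * u ^ s)"
proof (cases "\<forall>s\<le>S. \<beta> s = 0")
  case True
  then show ?thesis by auto
next
  case False
  then obtain k where k: "k \<le> S" "\<beta> k \<noteq> 0" by auto
  define p where "p u = (\<Sum>s\<le>S. \<beta> s * u ^ s)" for u
  have fin: "finite {u. p u = 0}" and card: "card {u. p u = 0} \<le> S"
    using polyfun_roots_finite[of \<beta> k S] polyfun_roots_card[of \<beta> k S] k by (auto simp: p_def)
  have "\<exists>j\<le>S. \<forall>u\<in>I j. p u \<noteq> 0"
  proof (rule ccontr)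
    assume "\<not> ?thesis"
    then obtain r where r: "\<And>j. j \<le> S \<Longrightarrow> r j \<in> I j \<and> p (r j) = 0" by metis
    have "inj_on r {..S}"
      using r disj by (intro inj_onI) (metis IntI atMost_iff empty_iff)
    then have "S + 1 = card (r ` {..S})" by (simp add: card_image)
    also have "\<dots> \<le> card {u. p u = 0}"
      using r by (intro card_mono fin) auto
    finally show False using card by simp
  qed
  then obtain j where j: "j \<le> S" "\<And>u. u \<in> I j \<Longrightarrow> p u \<noteq> 0" by blast
  have "continuous_on (I j) p"
    unfolding p_def by (intro continuous_intros)
  then have conn_p: "connected (p ` I j)"
    using conn[OF j(1)] by (rule connected_continuous_image)
  have "(\<forall>u\<in>I j. 0 \<le> p u) \<or> (\<forall>u\<in>I j. p u \<le> 0)"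
  proof (rule ccontr)
    assume "\<not> ?thesis"
    then obtain u v where "u \<in> I j" "v \<in> I j" "p u \<le> 0" "0 \<le> p v" by force
    then have "0 \<in> p ` I j"
      using connectedD_interval[OF conn_p, of "p u" "p v" 0] by blast
    then show False using j(2) by force
  qed
  then show ?thesis
  proof
    assume "\<forall>u\<in>I j. 0 \<le> p u"
    then show ?thesis using j(1) by (intro exI[of _ j] conjI bexI[of _ 1]) (auto simp: p_def)
  next
    assume "\<forall>u\<in>I j. p u \<le> 0"
    then show ?thesis using j(1) by (intro exI[of _ j] conjI bexI[of _ "-1"]) (auto simp: p_def)
  qed
qed

text \<open>The Taylor polynomial is written in the rescaled variable \<open>x / h\<close>, in which the weights reproduce
  polynomials. Nothing is said about the size of its higher coefficients.\<close>

lemma Theta0_taylor: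
  assumes m: "m \<in> Theta0 J S M\<^sub>S r\<^sub>S \<psi>" and h: "0 < h" "h \<le> \<psi>"
    and r: "mono_on {0..} r\<^sub>S" and M: "0 < M\<^sub>S" and r0: "\<And>t. 0 \<le> t \<Longrightarrow> 0 \<le> r\<^sub>S t"
  obtains c where "c 0 = m 0"
    and "\<And>x. x \<in> J \<Longrightarrow> \<bar>x\<bar> \<le> h \<Longrightarrow> \<bar>m x - (\<Sum>s\<le>S. c s * (x / h) ^ s)\<bar> \<le> M\<^sub>S * r\<^sub>S h * h ^ S"
proof -
  define c where "c s = (if s = 0 then m 0 else deriv_within J s m 0 / fact s * h ^ s)" for s
  have "\<bar>m x - (\<Sum>s\<le>S. c s * (x / h) ^ s)\<bar> \<le> M\<^sub>S * r\<^sub>S h * h ^ S"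
    if x: "x \<in> J" "\<bar>x\<bar> \<le> h" for x
  proof -
  have "(\<Sum>s\<le>S. c s * (x / h) ^ s) = m 0 + (\<Sum>s=1..S. deriv_within J s m 0 / fact s * x ^ s)"
  proof -
    have "{..S} = insert 0 {1..S}" by auto
    then show ?thesis using h by (auto simp: c_def power_divide intro!: sum.cong)
  qed
  then have "\<bar>m x - (\<Sum>s\<le>S. c s * (x / h) ^ s)\<bar> \<le> M\<^sub>S * r\<^sub>S \<bar>x\<bar> * \<bar>x\<bar> ^ S"
    using m x h unfolding Theta0_def by (force simp: algebra_simps)
  also have "\<dots> \<le> M\<^sub>S * r\<^sub>S h * h ^ S"
    using x h M r0[of "\<bar>x\<bar>"] r0[of h] mono_onD[OF r, of "\<bar>x\<bar>" h]
    by (intro mult_mono mult_left_mono power_mono) auto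
    finally show ?thesis .
  qed
  then show ?thesis by (intro that[of c]) (auto simp: c_def)
qed

text \<open>The factor \<open>n h\<close> makes the coefficients converge as the sample grows.\<close>

definition lp_coeff :: "nat \<Rightarrow> (real \<Rightarrow> real) \<Rightarrow> nat \<Rightarrow> real \<Rightarrow> (nat \<Rightarrow> real) \<Rightarrow> nat \<Rightarrow> real" where
  "lp_coeff S K n h x s =
     real n * h * (adj_mat (design_mat S K n h x 0) $$ (0, s) / det (design_mat S K n h x 0))"

lemma lp_weight_coeff:
  assumes "det (design_mat S K n h x 0) \<noteq> 0" "0 < n" "0 < h"
  shows "lp_weight S K n h x 0 i =
    K (x i / h) * (\<Sum>s\<le>S. lp_coeff S K n h x s * (x i / h) ^ s) / (real n * h)"
  using assms
  by (simp add: lp_weight_inverse lp_coeff_def sum_distrib_left sum_divide_distrib mult.assoc)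
     (simp add: mult_ac)

text \<open>The first term of the bound is the Taylor remainder \<open>\<rho>\<close> weighted by at most \<open>N n h\<close> observations in
  the window; the second is the noise. The Taylor polynomial itself is reproduced exactly.\<close>

lemma lp_est_error:
  assumes nh: "0 < n" "0 < h" and det: "det (design_mat S K n h x 0) \<noteq> 0"
    and coeff: "\<And>s. s \<le> S \<Longrightarrow> \<bar>lp_coeff S K n h x s\<bar> \<le> B"
    and K1: "\<And>u. \<bar>K u\<bar> \<le> 1" and Ksupp: "\<And>u. 1 < \<bar>u\<bar> \<Longrightarrow> K u = 0"
    and count: "real (card {i\<in>{1..n}. \<bar>x i / h\<bar> \<le> 1}) \<le> N * (real n * h)"
    and noise: "\<And>s. s \<le> S \<Longrightarrow> \<bar>\<Sum>i=1..n. K (x i / h) * (x i / h) ^ s * e i\<bar> \<le> R"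
    and y: "\<And>i. i \<in> {1..n} \<Longrightarrow> y i = m (x i) + e i"
    and taylor: "\<And>i. i \<in> {1..n} \<Longrightarrow> \<bar>x i\<bar> \<le> h \<Longrightarrow> \<bar>m (x i) - (\<Sum>s\<le>S. c s * (x i / h) ^ s)\<bar> \<le> \<rho>"
    and c0: "c 0 = m 0" and rho: "0 \<le> \<rho>"
  shows "\<bar>lp_est S K n h x y 0 - m 0\<bar> \<le> real (S + 1) * B * (N * \<rho> + R / (real n * h))"
proof -
  let ?u = "\<lambda>i. x i / h" and ?W = "lp_weight S K n h x 0" and ?b = "lp_coeff S K n h x"
  let ?p = "\<lambda>i. \<Sum>s\<le>S. c s * ?u i ^ s"
  have B0: "0 \<le> B" using coeff[of 0] by simp
  have nh_pos: "0 < real n * h" using nh by simp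
  have u_le: "\<bar>x i\<bar> \<le> h \<longleftrightarrow> \<bar>?u i\<bar> \<le> 1" for i using nh by (simp add: abs_divide)
  have W0: "?W i = 0" if "\<not> \<bar>?u i\<bar> \<le> 1" for i
    using that by (simp add: lp_weight_coeff[OF det nh] Ksupp)
  have W_le: "\<bar>?W i\<bar> \<le> real (S + 1) * B / (real n * h)" if "\<bar>?u i\<bar> \<le> 1" for i
  proof -
    have "\<bar>\<Sum>s\<le>S. ?b s * ?u i ^ s\<bar> \<le> (\<Sum>s\<le>S. \<bar>?b s * ?u i ^ s\<bar>)" by (rule sum_abs)
    also have "\<dots> \<le> (\<Sum>s\<le>S. B * 1)"
      using that coeff B0 unfolding abs_mult power_abs
      by (intro sum_mono mult_mono power_le_one) auto
    finally have "\<bar>\<Sum>s\<le>S. ?b s * ?u i ^ s\<bar> \<le> real (S + 1) * B" by simp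
    then have "\<bar>K (?u i)\<bar> * \<bar>\<Sum>s\<le>S. ?b s * ?u i ^ s\<bar> \<le> 1 * (real (S + 1) * B)"
      using K1 B0 by (intro mult_mono) auto
    then show ?thesis
      using nh_pos nh by (simp add: lp_weight_coeff[OF det nh] abs_mult divide_right_mono)
  qed
  have "(\<Sum>i=1..n. ?W i * ?p i) = (\<Sum>s\<le>S. c s * (\<Sum>i=1..n. ?W i * ?u i ^ s))"
    by (simp add: sum_distrib_left) (subst sum.swap, simp add: mult_ac)
  also have "\<dots> = (\<Sum>s\<le>S. if s = 0 then c 0 else 0)"
    using lp_weight_reproduces[OF det] by (intro sum.cong) auto
  also have "\<dots> = m 0" by (simp add: c0)
  finally have repro: "(\<Sum>i=1..n. ?W i * ?p i) = m 0" .
  have "lp_est S K n h x y 0 = (\<Sum>i=1..n. ?W i * ?p i + ?W i * (m (x i) - ?p i) + ?W i * e i)"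
    by (simp add: lp_est_def y algebra_simps)
  then have split: "lp_est S K n h x y 0 - m 0
      = (\<Sum>i=1..n. ?W i * (m (x i) - ?p i)) + (\<Sum>i=1..n. ?W i * e i)"
    using repro by (simp add: sum.distrib)
  have "\<bar>\<Sum>i=1..n. ?W i * (m (x i) - ?p i)\<bar> \<le> (\<Sum>i=1..n. \<bar>?W i * (m (x i) - ?p i)\<bar>)"
    by (rule sum_abs)
  also have "\<dots> \<le> (\<Sum>i=1..n. if \<bar>?u i\<bar> \<le> 1 then real (S + 1) * B / (real n * h) * \<rho> else 0)"
  proof (rule sum_mono)
    fix i assume i: "i \<in> {1..n}"
    show "\<bar>?W i * (m (x i) - ?p i)\<bar>
        \<le> (if \<bar>?u i\<bar> \<le> 1 then real (S + 1) * B / (real n * h) * \<rho> else 0)"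
    proof (cases "\<bar>?u i\<bar> \<le> 1")
      case True
      have "\<bar>?W i\<bar> * \<bar>m (x i) - ?p i\<bar> \<le> real (S + 1) * B / (real n * h) * \<rho>"
        using W_le[OF True] taylor[OF i] u_le True B0 nh_pos by (intro mult_mono) auto
      with True show ?thesis unfolding abs_mult by simp
    qed (use W0 in simp)
  qed
  also have "\<dots> = real (card {i\<in>{1..n}. \<bar>?u i\<bar> \<le> 1}) * (real (S + 1) * B / (real n * h) * \<rho>)"
    by (simp add: sum.If_cases Int_def)
  also have "\<dots> \<le> N * (real n * h) * (real (S + 1) * B / (real n * h) * \<rho>)"
    using count B0 nh_pos rho by (intro mult_right_mono) auto
  also have "\<dots> = real (S + 1) * B * (N * \<rho>)" using nh by simp
  finally have bias: "\<bar>\<Sum>i=1..n. ?W i * (m (x i) - ?p i)\<bar> \<le> real (S + 1) * B * (N * \<rho>)" .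
  have "?W i * e i = (\<Sum>s\<le>S. ?b s * (K (?u i) * ?u i ^ s * e i)) / (real n * h)" for i
  proof -
    have "?W i * e i = (K (?u i) * e i) * (\<Sum>s\<le>S. ?b s * ?u i ^ s) / (real n * h)"
      by (simp add: lp_weight_coeff[OF det nh])
    also have "(K (?u i) * e i) * (\<Sum>s\<le>S. ?b s * ?u i ^ s)
        = (\<Sum>s\<le>S. ?b s * (K (?u i) * ?u i ^ s * e i))"
      unfolding sum_distrib_left by (intro sum.cong refl) simp
    finally show ?thesis .
  qed
  then have "(\<Sum>i=1..n. ?W i * e i)
      = (\<Sum>i=1..n. \<Sum>s\<le>S. ?b s * (K (?u i) * ?u i ^ s * e i)) / (real n * h)"
    by (simp only: sum_divide_distrib[symmetric])
  also have "(\<Sum>i=1..n. \<Sum>s\<le>S. ?b s * (K (?u i) * ?u i ^ s * e i))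
      = (\<Sum>s\<le>S. ?b s * (\<Sum>i=1..n. K (?u i) * ?u i ^ s * e i))"
    by (subst sum.swap) (simp only: sum_distrib_left)
  finally have "\<bar>\<Sum>i=1..n. ?W i * e i\<bar>
      = \<bar>\<Sum>s\<le>S. ?b s * (\<Sum>i=1..n. K (?u i) * ?u i ^ s * e i)\<bar> / (real n * h)"
    using nh_pos by (simp only: abs_divide abs_of_pos)
  also have "\<dots> \<le> (\<Sum>s\<le>S. \<bar>?b s * (\<Sum>i=1..n. K (?u i) * ?u i ^ s * e i)\<bar>) / (real n * h)"
    using nh_pos by (intro divide_right_mono sum_abs) simp
  also have "\<dots> \<le> (\<Sum>s\<le>S. B * R) / (real n * h)"
    using noise coeff B0 nh_pos unfolding abs_mult
    by (intro divide_right_mono sum_mono mult_mono) auto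
  finally have "\<bar>\<Sum>i=1..n. ?W i * e i\<bar> \<le> real (S + 1) * B * (R / (real n * h))" by simp
  with bias show ?thesis
    unfolding split by (simp add: distrib_left)
qed

text \<open>The residual \<open>y\<^sub>i - a\<close> is the error \<open>e\<^sub>i\<close> plus a polynomial in \<open>u\<^sub>i\<close> plus a
  remainder of size at most \<open>\<tau> / 2\<close>. On an interval where the polynomial has constant sign \<open>\<sigma>\<close>, every
  observation with \<open>\<sigma> e\<^sub>i \<ge> \<tau>\<close> has a residual of absolute value at least \<open>\<tau> / 2\<close>. The bound is
  therefore uniform in the polynomial.\<close>

lemma CV_lower_bound:
  assumes nh: "0 < n" "0 < h" and det: "det (design_mat S K n h x 0) \<noteq> 0"
    and kappa: "0 \<le> \<kappa>" "\<And>j u. j \<le> S \<Longrightarrow> u \<in> I j \<Longrightarrow> \<kappa> \<le> \<bar>K u * (\<Sum>s\<le>S. lp_coeff S K n h x s * u ^ s)\<bar>"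
    and disj: "\<And>i j. i \<le> S \<Longrightarrow> j \<le> S \<Longrightarrow> i \<noteq> j \<Longrightarrow> I i \<inter> I j = {}"
    and conn: "\<And>j. j \<le> S \<Longrightarrow> connected (I j)"
    and bdd: "\<And>j. j \<le> S \<Longrightarrow> I j \<subseteq> {-1..1}"
    and count: "\<And>j \<sigma>. j \<le> S \<Longrightarrow> \<sigma> \<in> {1, -1} \<Longrightarrow>
        \<gamma> * (real n * h) \<le> real (card {i\<in>{1..n}. x i / h \<in> I j \<and> \<tau> \<le> \<sigma> * e i})"
    and y: "\<And>i. i \<in> {1..n} \<Longrightarrow> y i = m (x i) + e i"
    and taylor: "\<And>i. i \<in> {1..n} \<Longrightarrow> \<bar>x i\<bar> \<le> h \<Longrightarrow> \<bar>m (x i) - (\<Sum>s\<le>S. c s * (x i / h) ^ s)\<bar> \<le> \<tau> / 2"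
    and tau: "0 < \<tau>"
  shows "\<gamma> * (\<kappa> * (\<tau> / 2))\<^sup>2 \<le> real n * h * (\<Sum>i=1..n. (lp_weight S K n h x 0 i)\<^sup>2 * (y i - a)\<^sup>2)"
proof -
  let ?u = "\<lambda>i. x i / h" and ?W = "lp_weight S K n h x 0"
  \<comment> \<open>Subtracting the constant \<open>a\<close> from the Taylor polynomial leaves a polynomial of degree at most \<open>S\<close>.\<close>
  define \<beta> where "\<beta> s = (if s = 0 then c 0 - a else c s)" for s
  have nh_pos: "0 < real n * h" using nh by simp
  have q: "(\<Sum>s\<le>S. \<beta> s * u ^ s) = (\<Sum>s\<le>S. c s * u ^ s) - a" for u :: real
    unfolding \<beta>_def by (subst (1 2) sum.atMost_shift) simp
  have "\<exists>j\<le>S. \<exists>\<sigma>\<in>{1, -1}. \<forall>u\<in>I j. 0 \<le> \<sigma> * (\<Sum>s\<le>S. \<beta> s * u ^ s)"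
    by (rule polynomial_constant_sign) (fact disj conn)+
  then obtain j \<sigma> where j: "j \<le> S" and \<sigma>: "\<sigma> \<in> {1, -1::real}"
    and sign: "\<And>u. u \<in> I j \<Longrightarrow> 0 \<le> \<sigma> * (\<Sum>s\<le>S. \<beta> s * u ^ s)"
    by (elim exE conjE bexE) blast
  define T where "T = {i\<in>{1..n}. ?u i \<in> I j \<and> \<tau> \<le> \<sigma> * e i}"
  have summand: "(\<kappa> * (\<tau> / 2))\<^sup>2 / (real n * h)\<^sup>2 \<le> (?W i)\<^sup>2 * (y i - a)\<^sup>2" if "i \<in> T" for i
  proof -
    have i: "i \<in> {1..n}" "?u i \<in> I j" "\<tau> \<le> \<sigma> * e i" using that by (auto simp: T_def)
    have "-1 \<le> ?u i \<and> ?u i \<le> 1" using bdd[OF j] i(2) by auto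
    then have "\<bar>?u i\<bar> \<le> 1" by linarith
    then have "\<bar>x i\<bar> \<le> h" using nh by (simp add: abs_divide)
    then have rem: "\<bar>m (x i) - (\<Sum>s\<le>S. c s * ?u i ^ s)\<bar> \<le> \<tau> / 2" by (rule taylor[OF i(1)])
    have "\<sigma> * (y i - a) = \<sigma> * e i + \<sigma> * (\<Sum>s\<le>S. \<beta> s * ?u i ^ s)
        + \<sigma> * (m (x i) - (\<Sum>s\<le>S. c s * ?u i ^ s))"
      by (simp add: y[OF i(1)] q algebra_simps)
    moreover have "\<bar>\<sigma> * (m (x i) - (\<Sum>s\<le>S. c s * ?u i ^ s))\<bar> \<le> \<tau> / 2"
      using rem \<sigma> unfolding abs_mult by auto
    ultimately have "\<tau> / 2 \<le> \<sigma> * (y i - a)"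
      using i(3) sign[OF i(2)] by linarith
    moreover have "\<sigma> * (y i - a) \<le> \<bar>y i - a\<bar>" using \<sigma> by auto
    ultimately have "\<tau> / 2 \<le> \<bar>y i - a\<bar>" by (rule order_trans)
    moreover have "\<kappa> / (real n * h) \<le> \<bar>?W i\<bar>"
      using kappa(2)[OF j i(2)] nh_pos nh
      by (simp add: lp_weight_coeff[OF det nh] divide_right_mono)
    ultimately have "(\<kappa> / (real n * h))\<^sup>2 * (\<tau> / 2)\<^sup>2 \<le> \<bar>?W i\<bar>\<^sup>2 * \<bar>y i - a\<bar>\<^sup>2"
      using tau kappa(1) nh_pos by (intro mult_mono power_mono) auto
    then show ?thesis by (simp add: power_mult_distrib power_divide)
  qed
  have "\<gamma> * (\<kappa> * (\<tau> / 2))\<^sup>2 = real n * h * (\<gamma> * (real n * h) * ((\<kappa> * (\<tau> / 2))\<^sup>2 / (real n * h)\<^sup>2))"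
    using nh by (simp add: power2_eq_square)
  also have "\<dots> \<le> real n * h * (real (card T) * ((\<kappa> * (\<tau> / 2))\<^sup>2 / (real n * h)\<^sup>2))"
    using count[OF j \<sigma>] nh_pos unfolding T_def by (intro mult_left_mono mult_right_mono) auto
  also have "\<dots> = real n * h * (\<Sum>i\<in>T. (\<kappa> * (\<tau> / 2))\<^sup>2 / (real n * h)\<^sup>2)" by simp
  also have "\<dots> \<le> real n * h * (\<Sum>i\<in>T. (?W i)\<^sup>2 * (y i - a)\<^sup>2)"
    using summand nh_pos by (intro mult_left_mono sum_mono) auto
  also have "\<dots> \<le> real n * h * (\<Sum>i=1..n. (?W i)\<^sup>2 * (y i - a)\<^sup>2)"
    using nh_pos by (intro mult_left_mono sum_mono2) (auto simp: T_def)
  finally show ?thesis .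
qed

section \<open>Two probabilistic inequalities\<close>

text \<open>The variance of a sum of independent variables is the sum of the variances, each at most the second
  moment.\<close>

lemma (in prob_space) indep_sum_Chebyshev:
  fixes Z :: "'i \<Rightarrow> 'a \<Rightarrow> real"
  assumes fin: "finite I" and ind: "indep_vars (\<lambda>_. borel) Z I"
    and sq: "\<And>i. i \<in> I \<Longrightarrow> integrable M (\<lambda>\<omega>. (Z i \<omega>)\<^sup>2)"
    and v: "\<And>i. i \<in> I \<Longrightarrow> expectation (\<lambda>\<omega>. (Z i \<omega>)\<^sup>2) \<le> v" and t: "0 < t"
  shows "prob {\<omega>\<in>space M. t \<le> \<bar>(\<Sum>i\<in>I. Z i \<omega>) - (\<Sum>i\<in>I. expectation (Z i))\<bar>}
    \<le> real (card I) * v / t\<^sup>2"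
proof -
  define Y where "Y i \<omega> = Z i \<omega> - expectation (Z i)" for i \<omega>
  have rv: "Z i \<in> borel_measurable M" if "i \<in> I" for i
    using ind that by (auto simp: indep_vars_def)
  have int: "integrable M (Z i)" if "i \<in> I" for i
    using square_integrable_imp_integrable[OF rv sq] that by blast
  have indY: "indep_vars (\<lambda>_. borel) Y I"
    unfolding Y_def[abs_def] by (rule indep_vars_compose2[OF ind]) auto
  have intY: "integrable M (Y i)" and EY: "expectation (Y i) = 0" if "i \<in> I" for i
    using int[OF that] by (auto simp: Y_def[abs_def] prob_space)
  have intY2: "integrable M (\<lambda>\<omega>. Y i \<omega> * Y j \<omega>)"
    and EY2: "expectation (\<lambda>\<omega>. Y i \<omega> * Y j \<omega>) = (if i = j then variance (Z i) else 0)"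
    if ij: "i \<in> I" "j \<in> I" for i j
  proof -
    have "integrable M (\<lambda>\<omega>. Y i \<omega> * Y j \<omega>) \<and>
      expectation (\<lambda>\<omega>. Y i \<omega> * Y j \<omega>) = (if i = j then variance (Z i) else 0)"
    proof (cases "i = j")
      case True
      have "integrable M (\<lambda>\<omega>. (Y i \<omega>)\<^sup>2)"
        using sq[OF ij(1)] int[OF ij(1)] by (simp add: Y_def power2_diff)
      then show ?thesis using True by (simp add: Y_def power2_eq_square)
    next
      case False
      have ind2: "indep_vars (\<lambda>_. borel) Y {i, j}"
        using indep_vars_subset[OF indY] ij by simp
      show ?thesis
        using indep_vars_integrable[OF _ ind2] indep_vars_lebesgue_integral[OF _ ind2] False ij intY EY
        by auto
    qed
    then show "integrable M (\<lambda>\<omega>. Y i \<omega> * Y j \<omega>)"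
      "expectation (\<lambda>\<omega>. Y i \<omega> * Y j \<omega>) = (if i = j then variance (Z i) else 0)" by auto
  qed
  have square: "(\<Sum>i\<in>I. Y i \<omega>)\<^sup>2 = (\<Sum>i\<in>I. \<Sum>j\<in>I. Y i \<omega> * Y j \<omega>)" for \<omega>
    by (simp add: power2_eq_square sum_product)
  have "prob {\<omega>\<in>space M. t \<le> \<bar>\<Sum>i\<in>I. Y i \<omega>\<bar>} \<le> expectation (\<lambda>\<omega>. (\<Sum>i\<in>I. Y i \<omega>)\<^sup>2) / t\<^sup>2"
    using intY2 intY t unfolding square[symmetric]
    by (intro second_moment_method) (auto simp: square intro!: borel_measurable_sum)
  also have "expectation (\<lambda>\<omega>. (\<Sum>i\<in>I. Y i \<omega>)\<^sup>2) = (\<Sum>i\<in>I. \<Sum>j\<in>I. if i = j then variance (Z i) else 0)"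
    using intY2 by (simp add: square EY2)
  also have "\<dots> = (\<Sum>i\<in>I. variance (Z i))"
    using fin by (simp add: sum.delta')
  also have "\<dots> \<le> (\<Sum>i\<in>I. v)"
  proof (rule sum_mono)
    fix i assume i: "i \<in> I"
    show "variance (Z i) \<le> v"
      using variance_eq[OF int[OF i] sq[OF i]] v[OF i] by (smt (verit) zero_le_power2)
  qed
  finally show ?thesis
    using t by (simp add: Y_def sum_subtractf divide_right_mono)
qed

text \<open>For a centred variable with unit second moment and fourth moment at most \<open>a\<^sup>2 / 2\<close> the expectation of
  the left-hand side is at least \<open>1 - 1 / 2 - 1 / 4\<close>, so the inequality bounds the probability of
  \<open>x \<ge> 1 / (8 a)\<close> below. The linear term, which has expectation \<open>0\<close>, makes the polynomial nonpositive on
  the negative axis; the quartic term keeps it bounded on the positive axis. Since only expectations of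
  powers occur, the inequality can be used conditionally on the design.\<close>

lemma quartic_indicator_bound:
  fixes a x :: real
  assumes a: "1 \<le> a"
  shows "a * x + x\<^sup>2 - x ^ 4 / a\<^sup>2 - 1 / 4 \<le> 3 * a\<^sup>2 * (if 1 / (8 * a) \<le> x then 1 else 0)"
proof -
  have x4: "x ^ 4 = x\<^sup>2 * x\<^sup>2" by (simp add: power2_eq_square power4_eq_xxxx)
  consider "x < 0" | "0 \<le> x" "x < 1 / (8 * a)" | "1 / (8 * a) \<le> x" by linarith
  then show ?thesis
  proof cases
    case 1
    have "a * x + x\<^sup>2 - x ^ 4 / a\<^sup>2 \<le> 0"
    proof (cases "- x \<le> a")
      case True
      have "(- x) * (- x) \<le> a * (- x)" using True 1 by (intro mult_right_mono) auto
      then have "a * x + x\<^sup>2 \<le> 0" by (simp add: power2_eq_square)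
      moreover have "0 \<le> x ^ 4 / a\<^sup>2" by simp
      ultimately show ?thesis by linarith
    next
      case False
      then have "a\<^sup>2 \<le> x\<^sup>2" using a power_mono[of a "- x" 2] by simp
      then have "a\<^sup>2 * x\<^sup>2 \<le> x ^ 4" unfolding x4 by (intro mult_right_mono) auto
      then have "x\<^sup>2 \<le> x ^ 4 / a\<^sup>2" using a by (simp add: le_divide_eq mult.commute)
      moreover have "a * x \<le> 0" using 1 a by (simp add: mult_nonneg_nonpos)
      ultimately show ?thesis by linarith
    qed
    moreover have "\<not> 1 / (8 * a) \<le> x" using 1 a by (smt (verit) divide_nonneg_nonneg)
    ultimately show ?thesis by simp
  next
    case 2
    have ax: "a * x \<le> 1 / 8" using 2(2) a by (simp add: field_simps)
    have "1 * x \<le> a * x" using 2 a by (intro mult_right_mono) auto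
    then have "x \<le> 1 / 8" using ax by simp
    then have "x * x \<le> (1 / 8) * (1 / 8)" using 2(1) by (intro mult_mono) auto
    moreover have "0 \<le> x ^ 4 / a\<^sup>2" by simp
    ultimately have "a * x + x\<^sup>2 - x ^ 4 / a\<^sup>2 - 1 / 4 \<le> 0"
      using ax unfolding power2_eq_square by linarith
    then show ?thesis using 2 by simp
  next
    case 3
    define w where "w = x\<^sup>2 / a"
    have w: "w * a = x\<^sup>2" "w\<^sup>2 = x ^ 4 / a\<^sup>2"
      using a by (auto simp: w_def power_divide x4 power2_eq_square)
    have "0 \<le> (a - x)\<^sup>2" by simp
    then have ax: "2 * (a * x) \<le> a\<^sup>2 + x\<^sup>2" by (simp add: power2_diff)
    have "0 \<le> (w - 3 / 4 * a)\<^sup>2" by simp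
    then have "3 / 2 * (w * a) \<le> w\<^sup>2 + 9 / 16 * a\<^sup>2" by (simp add: power2_diff power_mult_distrib power_divide mult.commute)
    then have "3 / 2 * x\<^sup>2 \<le> x ^ 4 / a\<^sup>2 + 9 / 16 * a\<^sup>2" unfolding w .
    moreover have "0 \<le> a\<^sup>2" by simp
    ultimately have "a * x + x\<^sup>2 - x ^ 4 / a\<^sup>2 - 1 / 4 \<le> 3 * a\<^sup>2"
      using ax by linarith
    then show ?thesis using 3 by simp
  qed
qed

section \<open>Moments in the regression model\<close>

context regression_model
begin

lemma J_props: "J \<in> sets borel" "J \<subseteq> {-1..1}" "0 \<in> J" "emeasure lborel J < \<infinity>" "measure lborel J \<le> 2"
    "compact J"
  using J_cases by auto

lemma J_abs_le: "u \<in> J \<Longrightarrow> \<bar>u\<bar> \<le> 1"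
  using J_cases by (auto simp: abs_le_iff)

text \<open>Near \<open>0\<close> the set \<open>J\<close> is a cone, in the interior case and in the boundary case alike. This is why
  the same set \<open>J\<close> serves as the range of the design and as the domain of integration of the limiting
  kernel moments.\<close>

lemma scaled_mem_J: "0 < h \<Longrightarrow> h \<le> 1 \<Longrightarrow> \<bar>u\<bar> \<le> 1 \<Longrightarrow> h * u \<in> J \<longleftrightarrow> u \<in> J"
proof -
  assume h: "0 < h" "h \<le> 1" "\<bar>u\<bar> \<le> 1"
  have "\<bar>h * u\<bar> \<le> 1 * 1" using h unfolding abs_mult by (intro mult_mono) auto
  then have "-1 \<le> h * u" "h * u \<le> 1" by linarith+
  then show ?thesis using h J_cases by (auto simp: zero_le_mult_iff)
qed

lemma Lf_nonneg: "0 \<le> Lf" and LV_nonneg: "0 \<le> LV"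
  using fX_lipschitz V_lipschitz by (auto dest: lipschitz_on_nonneg)

lemma fX_near: "x \<in> J \<Longrightarrow> \<bar>fX x - fX 0\<bar> \<le> Lf * \<bar>x\<bar>"
  using lipschitz_onD[OF fX_lipschitz _ J_props(3), of x] by (simp add: dist_real_def)

lemma V_near: "x \<in> J \<Longrightarrow> \<bar>V x - V 0\<bar> \<le> LV * \<bar>x\<bar>"
  using lipschitz_onD[OF V_lipschitz _ J_props(3), of x] by (simp add: dist_real_def)

lemma fX_pos: "x \<in> J \<Longrightarrow> 0 < fX x"
proof -
  assume x: "x \<in> J"
  have "compact (fX ` J)"
    using J_props(6) lipschitz_on_continuous_on[OF fX_lipschitz] by (rule compact_continuous_image[rotated])
  then have "bdd_below (fX ` J)" by (simp add: bounded_imp_bdd_below compact_imp_bounded)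
  then show "0 < fX x" using fX_inf_pos cINF_lower[OF _ x, of fX] by linarith
qed

lemma V_bound: "x \<in> J \<Longrightarrow> \<bar>x\<bar> \<le> 1 \<Longrightarrow> V x \<le> V 0 + LV"
proof -
  assume x: "x \<in> J" "\<bar>x\<bar> \<le> 1"
  have "LV * \<bar>x\<bar> \<le> LV * 1" using x(2) LV_nonneg by (rule mult_left_mono)
  then show "V x \<le> V 0 + LV" using V_near[OF x(1)] by linarith
qed

lemma measurable_on_J:
  fixes f :: "real \<Rightarrow> real"
  assumes "continuous_on J f"
  shows "(\<lambda>x. indicator J x * f x) \<in> borel_measurable (borel :: real measure)"
  using borel_measurable_continuous_on_indicator[OF J_props(1) assms] by simp

lemma fX_measurable: "(\<lambda>x. indicator J x * fX x) \<in> borel_measurable borel"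
  and V_measurable: "(\<lambda>x. indicator J x * V x) \<in> borel_measurable borel"
  by (intro measurable_on_J lipschitz_on_continuous_on[OF fX_lipschitz]
      lipschitz_on_continuous_on[OF V_lipschitz])+

text \<open>Substituting \<open>x = h u\<close> turns the mean into \<open>h\<close> times the integral of \<open>g(u) fX(h u)\<close> over \<open>J\<close>, and the
  Lipschitz density differs from \<open>fX 0\<close> by at most \<open>Lf h\<close> in the window, whose length is at most \<open>2\<close>.\<close>

lemma design_expectation:
  assumes i: "i \<in> {1..n}" and h: "0 < h" "h \<le> 1"
    and g: "g \<in> borel_measurable borel" "\<And>u. \<bar>g u\<bar> \<le> B" "\<And>u. 1 < \<bar>u\<bar> \<Longrightarrow> g u = 0"
  shows "\<bar>(LINT \<omega>|M n. g (X n i \<omega> / h)) - h * (fX 0 * (LINT u:J|lborel. g u))\<bar> \<le> 2 * B * Lf * h\<^sup>2"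
proof -
  note [measurable] = g(1) fX_measurable J_props(1)
  have B: "0 \<le> B" using g(2)[of 0] by linarith
  have nonneg: "0 \<le> fX x * indicator J x" for x
    using fX_pos[of x] by (auto simp: indicator_def)
  have "(LINT \<omega>|M n. g (X n i \<omega> / h)) = (LINT x|lborel. (fX x * indicator J x) * g (x / h))"
    by (rule distributed_integral[OF X_density[OF i], symmetric]) (auto simp: nonneg)
  also have "\<dots> = h * (LINT u|lborel. (fX (h * u) * indicator J (h * u)) * g u)"
    using h by (subst lborel_integral_real_affine[where c = h and t = 0]) auto
  also have "(\<lambda>u. (fX (h * u) * indicator J (h * u)) * g u) = (\<lambda>u. indicator J u * (fX (h * u) * g u))"
  proof (rule ext)
    fix u show "(fX (h * u) * indicator J (h * u)) * g u = indicator J u * (fX (h * u) * g u)"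
      using scaled_mem_J[OF h, of u] g(3)[of u] by (cases "\<bar>u\<bar> \<le> 1") (auto simp: indicator_def)
  qed
  finally have E: "(LINT \<omega>|M n. g (X n i \<omega> / h)) = h * (LINT u|lborel. indicator J u * (fX (h * u) * g u))" .
  have meas: "(\<lambda>u. indicator J u * (fX (h * u) * g u)) \<in> borel_measurable borel"
  proof -
    have "(\<lambda>u. indicator J u * ((indicator J (h * u) * fX (h * u)) * g u)) \<in> borel_measurable borel"
      by measurable
    moreover have "indicator J u * ((indicator J (h * u) * fX (h * u)) * g u)
        = indicator J u * (fX (h * u) * g u)" for u
    proof (cases "u \<in> J")
      case True
      then have "\<bar>u\<bar> \<le> 1" by (rule J_abs_le)
      then show ?thesis using scaled_mem_J[OF h, of u] True by simp
    qed simp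
    ultimately show ?thesis by simp
  qed
  have int_g: "integrable lborel (\<lambda>u. indicator J u * g u)"
    using J_props g by (intro integrableI_bounded_set[where A = J and B = B]) auto
  have near: "\<bar>fX (h * u) - fX 0\<bar> \<le> Lf * h" if "u \<in> J" for u
  proof -
    have u: "\<bar>u\<bar> \<le> 1" by (rule J_abs_le[OF that])
    then have "h * u \<in> J" using scaled_mem_J[OF h] that by simp
    from fX_near[OF this] have "\<bar>fX (h * u) - fX 0\<bar> \<le> Lf * (h * \<bar>u\<bar>)"
      using h by (simp add: abs_mult)
    also have "\<dots> \<le> Lf * (h * 1)" using u h Lf_nonneg by (intro mult_left_mono) auto
    finally show ?thesis by simp
  qed
  have int_fg: "integrable lborel (\<lambda>u. indicator J u * (fX (h * u) * g u))"
  proof (rule integrableI_bounded_set[where A = J and B = "(fX 0 + Lf * h) * B"])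
    show "AE u in lborel. u \<in> J \<longrightarrow> norm (indicator J u * (fX (h * u) * g u)) \<le> (fX 0 + Lf * h) * B"
    proof (intro always_eventually allI impI)
      fix u assume u: "u \<in> J"
      have "\<bar>fX (h * u)\<bar> \<le> fX 0 + Lf * h"
        using near[OF u] fX_pos[OF J_props(3)] by linarith
      then have "\<bar>fX (h * u)\<bar> * \<bar>g u\<bar> \<le> (fX 0 + Lf * h) * B"
        using g(2)[of u] by (intro mult_mono) auto
      then show "norm (indicator J u * (fX (h * u) * g u)) \<le> (fX 0 + Lf * h) * B"
        using u by (simp add: abs_mult)
    qed
  qed (use J_props meas in auto)
  have "(LINT u|lborel. indicator J u * (fX (h * u) * g u)) - fX 0 * (LINT u:J|lborel. g u)
      = (LINT u|lborel. indicator J u * (fX (h * u) * g u) - fX 0 * (indicator J u * g u))"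
    using int_fg int_g by (simp add: set_lebesgue_integral_def)
  also have "\<bar>\<dots>\<bar> \<le> (LINT u|lborel. indicator J u * (Lf * h * B))"
  proof -
    have "norm (LINT u|lborel. indicator J u * (fX (h * u) * g u) - fX 0 * (indicator J u * g u))
        \<le> (LINT u|lborel. indicator J u * (Lf * h * B))"
    proof (rule Bochner_Integration.integral_norm_bound_integral)
      fix u
      have "\<bar>(fX (h * u) - fX 0) * g u\<bar> \<le> Lf * h * B" if "u \<in> J"
        using near[OF that] g(2)[of u] Lf_nonneg h unfolding abs_mult by (intro mult_mono) auto
      then show "norm (indicator J u * (fX (h * u) * g u) - fX 0 * (indicator J u * g u))
          \<le> indicator J u * (Lf * h * B)"
        by (auto simp: indicator_def algebra_simps)
    qed (use int_fg int_g J_props in auto)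
    then show ?thesis by simp
  qed
  also have "\<dots> = measure lborel J * (Lf * h * B)" using J_props by simp
  also have "\<dots> \<le> 2 * (Lf * h * B)"
    using J_props(5) Lf_nonneg h B by (intro mult_right_mono) auto
  finally have "h * \<bar>(LINT u|lborel. indicator J u * (fX (h * u) * g u)) - fX 0 * (LINT u:J|lborel. g u)\<bar>
      \<le> h * (2 * (Lf * h * B))"
    using h by (intro mult_left_mono) auto
  moreover have "h * \<bar>(LINT u|lborel. indicator J u * (fX (h * u) * g u)) - fX 0 * (LINT u:J|lborel. g u)\<bar>
      = \<bar>(LINT \<omega>|M n. g (X n i \<omega> / h)) - h * (fX 0 * (LINT u:J|lborel. g u))\<bar>"
    using h unfolding E right_diff_distrib[symmetric] abs_mult by simp
  ultimately show ?thesis by (simp add: power2_eq_square mult_ac)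
qed

text \<open>The probability that an observation falls into the window \<open>\<bar>x\<bar> \<le> h\<close> is at most \<open>window_const * h\<close>.\<close>

definition window_const :: real where "window_const = 2 * (fX 0 + Lf)"

lemma window_probability:
  assumes i: "i \<in> {1..n}" and h: "0 < h" "h \<le> 1"
  shows "(LINT \<omega>|M n. indicator {-1..1} (X n i \<omega> / h)) \<le> window_const * h"
proof -
  let ?g = "indicator {-1..1} :: real \<Rightarrow> real"
  have "(LINT u:J|lborel. ?g u) = (LINT u|lborel. indicator J u)"
    using J_props(2) unfolding set_lebesgue_integral_def
    by (intro Bochner_Integration.integral_cong) (auto simp: indicator_def)
  then have mass: "(LINT u:J|lborel. ?g u) \<le> 2" using J_props by simp
  have "\<bar>(LINT \<omega>|M n. ?g (X n i \<omega> / h)) - h * (fX 0 * (LINT u:J|lborel. ?g u))\<bar> \<le> 2 * 1 * Lf * h\<^sup>2"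
    by (rule design_expectation[OF i h]) (auto simp: indicator_def)
  then have "(LINT \<omega>|M n. ?g (X n i \<omega> / h)) \<le> h * (fX 0 * (LINT u:J|lborel. ?g u)) + 2 * Lf * h\<^sup>2"
    by linarith
  also have "\<dots> \<le> h * (fX 0 * 2) + 2 * Lf * (h * 1)"
    using mass h fX_pos[OF J_props(3)] Lf_nonneg unfolding power2_eq_square
    by (intro add_mono mult_left_mono) auto
  also have "\<dots> = window_const * h" by (simp add: window_const_def algebra_simps)
  finally show ?thesis .
qed

text \<open>As \<open>V\<close> may vanish away from \<open>0\<close>, the pair of \<open>X\<close> and \<open>noise\<close>, and not the pair of \<open>X\<close> and \<open>eps\<close>,
  can be recovered from the observation, and so is independent over \<open>i\<close>.\<close>

definition noise :: "nat \<Rightarrow> nat \<Rightarrow> 'a \<Rightarrow> real" where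
  "noise n i \<omega> = sqrt (V (X n i \<omega>)) * eps n i \<omega>"

lemma design_comp_measurable:
  assumes i: "i \<in> {1..n}" and f: "(\<lambda>x. indicator J x * f x) \<in> borel_measurable borel"
  shows "(\<lambda>\<omega>. f (X n i \<omega>) :: real) \<in> borel_measurable (M n)"
proof -
  have "(\<lambda>\<omega>. indicator J (X n i \<omega>) * f (X n i \<omega>)) \<in> borel_measurable (M n)"
    by (rule measurable_compose[OF X_measurable[OF i] f])
  then show ?thesis
    by (rule measurable_cong[THEN iffD1, rotated]) (use X_in_J[OF i] in simp)
qed

lemma noise_measurable: "i \<in> {1..n} \<Longrightarrow> noise n i \<in> borel_measurable (M n)"
  unfolding noise_def[abs_def]
  using design_comp_measurable[OF _ V_measurable] eps_measurable by measurable

abbreviation design_algebra :: "nat \<Rightarrow> nat \<Rightarrow> 'a measure" where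
  "design_algebra n i \<equiv> vimage_algebra (space (M n)) (X n i) borel"

lemma design_algebra_subalgebra:
  assumes i: "i \<in> {1..n}"
  shows "sigma_finite_subalgebra (M n) (design_algebra n i)"
proof (rule finite_measure_subalgebra_is_sigma_finite)
  interpret prob_space "M n" by (rule prob_space_M)
  have "subalgebra (M n) (design_algebra n i)"
    using measurable_sets[OF X_measurable[OF i]]
    by (auto simp: subalgebra_def sets_vimage_algebra2)
  then show "finite_measure_subalgebra (M n) (design_algebra n i)"
    by unfold_locales
qed

lemma design_algebra_measurable:
  "g \<in> borel_measurable borel \<Longrightarrow> (\<lambda>\<omega>. g (X n i \<omega>)) \<in> borel_measurable (design_algebra n i)"
  by (rule measurable_compose[OF measurable_vimage_algebra1]) auto

text \<open>The weight \<open>g(X)\<close> is measurable with respect to the design, so it can be moved inside the conditional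
  moments of the errors.\<close>

lemma error_moments:
  assumes i: "i \<in> {1..n}" and g: "g \<in> borel_measurable borel" "\<And>x. \<bar>g x\<bar> \<le> B"
  shows "integrable (M n) (\<lambda>\<omega>. g (X n i \<omega>))"
    and "integrable (M n) (\<lambda>\<omega>. g (X n i \<omega>) * eps n i \<omega>)"
    and "(LINT \<omega>|M n. g (X n i \<omega>) * eps n i \<omega>) = 0"
    and "integrable (M n) (\<lambda>\<omega>. g (X n i \<omega>) * (eps n i \<omega>)\<^sup>2)"
    and "(LINT \<omega>|M n. g (X n i \<omega>) * (eps n i \<omega>)\<^sup>2) = (LINT \<omega>|M n. g (X n i \<omega>))"
proof -
  interpret prob_space "M n" by (rule prob_space_M)
  interpret F: sigma_finite_subalgebra "M n" "design_algebra n i"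
    by (rule design_algebra_subalgebra[OF i])
  note [measurable] = X_measurable[OF i] eps_measurable[OF i] g(1)
  have gF: "(\<lambda>\<omega>. g (X n i \<omega>)) \<in> borel_measurable (design_algebra n i)"
    by (rule design_algebra_measurable[OF g(1)])
  show "integrable (M n) (\<lambda>\<omega>. g (X n i \<omega>))"
    using g(2) by (intro integrable_const_bound[where B = B]) auto
  have bounded_times: "integrable (M n) (\<lambda>\<omega>. g (X n i \<omega>) * f \<omega>)"
    if f: "integrable (M n) f" for f :: "'a \<Rightarrow> real"
  proof (rule Bochner_Integration.integrable_bound)
    show "integrable (M n) (\<lambda>\<omega>. B * \<bar>f \<omega>\<bar>)" using f by auto
    show "AE \<omega> in M n. norm (g (X n i \<omega>) * f \<omega>) \<le> norm (B * \<bar>f \<omega>\<bar>)"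
    proof (rule AE_I2)
      fix \<omega>
      have "\<bar>g (X n i \<omega>)\<bar> * \<bar>f \<omega>\<bar> \<le> B * \<bar>f \<omega>\<bar>" using g(2) by (intro mult_right_mono) auto
      moreover have "0 \<le> B" using g(2)[of 0] by linarith
      ultimately show "norm (g (X n i \<omega>) * f \<omega>) \<le> norm (B * \<bar>f \<omega>\<bar>)" by (simp add: abs_mult)
    qed
  qed (use f in measurable)
  show int1: "integrable (M n) (\<lambda>\<omega>. g (X n i \<omega>) * eps n i \<omega>)"
    by (rule bounded_times[OF eps_integrable[OF i]])
  show int2: "integrable (M n) (\<lambda>\<omega>. g (X n i \<omega>) * (eps n i \<omega>)\<^sup>2)"
    by (rule bounded_times[OF eps_sq_integrable[OF i]])
  have "(LINT \<omega>|M n. g (X n i \<omega>) * eps n i \<omega>)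
      = (LINT \<omega>|M n. g (X n i \<omega>) * real_cond_exp (M n) (design_algebra n i) (eps n i) \<omega>)"
    by (rule F.real_cond_exp_intg(2)[OF int1 gF, symmetric]) measurable
  also have "\<dots> = (LINT \<omega>|M n. 0)"
    using eps_cond_mean[OF i] by (intro integral_cong_AE) auto
  finally show "(LINT \<omega>|M n. g (X n i \<omega>) * eps n i \<omega>) = 0" by simp
  have "(LINT \<omega>|M n. g (X n i \<omega>) * (eps n i \<omega>)\<^sup>2)
      = (LINT \<omega>|M n. g (X n i \<omega>) * real_cond_exp (M n) (design_algebra n i) (\<lambda>\<omega>. (eps n i \<omega>)\<^sup>2) \<omega>)"
    by (rule F.real_cond_exp_intg(2)[OF int2 gF, symmetric]) measurable
  also have "\<dots> = (LINT \<omega>|M n. g (X n i \<omega>))"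
    using eps_cond_var[OF i] by (intro integral_cong_AE) auto
  finally show "(LINT \<omega>|M n. g (X n i \<omega>) * (eps n i \<omega>)\<^sup>2) = (LINT \<omega>|M n. g (X n i \<omega>))" .
qed

text \<open>As \<open>q > 4\<close>, the fourth power is at most \<open>1 + \<bar>e\<bar>\<^bsup>q\<^esup>\<close>.\<close>

lemma error_fourth_moment:
  assumes i: "i \<in> {1..n}" and g: "g \<in> borel_measurable borel" "\<And>x. 0 \<le> g x" "\<And>x. g x \<le> B"
  shows "integrable (M n) (\<lambda>\<omega>. g (X n i \<omega>) * (eps n i \<omega>) ^ 4)"
    and "(LINT \<omega>|M n. g (X n i \<omega>) * (eps n i \<omega>) ^ 4) \<le> (1 + E\<^sub>q) * (LINT \<omega>|M n. g (X n i \<omega>))"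
proof -
  interpret prob_space "M n" by (rule prob_space_M)
  interpret F: sigma_finite_subalgebra "M n" "design_algebra n i"
    by (rule design_algebra_subalgebra[OF i])
  note [measurable] = X_measurable[OF i] eps_measurable[OF i] g(1)
  have gF[measurable]: "(\<lambda>\<omega>. g (X n i \<omega>)) \<in> borel_measurable (design_algebra n i)"
    by (rule design_algebra_measurable[OF g(1)])
  have int_g: "integrable (M n) (\<lambda>\<omega>. g (X n i \<omega>))"
    using error_moments(1)[OF i g(1), of B] g(2,3) by simp
  have q4: "e ^ 4 \<le> 1 + \<bar>e\<bar> powr q" for e :: real
  proof (cases "\<bar>e\<bar> \<le> 1")
    case True
    then have "\<bar>e\<bar> ^ 4 \<le> 1" by (intro power_le_one) auto
    then have "e ^ 4 \<le> 1" by (simp add: power_even_abs)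
    moreover have "0 \<le> \<bar>e\<bar> powr q" by simp
    ultimately show ?thesis by linarith
  next
    case False
    have "0 \<le> 1 / real S" by simp
    then have "4 \<le> q" using moment_order by linarith
    then have "\<bar>e\<bar> powr 4 \<le> \<bar>e\<bar> powr q" using False by (intro powr_mono) auto
    moreover have "\<bar>e\<bar> powr 4 = e ^ 4"
      using False powr_realpow[of "\<bar>e\<bar>" 4] by (simp add: power_even_abs)
    ultimately show ?thesis by simp
  qed
  have "(\<integral>\<^sup>+\<omega>. ennreal (g (X n i \<omega>) * (eps n i \<omega>) ^ 4) \<partial>M n)
      \<le> (\<integral>\<^sup>+\<omega>. ennreal (g (X n i \<omega>)) + ennreal (g (X n i \<omega>)) * ennreal (\<bar>eps n i \<omega>\<bar> powr q) \<partial>M n)"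
  proof (rule nn_integral_mono)
    fix \<omega>
    have "g (X n i \<omega>) * (eps n i \<omega>) ^ 4 \<le> g (X n i \<omega>) * (1 + \<bar>eps n i \<omega>\<bar> powr q)"
      using q4 g(2) by (rule mult_left_mono)
    then show "ennreal (g (X n i \<omega>) * (eps n i \<omega>) ^ 4)
        \<le> ennreal (g (X n i \<omega>)) + ennreal (g (X n i \<omega>)) * ennreal (\<bar>eps n i \<omega>\<bar> powr q)"
      using g(2) by (simp add: ennreal_mult'[symmetric] ennreal_plus[symmetric] distrib_left del: ennreal_plus)
  qed
  also have "\<dots> = (\<integral>\<^sup>+\<omega>. ennreal (g (X n i \<omega>)) \<partial>M n)
      + (\<integral>\<^sup>+\<omega>. ennreal (g (X n i \<omega>)) * ennreal (\<bar>eps n i \<omega>\<bar> powr q) \<partial>M n)"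
    by (rule nn_integral_add) measurable
  also have "(\<integral>\<^sup>+\<omega>. ennreal (g (X n i \<omega>)) * ennreal (\<bar>eps n i \<omega>\<bar> powr q) \<partial>M n)
      = (\<integral>\<^sup>+\<omega>. ennreal (g (X n i \<omega>)) * nn_cond_exp (M n) (design_algebra n i)
          (\<lambda>\<omega>. ennreal (\<bar>eps n i \<omega>\<bar> powr q)) \<omega> \<partial>M n)"
    by (rule F.nn_cond_exp_intg[symmetric]) measurable
  also have "\<dots> \<le> (\<integral>\<^sup>+\<omega>. ennreal (g (X n i \<omega>)) * ennreal E\<^sub>q \<partial>M n)"
    using eps_cond_moment[of n] i by (intro nn_integral_mono_AE) (auto elim!: eventually_mono intro!: mult_left_mono)
  also have "\<dots> = (\<integral>\<^sup>+\<omega>. ennreal (g (X n i \<omega>)) \<partial>M n) * ennreal E\<^sub>q"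
    by (rule nn_integral_multc) measurable
  also have "(\<integral>\<^sup>+\<omega>. ennreal (g (X n i \<omega>)) \<partial>M n) = ennreal (LINT \<omega>|M n. g (X n i \<omega>))"
    using int_g g(2) by (intro nn_integral_eq_integral) auto
  also have "ennreal (LINT \<omega>|M n. g (X n i \<omega>)) + ennreal (LINT \<omega>|M n. g (X n i \<omega>)) * ennreal E\<^sub>q
      = ennreal ((1 + E\<^sub>q) * (LINT \<omega>|M n. g (X n i \<omega>)))"
  proof -
    have "0 \<le> (LINT \<omega>|M n. g (X n i \<omega>))" using g(2) by simp
    then show ?thesis
      using E_pos by (simp add: ennreal_mult'[symmetric] ennreal_plus[symmetric] algebra_simps del: ennreal_plus)
  qed
  finally have bound: "(\<integral>\<^sup>+\<omega>. ennreal (g (X n i \<omega>) * (eps n i \<omega>) ^ 4) \<partial>M n)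
      \<le> ennreal ((1 + E\<^sub>q) * (LINT \<omega>|M n. g (X n i \<omega>)))" by simp
  show int: "integrable (M n) (\<lambda>\<omega>. g (X n i \<omega>) * (eps n i \<omega>) ^ 4)"
    using bound g(2) by (intro integrableI_nonneg) (auto intro: le_less_trans)
  have "ennreal (LINT \<omega>|M n. g (X n i \<omega>) * (eps n i \<omega>) ^ 4)
      \<le> ennreal ((1 + E\<^sub>q) * (LINT \<omega>|M n. g (X n i \<omega>)))"
    using bound nn_integral_eq_integral[OF int] g(2) by simp
  moreover have "0 \<le> (1 + E\<^sub>q) * (LINT \<omega>|M n. g (X n i \<omega>))"
    using E_pos g(2) by (intro mult_nonneg_nonneg) auto
  ultimately show "(LINT \<omega>|M n. g (X n i \<omega>) * (eps n i \<omega>) ^ 4) \<le> (1 + E\<^sub>q) * (LINT \<omega>|M n. g (X n i \<omega>))"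
    by (simp add: ennreal_le_iff)
qed

text \<open>These are the constants of the tail bound for the noise: with \<open>a = tail_scale\<close> the bound
  \<open>1 + E\<^sub>q\<close> on the conditional fourth moment is \<open>a\<^sup>2 / 2\<close>, and \<open>sqrt (V 0 / 2)\<close> is a lower bound for the standard deviation of
  the noise near \<open>0\<close>.\<close>

definition tail_scale :: real where "tail_scale = sqrt (2 * (1 + E\<^sub>q))"
definition tail_level :: real where "tail_level = 1 / (8 * tail_scale) * sqrt (V 0 / 2)"
definition tail_mass :: real where "tail_mass = 1 / (12 * tail_scale\<^sup>2)"

lemma tail_consts: "1 \<le> tail_scale" "0 < tail_level" "0 < tail_mass" "tail_scale\<^sup>2 = 2 * (1 + E\<^sub>q)"
proof -
  show a: "1 \<le> tail_scale" unfolding tail_scale_def using E_pos by simp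
  show "0 < tail_level" "0 < tail_mass" using a V_0_pos by (simp_all add: tail_level_def tail_mass_def)
  show "tail_scale\<^sup>2 = 2 * (1 + E\<^sub>q)" using E_pos by (simp add: tail_scale_def)
qed

text \<open>Integrating the quartic inequality at \<open>\<sigma> \<cdot> eps\<close> against \<open>g(X)\<close> gives \<open>1/4\<close> of the mean of \<open>g(X)\<close> on the
  left: the linear term vanishes, the quadratic term contributes \<open>1\<close> and the quartic one at most
  \<open>1/2\<close>. Thus a fixed fraction of the errors, in every part of the window, is large with a prescribed
  sign.\<close>

lemma noise_tail:
  assumes i: "i \<in> {1..n}" and \<sigma>: "\<sigma> \<in> {1, -1::real}"
    and g: "g \<in> borel_measurable borel" "\<And>x. 0 \<le> g x" "\<And>x. g x \<le> 1"
    and V: "\<And>x. x \<in> J \<Longrightarrow> g x \<noteq> 0 \<Longrightarrow> V 0 / 2 \<le> V x"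
  shows "tail_mass * (LINT \<omega>|M n. g (X n i \<omega>))
    \<le> (LINT \<omega>|M n. g (X n i \<omega>) * (if tail_level \<le> \<sigma> * noise n i \<omega> then 1 else 0))"
proof -
  interpret prob_space "M n" by (rule prob_space_M)
  note [measurable] = X_measurable[OF i] eps_measurable[OF i] noise_measurable[OF i] g(1)
  let ?a = tail_scale and ?g = "\<lambda>\<omega>. g (X n i \<omega>)" and ?e = "eps n i"
  let ?ind = "\<lambda>\<omega>. if tail_level \<le> \<sigma> * noise n i \<omega> then 1 else 0 :: real"
  note m = error_moments[OF i g(1), of 1] error_fourth_moment[OF i g]
  have g1: "\<bar>g x\<bar> \<le> 1" for x using g(2,3)[of x] by simp
  have int_ind: "integrable (M n) (\<lambda>\<omega>. ?g \<omega> * ?ind \<omega>)"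
    using g(2,3) by (intro integrable_const_bound[where B = 1]) auto
  have "(LINT \<omega>|M n. (?a * \<sigma>) * (?g \<omega> * ?e \<omega>) + ?g \<omega> * (?e \<omega>)\<^sup>2
        - (1 / ?a\<^sup>2) * (?g \<omega> * (?e \<omega>) ^ 4) - (1 / 4) * ?g \<omega>)
      \<le> (LINT \<omega>|M n. (3 * ?a\<^sup>2) * (?g \<omega> * ?ind \<omega>))"
  proof (rule integral_mono)
    fix \<omega> assume \<omega>: "\<omega> \<in> space (M n)"
    have level: "(if 1 / (8 * ?a) \<le> \<sigma> * ?e \<omega> then 1 else 0) \<le> ?ind \<omega>" if "?g \<omega> \<noteq> 0"
    proof (cases "1 / (8 * ?a) \<le> \<sigma> * ?e \<omega>")
      case True
      have "sqrt (V 0 / 2) \<le> sqrt (V (X n i \<omega>))"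
        using V[OF X_in_J[OF i \<omega>] that] by simp
      then have "1 / (8 * ?a) * sqrt (V 0 / 2) \<le> (\<sigma> * ?e \<omega>) * sqrt (V (X n i \<omega>))"
        using True tail_consts(1) V_0_pos order_trans[OF _ True, of 0] by (intro mult_mono) auto
      then show ?thesis by (simp add: noise_def tail_level_def mult_ac)
    qed auto
    have "?a * (\<sigma> * ?e \<omega>) + (\<sigma> * ?e \<omega>)\<^sup>2 - (\<sigma> * ?e \<omega>) ^ 4 / ?a\<^sup>2 - 1 / 4
        \<le> 3 * ?a\<^sup>2 * (if 1 / (8 * ?a) \<le> \<sigma> * ?e \<omega> then 1 else 0)"
      by (rule quartic_indicator_bound[OF tail_consts(1)])
    then have "?g \<omega> * (?a * (\<sigma> * ?e \<omega>) + (\<sigma> * ?e \<omega>)\<^sup>2 - (\<sigma> * ?e \<omega>) ^ 4 / ?a\<^sup>2 - 1 / 4)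
        \<le> ?g \<omega> * (3 * ?a\<^sup>2 * (if 1 / (8 * ?a) \<le> \<sigma> * ?e \<omega> then 1 else 0))"
      using g(2) by (rule mult_left_mono)
    also have "\<dots> \<le> ?g \<omega> * (3 * ?a\<^sup>2 * ?ind \<omega>)"
    proof (cases "?g \<omega> = 0")
      case False
      then show ?thesis using level g(2) by (intro mult_left_mono) auto
    qed simp
    finally show "(?a * \<sigma>) * (?g \<omega> * ?e \<omega>) + ?g \<omega> * (?e \<omega>)\<^sup>2
        - (1 / ?a\<^sup>2) * (?g \<omega> * (?e \<omega>) ^ 4) - (1 / 4) * ?g \<omega>
      \<le> (3 * ?a\<^sup>2) * (?g \<omega> * ?ind \<omega>)"
      using \<sigma> by (auto simp: algebra_simps)
  qed (use m g1 int_ind in auto)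
  moreover have "(LINT \<omega>|M n. (?a * \<sigma>) * (?g \<omega> * ?e \<omega>) + ?g \<omega> * (?e \<omega>)\<^sup>2
        - (1 / ?a\<^sup>2) * (?g \<omega> * (?e \<omega>) ^ 4) - (1 / 4) * ?g \<omega>)
      = (LINT \<omega>|M n. ?g \<omega>) - (1 / ?a\<^sup>2) * (LINT \<omega>|M n. ?g \<omega> * (?e \<omega>) ^ 4) - (1 / 4) * (LINT \<omega>|M n. ?g \<omega>)"
    using m g1 by simp
  moreover have "(1 / ?a\<^sup>2) * (LINT \<omega>|M n. ?g \<omega> * (?e \<omega>) ^ 4)
      \<le> (1 / ?a\<^sup>2) * ((1 + E\<^sub>q) * (LINT \<omega>|M n. ?g \<omega>))"
    using m(7) by (intro mult_left_mono) auto
  moreover have "(1 / ?a\<^sup>2) * ((1 + E\<^sub>q) * (LINT \<omega>|M n. ?g \<omega>)) = (1 / 2) * (LINT \<omega>|M n. ?g \<omega>)"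
    using E_pos by (simp add: tail_consts(4) field_simps)
  ultimately have "(1 / 4) * (LINT \<omega>|M n. ?g \<omega>) \<le> (3 * ?a\<^sup>2) * (LINT \<omega>|M n. ?g \<omega> * ?ind \<omega>)"
    by simp
  then show ?thesis
    using tail_consts(1) by (simp add: tail_mass_def field_simps)
qed

end

section \<open>Concentration of the local sums\<close>

context regression_model
begin

text \<open>The independence assumption concerns the pairs of design point and response. Subtracting the regression
  function is a measurable operation on each pair, so functions of design point and noise are
  independent as well.\<close>

lemma deviation_bound:
  fixes G :: "real \<Rightarrow> real \<Rightarrow> real"
  assumes m: "m \<in> Theta0 J S M\<^sub>S r\<^sub>S (psi_n S n)"
    and G: "(\<lambda>p. G (fst p) (snd p)) \<in> borel_measurable (borel \<Otimes>\<^sub>M borel)"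
    and sq: "\<And>i. i \<in> {1..n} \<Longrightarrow> integrable (M n) (\<lambda>\<omega>. (G (X n i \<omega>) (noise n i \<omega>))\<^sup>2)"
    and v: "\<And>i. i \<in> {1..n} \<Longrightarrow> (LINT \<omega>|M n. (G (X n i \<omega>) (noise n i \<omega>))\<^sup>2) \<le> v"
    and t: "0 < t"
  shows "measure (M n) {\<omega>\<in>space (M n). t \<le> \<bar>(\<Sum>i=1..n. G (X n i \<omega>) (noise n i \<omega>))
      - (\<Sum>i=1..n. LINT \<omega>|M n. G (X n i \<omega>) (noise n i \<omega>))\<bar>} \<le> real n * v / t\<^sup>2"
proof -
  interpret prob_space "M n" by (rule prob_space_M)
  define Z where "Z i \<omega> = G (X n i \<omega>)
      (response V (X n) (eps n) m \<omega> i - indicator J (X n i \<omega>) * m (X n i \<omega>))" for i \<omega>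
  have mJ: "(\<lambda>x. indicator J x * m x) \<in> borel_measurable borel"
  proof -
    have "m \<in> borel_measurable (restrict_space borel J)"
      using m by (simp add: Theta0_def)
    then show ?thesis
      using J_props(1) by (subst (asm) borel_measurable_restrict_space_iff) auto
  qed
  have "(\<lambda>p. (fst p, snd p - indicator J (fst p) * m (fst p)))
      \<in> (borel \<Otimes>\<^sub>M borel) \<rightarrow>\<^sub>M (borel \<Otimes>\<^sub>M borel :: (real \<times> real) measure)"
    using measurable_compose[OF measurable_fst mJ] by measurable
  from measurable_compose[OF this G]
  have "indep_vars (\<lambda>_. borel) Z {1..n}"
    unfolding Z_def[abs_def]
    by (intro indep_vars_compose2[OF pairs_indep[OF m], where Y = "\<lambda>i p. G (fst p)
        (snd p - indicator J (fst p) * m (fst p))", simplified fst_conv snd_conv]) simp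
  moreover have Z: "Z i \<omega> = G (X n i \<omega>) (noise n i \<omega>)" if "i \<in> {1..n}" "\<omega> \<in> space (M n)" for i \<omega>
    using X_in_J[OF that] by (simp add: Z_def response_def noise_def)
  moreover have "integrable (M n) (\<lambda>\<omega>. (Z i \<omega>)\<^sup>2)" if "i \<in> {1..n}" for i
    using sq[OF that] Z[OF that] by (subst Bochner_Integration.integrable_cong[OF refl]) auto
  moreover have "expectation (\<lambda>\<omega>. (Z i \<omega>)\<^sup>2) \<le> v" if "i \<in> {1..n}" for i
    using v[OF that] Z[OF that] by (subst Bochner_Integration.integral_cong[OF refl]) auto
  ultimately have "prob {\<omega>\<in>space (M n). t \<le> \<bar>(\<Sum>i\<in>{1..n}. Z i \<omega>) - (\<Sum>i\<in>{1..n}. expectation (Z i))\<bar>}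
      \<le> real (card {1..n}) * v / t\<^sup>2"
    using t by (intro indep_sum_Chebyshev) auto
  moreover have "expectation (Z i) = (LINT \<omega>|M n. G (X n i \<omega>) (noise n i \<omega>))" if "i \<in> {1..n}" for i
    using Z[OF that] by (intro Bochner_Integration.integral_cong) auto
  moreover have "{\<omega>\<in>space (M n). t \<le> \<bar>(\<Sum>i\<in>{1..n}. Z i \<omega>) - c\<bar>}
      = {\<omega>\<in>space (M n). t \<le> \<bar>(\<Sum>i=1..n. G (X n i \<omega>) (noise n i \<omega>)) - c\<bar>}" for c
    using Z by (intro Collect_cong conj_cong refl) simp
  ultimately show ?thesis by simp
qed

text \<open>A bounded function supported in the window has a second moment of order \<open>h\<close>. Hence sums over the window
  fluctuate by the order \<open>sqrt (n h)\<close> only.\<close>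

lemma window_square:
  assumes i: "i \<in> {1..n}" and h: "0 < h" "h \<le> 1"
    and g: "g \<in> borel_measurable borel" "\<And>u. \<bar>g u\<bar> \<le> 1" "\<And>u. 1 < \<bar>u\<bar> \<Longrightarrow> g u = 0"
  shows "integrable (M n) (\<lambda>\<omega>. (g (X n i \<omega> / h))\<^sup>2)"
    and "(LINT \<omega>|M n. (g (X n i \<omega> / h))\<^sup>2) \<le> window_const * h"
proof -
  interpret prob_space "M n" by (rule prob_space_M)
  note [measurable] = X_measurable[OF i] g(1)
  have g2: "(g u)\<^sup>2 \<le> indicator {-1..1} u" for u
    using g(2)[of u] g(3)[of u] by (cases "\<bar>u\<bar> \<le> 1") (auto simp: indicator_def abs_square_le_1)
  show int: "integrable (M n) (\<lambda>\<omega>. (g (X n i \<omega> / h))\<^sup>2)"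
    using g(2) by (intro integrable_const_bound[where B = 1]) (auto simp: abs_square_le_1)
  have "(LINT \<omega>|M n. (g (X n i \<omega> / h))\<^sup>2) \<le> (LINT \<omega>|M n. indicator {-1..1} (X n i \<omega> / h))"
  proof (rule integral_mono[OF int])
    show "integrable (M n) (\<lambda>\<omega>. indicator {-1..1} (X n i \<omega> / h) :: real)"
      by (intro integrable_const_bound[where B = 1]) auto
  qed (rule g2)
  also have "\<dots> \<le> window_const * h" by (rule window_probability[OF i h])
  finally show "(LINT \<omega>|M n. (g (X n i \<omega> / h))\<^sup>2) \<le> window_const * h" .
qed

lemma window_const_pos: "0 < window_const"
  using fX_pos[OF J_props(3)] Lf_nonneg by (simp add: window_const_def)

text \<open>The bias of order \<open>n h\<^sup>2\<close> takes up at most half of the tolerance \<open>\<delta> n h\<close>; Chebyshev's inequality covers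
  the other half.\<close>

lemma design_concentration:
  assumes m: "m \<in> Theta0 J S M\<^sub>S r\<^sub>S (psi_n S n)" and n: "0 < n" and h: "0 < h" "h \<le> 1"
    and g: "g \<in> borel_measurable borel" "\<And>u. \<bar>g u\<bar> \<le> 1" "\<And>u. 1 < \<bar>u\<bar> \<Longrightarrow> g u = 0"
    and \<delta>: "0 < \<delta>" "4 * Lf * h \<le> \<delta>"
  shows "measure (M n) {\<omega>\<in>space (M n). \<delta> * (real n * h)
      \<le> \<bar>(\<Sum>i=1..n. g (X n i \<omega> / h)) - real n * h * (fX 0 * (LINT u:J|lborel. g u))\<bar>}
    \<le> 4 * window_const / (\<delta>\<^sup>2 * (real n * h))"
proof -
  interpret prob_space "M n" by (rule prob_space_M)
  note [measurable] = X_measurable noise_measurable g(1)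
  let ?E = "\<lambda>i. LINT \<omega>|M n. g (X n i \<omega> / h)" and ?L = "h * (fX 0 * (LINT u:J|lborel. g u))"
  have nh: "0 < real n * h" using n h by simp
  have "\<bar>(\<Sum>i=1..n. ?E i) - (\<Sum>i=1..n. ?L)\<bar> \<le> (\<Sum>i=1..n. \<bar>?E i - ?L\<bar>)"
    unfolding sum_subtractf[symmetric] by (rule sum_abs)
  also have "\<dots> \<le> (\<Sum>i=1..n. 2 * 1 * Lf * h\<^sup>2)"
    using design_expectation[OF _ h g] by (intro sum_mono) auto
  also have "\<dots> = (4 * Lf * h) * (real n * h) / 2" by (simp add: power2_eq_square)
  also have "\<dots> \<le> \<delta> * (real n * h) / 2"
    using \<delta>(2) nh by (intro divide_right_mono mult_right_mono) auto
  finally have bias: "\<bar>(\<Sum>i=1..n. ?E i) - real n * h * (fX 0 * (LINT u:J|lborel. g u))\<bar>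
      \<le> \<delta> * (real n * h) / 2" by (simp add: mult_ac)
  have "measure (M n) {\<omega>\<in>space (M n). \<delta> * (real n * h)
      \<le> \<bar>(\<Sum>i=1..n. g (X n i \<omega> / h)) - real n * h * (fX 0 * (LINT u:J|lborel. g u))\<bar>}
    \<le> measure (M n) {\<omega>\<in>space (M n). \<delta> * (real n * h) / 2
      \<le> \<bar>(\<Sum>i=1..n. g (X n i \<omega> / h)) - (\<Sum>i=1..n. ?E i)\<bar>}"
  proof (rule finite_measure_mono)
    have "\<delta> * (real n * h) / 2 \<le> \<bar>s - (\<Sum>i=1..n. ?E i)\<bar>"
      if "\<delta> * (real n * h) \<le> \<bar>s - real n * h * (fX 0 * (LINT u:J|lborel. g u))\<bar>" for s
      using bias that by linarith
    then show "{\<omega>\<in>space (M n). \<delta> * (real n * h)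
        \<le> \<bar>(\<Sum>i=1..n. g (X n i \<omega> / h)) - real n * h * (fX 0 * (LINT u:J|lborel. g u))\<bar>}
      \<subseteq> {\<omega>\<in>space (M n). \<delta> * (real n * h) / 2
        \<le> \<bar>(\<Sum>i=1..n. g (X n i \<omega> / h)) - (\<Sum>i=1..n. ?E i)\<bar>}"
      by (intro Collect_mono) blast
  qed measurable
  also have "\<dots> \<le> real n * (window_const * h) / (\<delta> * (real n * h) / 2)\<^sup>2"
    using window_square[OF _ h g] \<delta>(1) nh
    by (intro deviation_bound[OF m, where G = "\<lambda>x e. g (x / h)"]) auto
  also have "\<dots> = 4 * window_const / (\<delta>\<^sup>2 * (real n * h))"
    using n h \<delta>(1) by (simp add: power2_eq_square field_simps)
  finally show ?thesis .
qed

text \<open>Each summand is centred given the design, and its second moment is of order \<open>h\<close> because the variance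
  function is bounded by \<open>V 0 + LV\<close> in the window.\<close>

lemma noise_concentration:
  assumes m: "m \<in> Theta0 J S M\<^sub>S r\<^sub>S (psi_n S n)" and h: "0 < h" "h \<le> 1"
    and g: "g \<in> borel_measurable borel" "\<And>u. \<bar>g u\<bar> \<le> 1" "\<And>u. 1 < \<bar>u\<bar> \<Longrightarrow> g u = 0"
    and R: "0 < R"
  shows "measure (M n) {\<omega>\<in>space (M n). R \<le> \<bar>\<Sum>i=1..n. g (X n i \<omega> / h) * noise n i \<omega>\<bar>}
    \<le> real n * ((V 0 + LV) * (window_const * h)) / R\<^sup>2"
proof -
  interpret prob_space "M n" by (rule prob_space_M)
  let ?V = "\<lambda>x. indicator J x * V x"
  note [measurable] = X_measurable noise_measurable g(1) V_measurable
  have V: "0 \<le> ?V x" "?V x \<le> V 0 + LV" for x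
    using V_nonneg[of x] V_bound[of x] J_abs_le[of x] V_0_pos LV_nonneg by (auto simp: indicator_def)
  have mean: "(LINT \<omega>|M n. g (X n i \<omega> / h) * noise n i \<omega>) = 0" if i: "i \<in> {1..n}" for i
  proof -
    have "(LINT \<omega>|M n. g (X n i \<omega> / h) * noise n i \<omega>)
        = (LINT \<omega>|M n. (g (X n i \<omega> / h) * sqrt (?V (X n i \<omega>))) * eps n i \<omega>)"
      using X_in_J[OF i] by (intro Bochner_Integration.integral_cong) (auto simp: noise_def)
    also have "\<dots> = 0"
    proof (rule error_moments(3)[OF i])
      fix x
      have "\<bar>g (x / h)\<bar> * sqrt (?V x) \<le> 1 * sqrt (V 0 + LV)"
        using g(2) V by (intro mult_mono) auto
      then show "\<bar>g (x / h) * sqrt (?V x)\<bar> \<le> sqrt (V 0 + LV)"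
        using V by (simp add: abs_mult)
    qed measurable
    finally show ?thesis .
  qed
  have second: "integrable (M n) (\<lambda>\<omega>. (g (X n i \<omega> / h) * noise n i \<omega>)\<^sup>2) \<and>
      (LINT \<omega>|M n. (g (X n i \<omega> / h) * noise n i \<omega>)\<^sup>2) \<le> (V 0 + LV) * (window_const * h)"
    if i: "i \<in> {1..n}" for i
  proof -
    let ?\<phi> = "\<lambda>x. (g (x / h))\<^sup>2 * ?V x"
    have \<phi>: "?\<phi> \<in> borel_measurable borel" by measurable
    have \<phi>_le: "?\<phi> x \<le> (V 0 + LV) * (g (x / h))\<^sup>2" for x
      using mult_right_mono[OF V(2)[of x], of "(g (x / h))\<^sup>2"] by (simp add: mult_ac)
    have \<phi>_bound: "\<bar>?\<phi> x\<bar> \<le> V 0 + LV" for x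
    proof -
      have "\<bar>?\<phi> x\<bar> = ?\<phi> x" using V by (intro abs_of_nonneg) simp
      also have "\<dots> \<le> (V 0 + LV) * (g (x / h))\<^sup>2" by (rule \<phi>_le)
      also have "\<dots> \<le> (V 0 + LV) * 1"
        using g(2) V_0_pos LV_nonneg by (intro mult_left_mono) (auto simp: abs_square_le_1)
      finally show ?thesis by simp
    qed
    note moments = error_moments[OF i \<phi> \<phi>_bound]
    have eq: "(g (X n i \<omega> / h) * noise n i \<omega>)\<^sup>2 = ?\<phi> (X n i \<omega>) * (eps n i \<omega>)\<^sup>2"
      if "\<omega> \<in> space (M n)" for \<omega>
      using X_in_J[OF i that] V_nonneg by (simp add: noise_def power_mult_distrib)
    have "integrable (M n) (\<lambda>\<omega>. (g (X n i \<omega> / h) * noise n i \<omega>)\<^sup>2)"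
      using moments(4) eq by (subst Bochner_Integration.integrable_cong[OF refl eq]) auto
    moreover have "(LINT \<omega>|M n. (g (X n i \<omega> / h) * noise n i \<omega>)\<^sup>2) = (LINT \<omega>|M n. ?\<phi> (X n i \<omega>))"
      using moments(5) eq by (subst Bochner_Integration.integral_cong[OF refl eq]) auto
    moreover have "(LINT \<omega>|M n. ?\<phi> (X n i \<omega>)) \<le> (LINT \<omega>|M n. (V 0 + LV) * (g (X n i \<omega> / h))\<^sup>2)"
      using \<phi>_le window_square(1)[OF i h g] moments(1) by (intro integral_mono) auto
    moreover have "\<dots> \<le> (V 0 + LV) * (window_const * h)"
      using window_square(2)[OF i h g] V_0_pos LV_nonneg by (simp add: mult_left_mono)
    ultimately show ?thesis by linarith
  qed
  have "measure (M n) {\<omega>\<in>space (M n). R \<le> \<bar>(\<Sum>i=1..n. g (X n i \<omega> / h) * noise n i \<omega>)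
      - (\<Sum>i=1..n. LINT \<omega>|M n. g (X n i \<omega> / h) * noise n i \<omega>)\<bar>}
    \<le> real n * ((V 0 + LV) * (window_const * h)) / R\<^sup>2"
    using second R by (intro deviation_bound[OF m, where G = "\<lambda>x e. g (x / h) * e"]) auto
  then show ?thesis using mean by simp
qed

text \<open>The expected count is at least \<open>2 \<gamma> n h\<close>, twice the threshold: one factor \<open>2\<close> of the \<open>4\<close> in \<open>\<gamma>\<close> is
  spent on the bias of the design, the other on the deviation from the mean.\<close>

lemma large_noise_count:
  assumes m: "m \<in> Theta0 J S M\<^sub>S r\<^sub>S (psi_n S n)" and n: "0 < n" and h: "0 < h" "h \<le> 1"
    and I: "I \<in> sets borel" "I \<subseteq> J" and \<sigma>: "\<sigma> \<in> {1, -1::real}"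
    and small: "4 * Lf * h \<le> fX 0 * measure lborel I" "2 * LV * h \<le> V 0"
    and \<gamma>: "\<gamma> = tail_mass * (fX 0 * measure lborel I) / 4" "0 < \<gamma>"
  shows "measure (M n) {\<omega>\<in>space (M n).
      real (card {i\<in>{1..n}. X n i \<omega> / h \<in> I \<and> tail_level \<le> \<sigma> * noise n i \<omega>}) < \<gamma> * (real n * h)}
    \<le> window_const / (\<gamma>\<^sup>2 * (real n * h))"
proof -
  interpret prob_space "M n" by (rule prob_space_M)
  note [measurable] = X_measurable noise_measurable I(1)
  let ?g = "indicator I :: real \<Rightarrow> real"
  let ?G = "\<lambda>x e. ?g (x / h) * (if tail_level \<le> \<sigma> * e then 1 else 0)"
  let ?Z = "\<lambda>i \<omega>. ?G (X n i \<omega>) (noise n i \<omega>)"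
  have nh: "0 < real n * h" using n h by simp
  have g: "?g \<in> borel_measurable borel" "\<And>u. \<bar>?g u\<bar> \<le> 1" "\<And>u. 1 < \<bar>u\<bar> \<Longrightarrow> ?g u = 0"
    using I J_abs_le by (auto simp: indicator_def) (fastforce)
  have mass: "(LINT u:J|lborel. ?g u) = measure lborel I"
  proof -
    have "(LINT u:J|lborel. ?g u) = (LINT u|lborel. ?g u)"
      using I(2) unfolding set_lebesgue_integral_def
      by (intro Bochner_Integration.integral_cong) (auto simp: indicator_def)
    then show ?thesis using I(1) by simp
  qed
  have mean: "2 * \<gamma> * h \<le> (LINT \<omega>|M n. ?Z i \<omega>)" if i: "i \<in> {1..n}" for i
  proof -
    let ?E = "LINT \<omega>|M n. ?g (X n i \<omega> / h)"
    have "\<bar>?E - h * (fX 0 * measure lborel I)\<bar> \<le> 2 * 1 * Lf * h\<^sup>2"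
      using design_expectation[OF i h g] unfolding mass .
    moreover have "(4 * Lf * h) * h \<le> (fX 0 * measure lborel I) * h"
      using small(1) h by (intro mult_right_mono) auto
    ultimately have "h * (fX 0 * measure lborel I) / 2 \<le> ?E"
      by (simp add: power2_eq_square abs_le_iff algebra_simps)
    then have "tail_mass * (h * (fX 0 * measure lborel I) / 2) \<le> tail_mass * ?E"
      using tail_consts by (intro mult_left_mono) auto
    also have "\<dots> \<le> (LINT \<omega>|M n. ?Z i \<omega>)"
    proof (rule noise_tail[OF i \<sigma>])
      fix x assume x: "x \<in> J" "?g (x / h) \<noteq> 0"
      then have "\<bar>x / h\<bar> \<le> 1" using g(3)[of "x / h"] by force
      then have "\<bar>x\<bar> \<le> h" using h by (simp add: abs_divide)
      then have "LV * \<bar>x\<bar> \<le> LV * h" using LV_nonneg by (rule mult_left_mono)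
      then show "V 0 / 2 \<le> V x" using V_near[OF x(1)] small(2) by linarith
    qed (auto simp: indicator_def)
    finally show ?thesis by (simp add: \<gamma>(1) mult_ac)
  qed
  have count: "(\<Sum>i=1..n. ?Z i \<omega>)
      = real (card {i\<in>{1..n}. X n i \<omega> / h \<in> I \<and> tail_level \<le> \<sigma> * noise n i \<omega>})" for \<omega>
  proof -
    have "(\<Sum>i=1..n. ?Z i \<omega>)
        = (\<Sum>i=1..n. if X n i \<omega> / h \<in> I \<and> tail_level \<le> \<sigma> * noise n i \<omega> then 1 else 0)"
      by (intro sum.cong) (auto simp: indicator_def)
    then show ?thesis by (simp add: sum.If_cases Int_def)
  qed
  have sum_mean: "2 * (\<gamma> * (real n * h)) \<le> (\<Sum>i=1..n. LINT \<omega>|M n. ?Z i \<omega>)"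
    using sum_mono[of "{1..n}" "\<lambda>_. 2 * \<gamma> * h", OF mean] by (simp add: mult_ac)
  have second: "integrable (M n) (\<lambda>\<omega>. (?Z i \<omega>)\<^sup>2) \<and> (LINT \<omega>|M n. (?Z i \<omega>)\<^sup>2) \<le> window_const * h"
    if i: "i \<in> {1..n}" for i
  proof -
    have int: "integrable (M n) (\<lambda>\<omega>. (?Z i \<omega>)\<^sup>2)"
      using i by (intro integrable_const_bound[where B = 1]) (auto simp: indicator_def)
    moreover have "(LINT \<omega>|M n. (?Z i \<omega>)\<^sup>2) \<le> (LINT \<omega>|M n. (?g (X n i \<omega> / h))\<^sup>2)"
      by (rule integral_mono[OF int window_square(1)[OF i h g]]) (auto simp: indicator_def)
    ultimately show ?thesis using window_square(2)[OF i h g] by linarith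
  qed
  have "measure (M n) {\<omega>\<in>space (M n).
      real (card {i\<in>{1..n}. X n i \<omega> / h \<in> I \<and> tail_level \<le> \<sigma> * noise n i \<omega>}) < \<gamma> * (real n * h)}
    \<le> measure (M n) {\<omega>\<in>space (M n). \<gamma> * (real n * h)
      \<le> \<bar>(\<Sum>i=1..n. ?Z i \<omega>) - (\<Sum>i=1..n. LINT \<omega>|M n. ?Z i \<omega>)\<bar>}"
  proof (rule finite_measure_mono)
    have "\<gamma> * (real n * h) \<le> \<bar>s - (\<Sum>i=1..n. LINT \<omega>|M n. ?Z i \<omega>)\<bar>"
      if "s < \<gamma> * (real n * h)" for s
      using sum_mean that by linarith
    then show "{\<omega>\<in>space (M n).
        real (card {i\<in>{1..n}. X n i \<omega> / h \<in> I \<and> tail_level \<le> \<sigma> * noise n i \<omega>}) < \<gamma> * (real n * h)}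
      \<subseteq> {\<omega>\<in>space (M n). \<gamma> * (real n * h)
        \<le> \<bar>(\<Sum>i=1..n. ?Z i \<omega>) - (\<Sum>i=1..n. LINT \<omega>|M n. ?Z i \<omega>)\<bar>}"
      unfolding count by (intro Collect_mono) blast
  qed measurable
  also have "\<dots> \<le> real n * (window_const * h) / (\<gamma> * (real n * h))\<^sup>2"
    using second \<gamma>(2) nh by (intro deviation_bound[OF m, where G = ?G]) auto
  also have "\<dots> = window_const / (\<gamma>\<^sup>2 * (real n * h))"
    using n h \<gamma>(2) by (simp add: power2_eq_square field_simps)
  finally show ?thesis .
qed

end

section \<open>Regular samples have high probability\<close>

lemma (in finite_measure) measure_UN_le_card:
  assumes "finite I" "\<And>i. i \<in> I \<Longrightarrow> A i \<in> sets M" "\<And>i. i \<in> I \<Longrightarrow> measure M (A i) \<le> b"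
  shows "measure M (\<Union>i\<in>I. A i) \<le> real (card I) * b"
proof -
  have "measure M (\<Union>i\<in>I. A i) \<le> (\<Sum>i\<in>I. measure M (A i))"
    using assms by (intro finite_measure_subadditive_finite) auto
  also have "\<dots> \<le> real (card I) * b" using assms(3) by (rule sum_bounded_above)
  finally show ?thesis .
qed

text \<open>Dividing the design matrix by \<open>n h\<close> brings it close to \<open>G\<close>, and inversion is continuous at \<open>G\<close>.\<close>

lemma lp_coeff_near:
  assumes n: "0 < n" and h: "0 < h"
    and \<delta>: "\<forall>A\<in>carrier_mat (S + 1) (S + 1).
      (\<forall>s<S + 1. \<forall>t<S + 1. \<bar>A $$ (s, t) - G $$ (s, t)\<bar> \<le> \<delta>) \<longrightarrow>
      det A \<noteq> 0 \<and> (\<forall>s<S + 1. \<forall>t<S + 1.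
        \<bar>adj_mat A $$ (s, t) / det A - adj_mat G $$ (s, t) / det G\<bar> < \<epsilon>)"
    and near: "\<forall>s\<le>S. \<forall>t\<le>S.
      \<bar>(\<Sum>i=1..n. K (x i / h) * (x i / h) ^ s * (x i / h) ^ t) - real n * h * G $$ (s, t)\<bar>
        < \<delta> * (real n * h)"
  shows "det (design_mat S K n h x 0) \<noteq> 0"
    and "s \<le> S \<Longrightarrow> \<bar>lp_coeff S K n h x s - adj_mat G $$ (0, s) / det G\<bar> < \<epsilon>"
proof -
  let ?D = "design_mat S K n h x 0" and ?c = "1 / (real n * h)"
  have nh: "0 < real n * h" using n h by simp
  have D: "?D \<in> carrier_mat (S + 1) (S + 1)" by (rule design_mat_carrier)
  have "\<bar>(?c \<cdot>\<^sub>m ?D) $$ (s, t) - G $$ (s, t)\<bar> \<le> \<delta>" if st: "s \<le> S" "t \<le> S" for s t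
  proof -
    have entry: "?D $$ (s, t) = (\<Sum>i=1..n. K (x i / h) * (x i / h) ^ s * (x i / h) ^ t)"
      using design_mat_entry[OF st, of K n h x 0] by simp
    have "(?c \<cdot>\<^sub>m ?D) $$ (s, t) = ?c * ?D $$ (s, t)" using D st by simp
    then have "(?c \<cdot>\<^sub>m ?D) $$ (s, t) - G $$ (s, t) = ?c * (?D $$ (s, t) - real n * h * G $$ (s, t))"
      using n h by (simp only: right_diff_distrib) simp
    then have "\<bar>(?c \<cdot>\<^sub>m ?D) $$ (s, t) - G $$ (s, t)\<bar>
        = \<bar>?D $$ (s, t) - real n * h * G $$ (s, t)\<bar> / (real n * h)"
      using n h by (simp add: abs_mult abs_divide)
    also have "\<dots> \<le> \<delta> * (real n * h) / (real n * h)"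
      using near st nh unfolding entry by (intro divide_right_mono less_imp_le) auto
    finally show ?thesis using n h by simp
  qed
  then have inv: "det (?c \<cdot>\<^sub>m ?D) \<noteq> 0" "\<And>s. s \<le> S \<Longrightarrow>
      \<bar>adj_mat (?c \<cdot>\<^sub>m ?D) $$ (0, s) / det (?c \<cdot>\<^sub>m ?D) - adj_mat G $$ (0, s) / det G\<bar> < \<epsilon>"
    using bspec[OF \<delta>, of "?c \<cdot>\<^sub>m ?D"] D by auto
  have c: "?c \<noteq> 0" using n h by simp
  show "det ?D \<noteq> 0" by (rule inverse_entry_smult(1)[OF D c inv(1), of 0 0]) auto
  show "\<bar>lp_coeff S K n h x s - adj_mat G $$ (0, s) / det G\<bar> < \<epsilon>" if "s \<le> S"
  proof -
    have "adj_mat ?D $$ (0, s) / det ?D = ?c * (adj_mat (?c \<cdot>\<^sub>m ?D) $$ (0, s) / det (?c \<cdot>\<^sub>m ?D))"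
      using that by (intro inverse_entry_smult(2)[OF D c inv(1)]) auto
    then have "lp_coeff S K n h x s = adj_mat (?c \<cdot>\<^sub>m ?D) $$ (0, s) / det (?c \<cdot>\<^sub>m ?D)"
      unfolding lp_coeff_def using n h by (simp only:) simp
    then show ?thesis using inv(2)[OF that] by simp
  qed
qed

text \<open>The identity \<open>sqrt (n h) h\<^bsup>S\<^esup> = 1\<close> is what the choice of the bandwidth is for: the noise level
  \<open>1 / sqrt (n h)\<close> agrees with the bias level \<open>h\<^bsup>S\<^esup>\<close>.\<close>

lemma h_nv_props:
  assumes "1 \<le> n"
  shows "0 < h_nv S n" "h_nv S n \<le> 1" "sqrt (real n * h_nv S n) * h_nv S n ^ S = 1"
    "h_nv S n ^ S = real n powr (- (real S / (2 * real S + 1)))"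
proof -
  have n: "0 < real n" "1 \<le> real n" using assms by auto
  show pos: "0 < h_nv S n" using n by (simp add: h_nv_def)
  show "h_nv S n \<le> 1"
    unfolding h_nv_def using powr_mono[of "- (1 / (2 * real S + 1))" 0 "real n"] n by simp
  show pow: "h_nv S n ^ S = real n powr (- (real S / (2 * real S + 1)))"
    using n by (simp add: h_nv_def powr_power mult_ac)
  have "(sqrt (real n * h_nv S n) * h_nv S n ^ S)\<^sup>2 = (real n * h_nv S n) * (h_nv S n ^ S)\<^sup>2"
    using n pos by (simp add: power_mult_distrib)
  also have "\<dots> = real n powr 1 * real n powr (- (1 / (2 * real S + 1)))
      * (real n powr (- (real S / (2 * real S + 1))) * real n powr (- (real S / (2 * real S + 1))))"
    using n by (simp only: pow power2_eq_square) (simp add: h_nv_def)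
  also have "\<dots> = real n powr (1 - 1 / (2 * real S + 1) - real S / (2 * real S + 1) - real S / (2 * real S + 1))"
    by (simp only: powr_add[symmetric]) simp
  also have "1 - 1 / (2 * real S + 1) - real S / (2 * real S + 1) - real S / (2 * real S + 1) = 0"
  proof -
    have "1 / (2 * real S + 1) + real S / (2 * real S + 1) + real S / (2 * real S + 1)
        = (2 * real S + 1) / (2 * real S + 1)"
      by (simp only: add_divide_distrib[symmetric]) simp
    then show ?thesis by simp
  qed
  also have "real n powr 0 = 1" using n by simp
  finally have "(sqrt (real n * h_nv S n) * h_nv S n ^ S)\<^sup>2 = 1\<^sup>2" by simp
  moreover have "0 \<le> sqrt (real n * h_nv S n) * h_nv S n ^ S" using n pos by simp
  ultimately show "sqrt (real n * h_nv S n) * h_nv S n ^ S = 1"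
    using power2_eq_imp_eq by (metis zero_le_one)
qed

lemma h_nv_le_psi_n:
  assumes "3 \<le> n"
  shows "h_nv S n \<le> psi_n S n"
proof -
  have "1 = ln (exp 1 :: real)" by simp
  also have "\<dots> \<le> ln (real n)"
    using exp_le assms by (subst ln_le_cancel_iff) auto
  finally have "1 \<le> ln (real n)" .
  then show ?thesis
    using assms by (simp add: h_nv_def psi_n_def)
qed

lemma h_nv_tendsto: "h_nv S \<longlonglongrightarrow> 0"
  unfolding h_nv_def[abs_def]
  by (rule tendsto_neg_powr[OF _ filterlim_real_sequentially]) simp

lemma effective_sample_size_tendsto:
  assumes "1 \<le> S"
  shows "(\<lambda>n. c / (real n * h_nv S n)) \<longlonglongrightarrow> 0"
proof -
  have e: "- (2 * real S / (2 * real S + 1)) < 0" using assms by simp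
  have "(\<lambda>n. c * real n powr (- (2 * real S / (2 * real S + 1)))) \<longlonglongrightarrow> c * 0"
    by (intro tendsto_mult_left tendsto_neg_powr[OF e filterlim_real_sequentially])
  then have lim: "(\<lambda>n. c * real n powr (- (2 * real S / (2 * real S + 1)))) \<longlonglongrightarrow> 0" by simp
  have "\<forall>\<^sub>F n in sequentially. c * real n powr (- (2 * real S / (2 * real S + 1)))
      = c / (real n * h_nv S n)"
    using eventually_ge_at_top[of "1::nat"]
  proof eventually_elim
    case (elim n)
    then have "real n * h_nv S n = real n powr 1 * real n powr (- (1 / (2 * real S + 1)))"
      by (simp add: h_nv_def)
    also have "\<dots> = real n powr (1 - 1 / (2 * real S + 1))"
      by (simp only: powr_add[symmetric]) simp
    also have "1 - 1 / (2 * real S + 1) = 2 * real S / (2 * real S + 1)" by (simp add: field_simps)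
    finally show ?case by (simp add: powr_minus divide_inverse)
  qed
  from Lim_transform_eventually[OF lim this] show ?thesis .
qed

text \<open>The properties of design points \<open>x\<close> and errors \<open>e\<close> from which the two deterministic bounds follow. In
  order: the normalised design matrix is close to its limit \<open>G\<close>, the window is not overcrowded, the
  noise averages out against the kernel monomials, and each of the sets \<open>I j\<close> contains many errors
  exceeding \<open>\<tau>\<close> in either direction.\<close>

definition regular_sample ::
  "nat \<Rightarrow> (real \<Rightarrow> real) \<Rightarrow> nat \<Rightarrow> real \<Rightarrow> real mat \<Rightarrow> real \<Rightarrow> real \<Rightarrow> real \<Rightarrow> (nat \<Rightarrow> real set) \<Rightarrow>
    real \<Rightarrow> real \<Rightarrow> (nat \<Rightarrow> real) \<Rightarrow> (nat \<Rightarrow> real) \<Rightarrow> bool" where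
  "regular_sample S K n h G \<delta> N R I \<gamma> \<tau> x e \<longleftrightarrow>
    (\<forall>s\<le>S. \<forall>t\<le>S.
      \<bar>(\<Sum>i=1..n. K (x i / h) * (x i / h) ^ s * (x i / h) ^ t) - real n * h * G $$ (s, t)\<bar>
        < \<delta> * (real n * h)) \<and>
    real (card {i\<in>{1..n}. \<bar>x i / h\<bar> \<le> 1}) \<le> N * (real n * h) \<and>
    (\<forall>s\<le>S. \<bar>\<Sum>i=1..n. K (x i / h) * (x i / h) ^ s * e i\<bar> \<le> R) \<and>
    (\<forall>j\<le>S. \<forall>\<sigma>\<in>{1, -1}. \<gamma> * (real n * h)
      \<le> real (card {i\<in>{1..n}. x i / h \<in> I j \<and> \<tau> \<le> \<sigma> * e i}))"

context regression_model
begin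

text \<open>A union bound over the \<open>(S + 1)\<^sup>2 + 1 + (S + 1) + 2 (S + 1)\<close> exceptional events of the concentration
  lemmas.\<close>

lemma good_event_probability:
  fixes I :: "nat \<Rightarrow> real set"
  assumes m: "m \<in> Theta0 J S M\<^sub>S r\<^sub>S (psi_n S n)" and n: "0 < n" and h: "0 < h" "h \<le> 1"
    and K: "K \<in> borel_measurable borel" "\<And>u. \<bar>K u\<bar> \<le> 1" "\<And>u. 1 < \<bar>u\<bar> \<Longrightarrow> K u = 0"
    and \<delta>: "0 < \<delta>" "4 * Lf * h \<le> \<delta>" "4 * Lf * h \<le> 1" and R: "0 < R"
    and I: "\<And>j. j \<le> S \<Longrightarrow> I j \<in> sets borel" "\<And>j. j \<le> S \<Longrightarrow> I j \<subseteq> J"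
      "\<And>j. j \<le> S \<Longrightarrow> measure lborel (I j) = l"
    and small: "4 * Lf * h \<le> fX 0 * l" "2 * LV * h \<le> V 0"
    and \<gamma>: "\<gamma> = tail_mass * (fX 0 * l) / 4" "0 < \<gamma>"
  shows "\<exists>A\<in>sets (M n).
    1 - (real ((S + 1)\<^sup>2) * (4 * window_const / (\<delta>\<^sup>2 * (real n * h))) + 4 * window_const / (real n * h)
      + real (S + 1) * (real n * ((V 0 + LV) * (window_const * h)) / R\<^sup>2)
      + real (2 * (S + 1)) * (window_const / (\<gamma>\<^sup>2 * (real n * h)))) \<le> measure (M n) A \<and>
    (\<forall>\<omega>\<in>A. regular_sample S K n h (fX 0 \<cdot>\<^sub>m kernel_moment_mat S K J) \<delta> (2 * fX 0 + 1) R I \<gamma> tail_level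
      (\<lambda>i. X n i \<omega>) (\<lambda>i. noise n i \<omega>))"
proof -
  interpret prob_space "M n" by (rule prob_space_M)
  note [measurable] = X_measurable noise_measurable K(1)
  have nh: "0 < real n * h" using n h by simp
  let ?g = "\<lambda>s t u. K u * u ^ s * u ^ t :: real" and ?W = "indicator {-1..1} :: real \<Rightarrow> real"
  let ?mass = "LINT u:J|lborel. ?W u"
  have g: "?g s t \<in> borel_measurable borel" "\<bar>?g s t u\<bar> \<le> 1" "1 < \<bar>u\<bar> \<Longrightarrow> ?g s t u = 0" for s t u
  proof -
    show "?g s t \<in> borel_measurable borel" by measurable
    show "\<bar>?g s t u\<bar> \<le> 1"
    proof (cases "\<bar>u\<bar> \<le> 1")
      case True
      then have "\<bar>K u\<bar> * \<bar>u\<bar> ^ s * \<bar>u\<bar> ^ t \<le> 1 * 1 * 1"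
        using K(2) by (intro mult_mono power_le_one) auto
      then show ?thesis by (simp add: abs_mult power_abs)
    qed (use K(3)[of u] in simp)
    show "1 < \<bar>u\<bar> \<Longrightarrow> ?g s t u = 0" using K(3) by simp
  qed
  have mass: "?mass \<le> 2"
  proof -
    have "?mass = (LINT u|lborel. indicator J u)"
      using J_props(2) unfolding set_lebesgue_integral_def
      by (intro Bochner_Integration.integral_cong) (auto simp: indicator_def)
    then show ?thesis using J_props by simp
  qed
  define Ba where "Ba = (\<lambda>(s, t). {\<omega>\<in>space (M n). \<delta> * (real n * h)
      \<le> \<bar>(\<Sum>i=1..n. ?g s t (X n i \<omega> / h)) - real n * h * (fX 0 * (LINT u:J|lborel. ?g s t u))\<bar>})"
  define Bb where "Bb = {\<omega>\<in>space (M n). 1 * (real n * h)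
      \<le> \<bar>(\<Sum>i=1..n. ?W (X n i \<omega> / h)) - real n * h * (fX 0 * ?mass)\<bar>}"
  define Bc where "Bc s = {\<omega>\<in>space (M n). R \<le> \<bar>\<Sum>i=1..n. ?g s 0 (X n i \<omega> / h) * noise n i \<omega>\<bar>}" for s
  define Bd where "Bd = (\<lambda>(j, \<sigma>). {\<omega>\<in>space (M n).
      real (card {i\<in>{1..n}. X n i \<omega> / h \<in> I j \<and> tail_level \<le> \<sigma> * noise n i \<omega>}) < \<gamma> * (real n * h)})"
  have Ba_meas: "Ba p \<in> sets (M n)" for p unfolding Ba_def by (cases p) (simp, measurable)
  have Bb_meas: "Bb \<in> sets (M n)" unfolding Bb_def by measurable
  have Bc_meas: "Bc s \<in> sets (M n)" for s unfolding Bc_def by measurable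
  have Bd_meas: "Bd p \<in> sets (M n)" if pin: "p \<in> {..S} \<times> {1, -1}" for p
  proof -
    obtain j \<sigma> where p: "p = (j, \<sigma>)" "j \<le> S" using pin by (cases p) auto
    note [measurable] = I(1)[OF p(2)]
    have "Bd p = {\<omega>\<in>space (M n). (\<Sum>i=1..n. if X n i \<omega> / h \<in> I j \<and> tail_level \<le> \<sigma> * noise n i \<omega>
        then 1 else 0) < \<gamma> * (real n * h)}"
      by (simp add: Bd_def p(1) sum.If_cases Int_def)
    also have "\<dots> \<in> sets (M n)" by measurable
    finally show ?thesis .
  qed
  have "measure (M n) (\<Union>p\<in>{..S} \<times> {..S}. Ba p)
      \<le> real (card ({..S} \<times> {..S})) * (4 * window_const / (\<delta>\<^sup>2 * (real n * h)))"
    using Ba_meas design_concentration[OF m n h g \<delta>(1,2)]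
    by (intro measure_UN_le_card) (auto simp: Ba_def)
  then have Ba: "measure (M n) (\<Union>p\<in>{..S} \<times> {..S}. Ba p)
      \<le> real ((S + 1)\<^sup>2) * (4 * window_const / (\<delta>\<^sup>2 * (real n * h)))"
    by (simp add: power2_eq_square)
  have "measure (M n) Bb \<le> 4 * window_const / (1\<^sup>2 * (real n * h))"
    unfolding Bb_def using \<delta>(3) by (intro design_concentration[OF m n h]) (auto simp: indicator_def)
  then have Bb: "measure (M n) Bb \<le> 4 * window_const / (real n * h)" by simp
  have "measure (M n) (\<Union>s\<in>{..S}. Bc s)
      \<le> real (card {..S}) * (real n * ((V 0 + LV) * (window_const * h)) / R\<^sup>2)"
    using Bc_meas noise_concentration[where g = "?g s 0" for s, OF m h g R]
    by (intro measure_UN_le_card) (auto simp: Bc_def)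
  then have Bc: "measure (M n) (\<Union>s\<in>{..S}. Bc s)
      \<le> real (S + 1) * (real n * ((V 0 + LV) * (window_const * h)) / R\<^sup>2)" by simp
  have "measure (M n) (Bd (j, \<sigma>)) \<le> window_const / (\<gamma>\<^sup>2 * (real n * h))"
    if "j \<le> S" "\<sigma> \<in> {1, -1}" for j \<sigma>
    unfolding Bd_def prod.case using I[OF that(1)] small \<gamma>
    by (intro large_noise_count[OF m n h _ _ that(2)]) auto
  then have "measure (M n) (\<Union>p\<in>{..S} \<times> {1, -1}. Bd p)
      \<le> real (card ({..S} \<times> {1, -1::real})) * (window_const / (\<gamma>\<^sup>2 * (real n * h)))"
    using Bd_meas by (intro measure_UN_le_card) auto
  then have Bd: "measure (M n) (\<Union>p\<in>{..S} \<times> {1, -1}. Bd p)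
      \<le> real (2 * (S + 1)) * (window_const / (\<gamma>\<^sup>2 * (real n * h)))"
    by (simp add: card_cartesian_product mult.commute)
  define Ca Cc Cd where C_def: "Ca = (\<Union>p\<in>{..S} \<times> {..S}. Ba p)" "Cc = (\<Union>s\<in>{..S}. Bc s)"
      "Cd = (\<Union>p\<in>{..S} \<times> {1, -1}. Bd p)"
  have C_meas: "Ca \<in> sets (M n)" "Cc \<in> sets (M n)" "Cd \<in> sets (M n)"
    unfolding C_def using Ba_meas Bc_meas Bd_meas by (auto intro!: sets.finite_UN)
  define A where "A = space (M n) - (Ca \<union> Bb \<union> Cc \<union> Cd)"
  have "measure (M n) (Ca \<union> Bb \<union> Cc \<union> Cd)
      \<le> measure (M n) Ca + measure (M n) Bb + measure (M n) Cc + measure (M n) Cd"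
    using C_meas Bb_meas measure_Un_le[of "Ca \<union> Bb \<union> Cc" "M n" Cd] measure_Un_le[of "Ca \<union> Bb" "M n" Cc]
      measure_Un_le[of Ca "M n" Bb] by auto
  moreover have "measure (M n) A = 1 - measure (M n) (Ca \<union> Bb \<union> Cc \<union> Cd)"
    unfolding A_def using C_meas Bb_meas by (intro prob_compl) auto
  ultimately have prob_A: "1 - (real ((S + 1)\<^sup>2) * (4 * window_const / (\<delta>\<^sup>2 * (real n * h)))
      + 4 * window_const / (real n * h)
      + real (S + 1) * (real n * ((V 0 + LV) * (window_const * h)) / R\<^sup>2)
      + real (2 * (S + 1)) * (window_const / (\<gamma>\<^sup>2 * (real n * h)))) \<le> measure (M n) A"
    using Ba Bb Bc Bd unfolding C_def[symmetric] by linarith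
  have "A \<in> sets (M n)" unfolding A_def using C_meas Bb_meas by auto
  moreover have "regular_sample S K n h (fX 0 \<cdot>\<^sub>m kernel_moment_mat S K J) \<delta> (2 * fX 0 + 1) R I \<gamma> tail_level
      (\<lambda>i. X n i \<omega>) (\<lambda>i. noise n i \<omega>)" if \<omega>: "\<omega> \<in> A" for \<omega>
    unfolding regular_sample_def
  proof (intro conjI allI impI ballI)
    have sp: "\<omega> \<in> space (M n)" using \<omega> by (simp add: A_def)
    {
      fix s t assume st: "s \<le> S" "t \<le> S"
      then have "\<omega> \<notin> Ba (s, t)" using \<omega> unfolding A_def C_def by blast
      then show "\<bar>(\<Sum>i=1..n. K (X n i \<omega> / h) * (X n i \<omega> / h) ^ s * (X n i \<omega> / h) ^ t)
        - real n * h * (fX 0 \<cdot>\<^sub>m kernel_moment_mat S K J) $$ (s, t)\<bar> < \<delta> * (real n * h)"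
        using sp st by (simp add: Ba_def kernel_moment_mat_def)
    next
      have "\<omega> \<notin> Bb" using \<omega> unfolding A_def by blast
      then have "(\<Sum>i=1..n. ?W (X n i \<omega> / h)) \<le> real n * h * (fX 0 * ?mass) + real n * h"
        using sp by (simp add: Bb_def)
      also have "\<dots> \<le> real n * h * (fX 0 * 2) + real n * h"
        using mass nh fX_pos[OF J_props(3)] by (intro add_right_mono mult_left_mono) auto
      also have "\<dots> = (2 * fX 0 + 1) * (real n * h)" by (simp add: algebra_simps)
      also have "(\<Sum>i=1..n. ?W (X n i \<omega> / h)) = (\<Sum>i=1..n. if \<bar>X n i \<omega> / h\<bar> \<le> 1 then 1 else 0)"
        by (intro sum.cong refl) (simp only: indicator_def of_bool_def atLeastAtMost_iff abs_le_iff, auto)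
      also have "\<dots> = real (card {i\<in>{1..n}. \<bar>X n i \<omega> / h\<bar> \<le> 1})"
        by (simp add: sum.If_cases Int_def)
      finally show "real (card {i\<in>{1..n}. \<bar>X n i \<omega> / h\<bar> \<le> 1}) \<le> (2 * fX 0 + 1) * (real n * h)" .
    next
      fix s assume "s \<le> S"
      then have "\<omega> \<notin> Bc s" using \<omega> unfolding A_def C_def by blast
      then show "\<bar>\<Sum>i=1..n. K (X n i \<omega> / h) * (X n i \<omega> / h) ^ s * noise n i \<omega>\<bar> \<le> R"
        using sp by (simp add: Bc_def)
    next
      fix j \<sigma> assume j: "j \<le> S" "\<sigma> \<in> {1, -1::real}"
      then have "\<omega> \<notin> Bd (j, \<sigma>)" using \<omega> unfolding A_def C_def by blast
      then show "\<gamma> * (real n * h)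
        \<le> real (card {i\<in>{1..n}. X n i \<omega> / h \<in> I j \<and> tail_level \<le> \<sigma> * noise n i \<omega>})"
        using sp by (simp add: Bd_def)
    }
  qed
  ultimately show ?thesis using prob_A by blast
qed

end

section \<open>Measurability of the estimators and the zero function\<close>

lemma lp_weight_measurable:
  assumes K: "K \<in> borel_measurable borel"
    and x: "\<And>i. i \<in> {1..n} \<Longrightarrow> (\<lambda>\<omega>. x \<omega> i) \<in> borel_measurable N" and i: "i \<in> {1..n}"
  shows "(\<lambda>\<omega>. lp_weight S K n h (x \<omega>) 0 i) \<in> borel_measurable N"
proof -
  let ?D = "\<lambda>\<omega>. design_mat S K n h (x \<omega>) 0"
  note [measurable] = K x
  have entry: "(\<lambda>\<omega>. ?D \<omega> $$ (s, t)) \<in> borel_measurable N" if "s < S + 1" "t < S + 1" for s t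
  proof -
    have "(\<lambda>\<omega>. \<Sum>i=1..n. K (x \<omega> i / h) * (x \<omega> i / h) ^ s * (x \<omega> i / h) ^ t) \<in> borel_measurable N"
      by measurable
    then show ?thesis using that by (simp add: design_mat_entry)
  qed
  have det: "(\<lambda>\<omega>. det (?D \<omega>)) \<in> borel_measurable N"
    by (rule borel_measurable_det[OF design_mat_carrier entry])
  have adj: "(\<lambda>\<omega>. adj_mat (?D \<omega>) $$ (0, s)) \<in> borel_measurable N" if "s \<le> S" for s
    using that by (intro borel_measurable_adj_mat[OF design_mat_carrier entry]) auto
  have xi: "(\<lambda>\<omega>. K (x \<omega> i / h)) \<in> borel_measurable N"
    "(\<lambda>\<omega>. (x \<omega> i / h) ^ s) \<in> borel_measurable N" for s
    using i by measurable
  have "lp_weight S K n h (x \<omega>) 0 i = (if det (?D \<omega>) = 0 then 0 else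
      \<Sum>s\<le>S. adj_mat (?D \<omega>) $$ (0, s) / det (?D \<omega>) * (K (x \<omega> i / h) * (x \<omega> i / h) ^ s))" for \<omega>
    using lp_weight_inverse[of S K n h "x \<omega>" 0 i] lp_weight_singular[of S K n h "x \<omega>" 0 i] by simp
  moreover have "(\<lambda>\<omega>. if det (?D \<omega>) = 0 then 0 else
      \<Sum>s\<le>S. adj_mat (?D \<omega>) $$ (0, s) / det (?D \<omega>) * (K (x \<omega> i / h) * (x \<omega> i / h) ^ s))
      \<in> borel_measurable N"
    using det adj xi
    by (intro measurable_If borel_measurable_sum borel_measurable_times borel_measurable_divide
        borel_measurable_const) auto
  ultimately show ?thesis by simp
qed

lemma estimators_measurable:
  assumes K: "K \<in> borel_measurable borel"
    and x: "\<And>i. i \<in> {1..n} \<Longrightarrow> (\<lambda>\<omega>. x \<omega> i) \<in> borel_measurable N"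
    and y: "\<And>i. i \<in> {1..n} \<Longrightarrow> (\<lambda>\<omega>. y \<omega> i) \<in> borel_measurable N"
  shows "(\<lambda>\<omega>. m_hat S K n (x \<omega>) (y \<omega>)) \<in> borel_measurable N"
    and "(\<lambda>\<omega>. r_hat S K d n (x \<omega>) (y \<omega>) t) \<in> borel_measurable N"
proof -
  note [measurable] = lp_weight_measurable[OF K x] y
  show [measurable]: "(\<lambda>\<omega>. m_hat S K n (x \<omega>) (y \<omega>)) \<in> borel_measurable N"
    unfolding m_hat_def lp_est_def by measurable
  have [measurable]: "(\<lambda>\<omega>. CV_hat S K n (x \<omega>) (y \<omega>)) \<in> borel_measurable N"
    unfolding CV_hat_def by measurable
  show "(\<lambda>\<omega>. r_hat S K d n (x \<omega>) (y \<omega>) t) \<in> borel_measurable N"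
    unfolding r_hat_def by measurable
qed

context regression_model
begin

lemma response_measurable:
  assumes m: "m \<in> Theta0 J S M\<^sub>S r\<^sub>S \<psi>" and i: "i \<in> {1..n}"
  shows "(\<lambda>\<omega>. response V (X n) (eps n) m \<omega> i) \<in> borel_measurable (M n)"
proof -
  have "m \<in> borel_measurable (restrict_space borel J)"
    using m by (simp add: Theta0_def)
  then have "(\<lambda>x. indicator J x * m x) \<in> borel_measurable borel"
    using J_props(1) by (subst (asm) borel_measurable_restrict_space_iff) auto
  from design_comp_measurable[OF i this] noise_measurable[OF i]
  show ?thesis unfolding response_def noise_def[symmetric] by measurable
qed

text \<open>The infimum over the class is bounded below by a common lower bound of the probabilities only if the
  class is nonempty.\<close>

lemma zero_in_Theta0: "(\<lambda>_. 0) \<in> Theta0 J S M\<^sub>S r\<^sub>S \<psi>"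
proof -
  have limpt: "at x within J \<noteq> bot" if "x \<in> J" for x
    using that J_cases by (auto simp: trivial_limit_within islimpt_Icc)
  have deriv: "(f has_vector_derivative 0) (at x within J)"
    if "\<And>y. y \<in> J \<Longrightarrow> f y = 0" "x \<in> J" for f :: "real \<Rightarrow> real" and x
    by (rule has_vector_derivative_transform[OF that(2) _ has_vector_derivative_const[of 0]])
       (use that(1) in simp)
  have zero: "deriv_within J s (\<lambda>_. 0) x = 0" if "x \<in> J" for s x
    using that
  proof (induction s arbitrary: x)
    case (Suc s)
    then show ?case
      using vector_derivative_within[OF limpt deriv] by simp
  qed simp
  have diff: "deriv_within J s (\<lambda>_. 0) differentiable (at x within J)" if "x \<in> J" for s x
    using deriv[OF zero that] by (rule differentiableI_vector)
  have "\<forall>\<^sub>F x in at 0 within J. deriv_within J s (\<lambda>_. 0) differentiable (at x within J)" for s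
    using diff by (auto simp: eventually_at_filter)
  then have "differentiable_at0 J S (\<lambda>_. 0)"
    using diff[OF J_props(3)] by (simp add: differentiable_at0_def)
  then show ?thesis
    using zero[OF J_props(3)] Mbound_pos r_S_nonneg by (auto simp: Theta0_def)
qed

end

section \<open>Coverage\<close>

context regression_model
begin

text \<open>The constants are chosen in the following order. The limiting design matrix determines the interval
  \<open>{c1..c2}\<close>, on which the equivalent kernel is at least \<open>\<kappa>\<close>, and this determines the accuracy \<open>\<epsilon>\<close> for the
  coefficients and the accuracy \<open>\<delta>\<close> for the design matrix. The interval is divided into \<open>S + 1\<close> parts of
  length \<open>l\<close>. The noise level \<open>R\<close> is so large that the noise sums exceed \<open>R sqrt (n h)\<close> with probability at
  most \<open>\<alpha> / 2\<close>. The remaining exceptional events have probability at most \<open>P / (n h)\<close>, which tends to \<open>0\<close>.\<close>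

lemma estimation_on_good_event:
  assumes K: "kernel_cond S K" and \<alpha>: "0 < \<alpha>"
  shows "\<exists>C c. 0 < c \<and> (\<forall>\<^sub>F n in sequentially. \<forall>m\<in>Theta0 J S M\<^sub>S r\<^sub>S (psi_n S n). \<exists>A\<in>sets (M n).
    1 - \<alpha> \<le> measure (M n) A \<and>
    (\<forall>\<omega>\<in>A. \<bar>m_hat S K n (\<lambda>i. X n i \<omega>) (response V (X n) (eps n) m \<omega>) - m 0\<bar> \<le> C * h_nv S n ^ S \<and>
      c \<le> CV_hat S K n (\<lambda>i. X n i \<omega>) (response V (X n) (eps n) m \<omega>)))"
proof -
  have K_meas: "K \<in> borel_measurable borel" by (rule kernel_measurable[OF K])
  have K_le: "\<bar>K u\<bar> \<le> 1" for u
    using K unfolding kernel_cond_def by blast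
  have K_supp: "K u = 0" if "1 < \<bar>u\<bar>" for u
  proof -
    have "u \<notin> {-1..1}" using that by auto
    then show ?thesis using K unfolding kernel_cond_def by blast
  qed
  define G where "G = fX 0 \<cdot>\<^sub>m kernel_moment_mat S K J"
  have f0: "0 < fX 0" by (rule fX_pos[OF J_props(3)])
  have Gc: "G \<in> carrier_mat (S + 1) (S + 1)" by (simp add: G_def kernel_moment_mat_def)
  have "invertible_mat (kernel_moment_mat S K J)"
    using K J_cases by (auto simp: kernel_cond_def)
  then have "det (kernel_moment_mat S K J) \<noteq> 0"
    by (rule invertible_mat_det_nonzero[OF kernel_moment_mat_carrier])
  then have det_G: "det G \<noteq> 0" using f0 by (simp add: G_def)
  define b where "b s = adj_mat G $$ (0, s) / det G" for s
  obtain \<kappa> c1 c2 where \<kappa>: "0 < \<kappa>" and c12: "c1 < c2" "{c1..c2} \<subseteq> J"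
    and kernel: "\<And>u. u \<in> {c1..c2} \<Longrightarrow> \<kappa> \<le> \<bar>K u * (\<Sum>s\<le>S. b s * u ^ s)\<bar>"
    unfolding b_def using equivalent_kernel_nonzero[OF K J_cases f0 G_def det_G] by blast
  define \<epsilon> where "\<epsilon> = min 1 (\<kappa> / (2 * real (S + 1)))"
  have \<epsilon>: "0 < \<epsilon>" "\<epsilon> \<le> 1" "real (S + 1) * \<epsilon> \<le> \<kappa> / 2"
  proof -
    show "0 < \<epsilon>" "\<epsilon> \<le> 1" using \<kappa> by (auto simp: \<epsilon>_def)
    have "real (S + 1) * \<epsilon> \<le> real (S + 1) * (\<kappa> / (2 * real (S + 1)))"
      unfolding \<epsilon>_def by (intro mult_left_mono) auto
    also have "\<dots> = \<kappa> / 2" by (simp add: field_simps)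
    finally show "real (S + 1) * \<epsilon> \<le> \<kappa> / 2" .
  qed
  obtain \<delta> where \<delta>: "0 < \<delta>" and \<delta>_near: "\<forall>A\<in>carrier_mat (S + 1) (S + 1).
      (\<forall>s<S + 1. \<forall>t<S + 1. \<bar>A $$ (s, t) - G $$ (s, t)\<bar> \<le> \<delta>) \<longrightarrow>
      det A \<noteq> 0 \<and> (\<forall>s<S + 1. \<forall>t<S + 1.
        \<bar>adj_mat A $$ (s, t) / det A - adj_mat G $$ (s, t) / det G\<bar> < \<epsilon>)"
    using inverse_entries_continuous[OF Gc det_G \<epsilon>(1)] by blast
  define B where "B = (\<Sum>s\<le>S. \<bar>b s\<bar>) + 1"
  define l where "l = (c2 - c1) / real (S + 1)"
  have l: "0 < l" "c1 + real (S + 1) * l = c2" using c12 by (auto simp: l_def)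
  define I where "I j = {c1 + real j * l<..<c1 + real (j + 1) * l}" for j
  have I_sub: "I j \<subseteq> {c1..c2}" if "j \<le> S" for j
  proof -
    have "real (j + 1) * l \<le> real (S + 1) * l"
      using that l(1) by (intro mult_right_mono) auto
    moreover have "0 \<le> real j * l" using l(1) by simp
    ultimately have "c1 \<le> c1 + real j * l" "c1 + real (j + 1) * l \<le> c2" using l(2) by linarith+
    then show ?thesis unfolding I_def by fastforce
  qed
  have I_borel: "I j \<in> sets borel" for j by (simp add: I_def)
  have I_J: "I j \<subseteq> J" if "j \<le> S" for j using I_sub[OF that] c12(2) by simp
  have I_disj: "I i \<inter> I j = {}" if "i \<noteq> j" for i j
  proof -
    have "I i \<inter> I j = {}" if "i < j" for i j
    proof -
      have "real (i + 1) * l \<le> real j * l" using that l(1) by (intro mult_right_mono) auto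
      then show ?thesis by (auto simp: I_def)
    qed
    then show ?thesis using that by (metis inf_commute linorder_neqE_nat)
  qed
  have I_meas: "measure lborel (I j) = l" for j
    using l(1) by (simp add: I_def algebra_simps)
  define \<gamma> where "\<gamma> = tail_mass * (fX 0 * l) / 4"
  have \<gamma>: "0 < \<gamma>" using tail_consts f0 l by (simp add: \<gamma>_def)
  have V1: "0 < V 0 + LV" using V_0_pos LV_nonneg by simp
  define Q where "Q = real (S + 1) * (V 0 + LV) * window_const"
  have Q: "0 < Q" using V1 window_const_pos by (simp add: Q_def)
  define R where "R = sqrt (2 * Q / \<alpha>)"
  have R: "0 < R" "Q / R\<^sup>2 = \<alpha> / 2" using Q \<alpha> by (auto simp: R_def)
  define P where "P = real ((S + 1)\<^sup>2) * (4 * window_const / \<delta>\<^sup>2) + 4 * window_const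
      + real (2 * (S + 1)) * (window_const / \<gamma>\<^sup>2)"
  define \<rho> where "\<rho> = M\<^sub>S * r\<^sub>S 1"
  have \<rho>: "0 \<le> \<rho>" using Mbound_pos r_S_nonneg[of 1] by (simp add: \<rho>_def)
  define C where "C = real (S + 1) * B * ((2 * fX 0 + 1) * \<rho> + R)"
  define c where "c = \<gamma> * (\<kappa> / 2 * (tail_level / 2))\<^sup>2"
  have c: "0 < c" using \<gamma> \<kappa> tail_consts by (simp add: c_def)
  have to_zero: "(\<lambda>n. a * h_nv S n) \<longlonglongrightarrow> 0" for a
    using tendsto_mult_left[OF h_nv_tendsto, of a] by simp
  have to_zero': "(\<lambda>n. \<rho> * h_nv S n ^ S) \<longlonglongrightarrow> 0"
  proof -
    have "(\<lambda>n. \<rho> * h_nv S n ^ S) \<longlonglongrightarrow> \<rho> * 0 ^ S"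
      by (intro tendsto_intros h_nv_tendsto)
    then show ?thesis using S_pos by (simp add: power_0_left)
  qed
  have ev: "\<forall>\<^sub>F n in sequentially. 3 \<le> n \<and> 4 * Lf * h_nv S n < \<delta> \<and> 4 * Lf * h_nv S n < 1 \<and>
      4 * Lf * h_nv S n < fX 0 * l \<and> 2 * LV * h_nv S n < V 0 \<and> \<rho> * h_nv S n ^ S < tail_level / 2 \<and>
      P / (real n * h_nv S n) < \<alpha> / 2"
    using \<delta> f0 l V_0_pos tail_consts \<alpha>
    by (intro eventually_conj eventually_ge_at_top order_tendstoD(2)[OF to_zero]
        order_tendstoD(2)[OF to_zero'] order_tendstoD(2)[OF effective_sample_size_tendsto[OF S_pos]]) auto
  show ?thesis
  proof (intro exI[of _ C] exI[of _ c] conjI c, rule eventually_mono[OF ev], rule ballI, elim conjE)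
    fix n m
    assume n3: "3 \<le> n" and m: "m \<in> Theta0 J S M\<^sub>S r\<^sub>S (psi_n S n)"
      and small: "4 * Lf * h_nv S n < \<delta>" "4 * Lf * h_nv S n < 1" "4 * Lf * h_nv S n < fX 0 * l"
        "2 * LV * h_nv S n < V 0" "\<rho> * h_nv S n ^ S < tail_level / 2" "P / (real n * h_nv S n) < \<alpha> / 2"
    let ?h = "h_nv S n" and ?x = "\<lambda>\<omega> i. X n i \<omega>" and ?y = "response V (X n) (eps n) m"
    have n: "0 < n" "1 \<le> n" using n3 by auto
    note h = h_nv_props[OF n(2), of S]
    have nh: "0 < real n * ?h" using n h by simp
    have Rn: "0 < R * sqrt (real n * ?h)" using R nh by simp
    have "\<exists>A\<in>sets (M n).
      1 - (real ((S + 1)\<^sup>2) * (4 * window_const / (\<delta>\<^sup>2 * (real n * ?h))) + 4 * window_const / (real n * ?h)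
        + real (S + 1) * (real n * ((V 0 + LV) * (window_const * ?h)) / (R * sqrt (real n * ?h))\<^sup>2)
        + real (2 * (S + 1)) * (window_const / (\<gamma>\<^sup>2 * (real n * ?h)))) \<le> measure (M n) A \<and>
      (\<forall>\<omega>\<in>A. regular_sample S K n ?h G \<delta> (2 * fX 0 + 1) (R * sqrt (real n * ?h)) I \<gamma> tail_level
        (?x \<omega>) (\<lambda>i. noise n i \<omega>))"
      unfolding G_def
      by (rule good_event_probability[OF m n(1) h(1,2) K_meas K_le _ \<delta> less_imp_le[OF small(1)]
            less_imp_le[OF small(2)] Rn _ _ _ less_imp_le[OF small(3)]
            less_imp_le[OF small(4)] \<gamma>_def \<gamma>]) (fact K_supp | rule I_borel | erule I_J | rule I_meas)+
    then obtain A where A: "A \<in> sets (M n)"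
      and prob: "1 - (real ((S + 1)\<^sup>2) * (4 * window_const / (\<delta>\<^sup>2 * (real n * ?h)))
        + 4 * window_const / (real n * ?h)
        + real (S + 1) * (real n * ((V 0 + LV) * (window_const * ?h)) / (R * sqrt (real n * ?h))\<^sup>2)
        + real (2 * (S + 1)) * (window_const / (\<gamma>\<^sup>2 * (real n * ?h)))) \<le> measure (M n) A"
      and regular: "\<And>\<omega>. \<omega> \<in> A \<Longrightarrow> regular_sample S K n ?h G \<delta> (2 * fX 0 + 1) (R * sqrt (real n * ?h)) I \<gamma> tail_level
        (?x \<omega>) (\<lambda>i. noise n i \<omega>)"
      by blast
    have "real (S + 1) * (real n * ((V 0 + LV) * (window_const * ?h)) / (R * sqrt (real n * ?h))\<^sup>2) = Q / R\<^sup>2"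
      using nh n h by (simp add: Q_def power_mult_distrib)
    then have total: "real ((S + 1)\<^sup>2) * (4 * window_const / (\<delta>\<^sup>2 * (real n * ?h)))
        + 4 * window_const / (real n * ?h)
        + real (S + 1) * (real n * ((V 0 + LV) * (window_const * ?h)) / (R * sqrt (real n * ?h))\<^sup>2)
        + real (2 * (S + 1)) * (window_const / (\<gamma>\<^sup>2 * (real n * ?h))) = P / (real n * ?h) + \<alpha> / 2"
      unfolding R(2) by (simp add: P_def add_divide_distrib)
    from prob have "1 - (P / (real n * ?h) + \<alpha> / 2) \<le> measure (M n) A" unfolding total .
    then have prob_A: "1 - \<alpha> \<le> measure (M n) A" using small(6) by linarith
    have "\<bar>m_hat S K n (?x \<omega>) (?y \<omega>) - m 0\<bar> \<le> C * ?h ^ S \<and> c \<le> CV_hat S K n (?x \<omega>) (?y \<omega>)"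
      if \<omega>: "\<omega> \<in> A" for \<omega>
    proof -
      have \<omega>_space: "\<omega> \<in> space (M n)" using \<omega> A sets.sets_into_space by blast
      note reg = regular[OF \<omega>, unfolded regular_sample_def]
      note near = reg[THEN conjunct1] and reg2 = reg[THEN conjunct2]
      note count = reg2[THEN conjunct1] and reg3 = reg2[THEN conjunct2]
      have noise: "\<bar>\<Sum>i=1..n. K (?x \<omega> i / ?h) * (?x \<omega> i / ?h) ^ s * noise n i \<omega>\<bar>
          \<le> R * sqrt (real n * ?h)" if "s \<le> S" for s
        using reg3[THEN conjunct1] that by blast
      have large: "\<gamma> * (real n * ?h)
          \<le> real (card {i\<in>{1..n}. ?x \<omega> i / ?h \<in> I j \<and> tail_level \<le> \<sigma> * noise n i \<omega>})"
        if "j \<le> S" "\<sigma> \<in> {1, -1}" for j \<sigma>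
        using reg3[THEN conjunct2] that by blast
      note coeff = lp_coeff_near[OF n(1) h(1) \<delta>_near near, folded b_def]
      have coeff_le: "\<bar>lp_coeff S K n ?h (?x \<omega>) s\<bar> \<le> B" if "s \<le> S" for s
      proof -
        have "\<bar>b s\<bar> \<le> (\<Sum>s\<le>S. \<bar>b s\<bar>)" using that by (intro member_le_sum) auto
        then show ?thesis using coeff(2)[OF that] \<epsilon>(2) by (simp add: B_def)
      qed
      have kernel_lower: "\<kappa> / 2 \<le> \<bar>K u * (\<Sum>s\<le>S. lp_coeff S K n ?h (?x \<omega>) s * u ^ s)\<bar>"
        if "j \<le> S" "u \<in> I j" for j u
      proof -
        have u: "u \<in> {c1..c2}" using I_sub that by blast
        then have u1: "\<bar>u\<bar> \<le> 1" using c12(2) J_abs_le by blast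
        let ?p = "\<Sum>s\<le>S. lp_coeff S K n ?h (?x \<omega>) s * u ^ s" and ?q = "\<Sum>s\<le>S. b s * u ^ s"
        have "\<bar>?p - ?q\<bar> = \<bar>\<Sum>s\<le>S. (lp_coeff S K n ?h (?x \<omega>) s - b s) * u ^ s\<bar>"
          by (simp add: sum_subtractf left_diff_distrib)
        also have "\<dots> \<le> (\<Sum>s\<le>S. \<bar>(lp_coeff S K n ?h (?x \<omega>) s - b s) * u ^ s\<bar>)" by (rule sum_abs)
        also have "\<dots> \<le> (\<Sum>s\<le>S. \<epsilon> * 1)"
          using coeff(2) u1 \<epsilon>(1) unfolding abs_mult power_abs
          by (intro sum_mono mult_mono power_le_one) (auto intro: less_imp_le)
        also have "\<dots> \<le> \<kappa> / 2" using \<epsilon>(3) by simp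
        finally have "\<bar>K u\<bar> * \<bar>?p - ?q\<bar> \<le> 1 * (\<kappa> / 2)"
          using K_le by (intro mult_mono) auto
        then have "\<bar>K u * ?p - K u * ?q\<bar> \<le> \<kappa> / 2"
          by (simp add: abs_mult[symmetric] right_diff_distrib)
        then show ?thesis using kernel[OF u] by linarith
      qed
      have y: "?y \<omega> i = m (?x \<omega> i) + noise n i \<omega>" for i
        by (simp add: response_def noise_def)
      obtain a where a0: "a 0 = m 0" and taylor: "\<And>x. x \<in> J \<Longrightarrow> \<bar>x\<bar> \<le> ?h \<Longrightarrow>
          \<bar>m x - (\<Sum>s\<le>S. a s * (x / ?h) ^ s)\<bar> \<le> M\<^sub>S * r\<^sub>S ?h * ?h ^ S"
        using Theta0_taylor[OF m h(1) h_nv_le_psi_n[OF n3] r_S_mono Mbound_pos r_S_nonneg] by blast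
      have "r\<^sub>S ?h \<le> r\<^sub>S 1" using mono_onD[OF r_S_mono, of ?h 1] h by simp
      then have "M\<^sub>S * r\<^sub>S ?h * ?h ^ S \<le> \<rho> * ?h ^ S"
        unfolding \<rho>_def using Mbound_pos h by (intro mult_right_mono mult_left_mono) auto
      then have taylor_\<rho>: "\<bar>m (?x \<omega> i) - (\<Sum>s\<le>S. a s * (?x \<omega> i / ?h) ^ s)\<bar> \<le> \<rho> * ?h ^ S"
        if "i \<in> {1..n}" "\<bar>?x \<omega> i\<bar> \<le> ?h" for i
        using taylor[OF X_in_J[OF that(1) \<omega>_space] that(2)] by linarith
      have "\<bar>lp_est S K n ?h (?x \<omega>) (?y \<omega>) 0 - m 0\<bar>
          \<le> real (S + 1) * B * ((2 * fX 0 + 1) * (\<rho> * ?h ^ S) + R * sqrt (real n * ?h) / (real n * ?h))"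
        using \<rho> h by (intro lp_est_error[OF n(1) h(1) coeff(1) coeff_le K_le K_supp count
            noise y taylor_\<rho> a0]) auto
      also have "R * sqrt (real n * ?h) / (real n * ?h) = R * ?h ^ S"
      proof -
        have "sqrt (real n * ?h) * sqrt (real n * ?h) = real n * ?h" using nh by simp
        then have "sqrt (real n * ?h) / (real n * ?h) = 1 / sqrt (real n * ?h)"
          using nh by (metis divide_divide_eq_left divide_self_if less_irrefl real_sqrt_gt_zero)
        also have "\<dots> = ?h ^ S"
        proof -
          have "sqrt (real n * ?h) \<noteq> 0" using n h by simp
          then show ?thesis using h(3) by (metis mult.commute nonzero_divide_eq_eq)
        qed
        finally show ?thesis by (simp add: times_divide_eq_right[symmetric] del: times_divide_eq_right)
      qed
      finally have est: "\<bar>m_hat S K n (?x \<omega>) (?y \<omega>) - m 0\<bar> \<le> C * ?h ^ S"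
        by (simp add: m_hat_def C_def algebra_simps)
      have "c \<le> real n * ?h * (\<Sum>i=1..n. (lp_weight S K n ?h (?x \<omega>) 0 i)\<^sup>2
          * (?y \<omega> i - m_hat S K n (?x \<omega>) (?y \<omega>))\<^sup>2)"
        unfolding c_def
      proof (rule CV_lower_bound[OF n(1) h(1) coeff(1) _ kernel_lower I_disj _ _ large y])
        show "\<bar>m (?x \<omega> i) - (\<Sum>s\<le>S. a s * (?x \<omega> i / ?h) ^ s)\<bar> \<le> tail_level / 2"
          if "i \<in> {1..n}" "\<bar>?x \<omega> i\<bar> \<le> ?h" for i
          using taylor_\<rho>[OF that] small(5) by linarith
        show "connected (I j)" for j by (simp add: I_def)
        show "I j \<subseteq> {- 1..1}" if "j \<le> S" for j using I_sub[OF that] c12(2) J_props(2) by blast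
      qed (use \<kappa> tail_consts in auto)
      then show ?thesis using est by (simp add: CV_hat_def)
    qed
    then show "\<exists>A\<in>sets (M n). 1 - \<alpha> \<le> measure (M n) A \<and>
      (\<forall>\<omega>\<in>A. \<bar>m_hat S K n (?x \<omega>) (?y \<omega>) - m 0\<bar> \<le> C * ?h ^ S \<and> c \<le> CV_hat S K n (?x \<omega>) (?y \<omega>))"
      using A prob_A by blast
  qed
qed

text \<open>The half-width is \<open>d\<^sub>n h\<^bsup>S\<^esup>\<close> times at least the constant \<open>k\<close>, and so exceeds the estimation error
  \<open>C h\<^bsup>S\<^esup>\<close> as soon as \<open>d\<^sub>n \<ge> C / k\<close>.\<close>

lemma coverage_eventually:
  assumes K: "kernel_cond S K" and \<alpha>: "0 < \<alpha>" "\<alpha> < 1" and d: "filterlim d at_top sequentially"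
  shows "\<forall>\<^sub>F n in sequentially. \<forall>m\<in>Theta0 J S M\<^sub>S r\<^sub>S (psi_n S n). \<forall>t\<in>{0<..\<alpha>}.
    \<exists>A\<in>sets (M n). 1 - \<alpha> \<le> measure (M n) A \<and>
      (\<forall>\<omega>\<in>A. \<bar>m_hat S K n (\<lambda>i. X n i \<omega>) (response V (X n) (eps n) m \<omega>) - m 0\<bar>
        \<le> r_hat S K d n (\<lambda>i. X n i \<omega>) (response V (X n) (eps n) m \<omega>) t)"
proof -
  define p where "p = real S / (2 * real S + 1)"
  have p: "0 \<le> p" by (simp add: p_def)
  obtain C c where c: "0 < c" and good: "\<forall>\<^sub>F n in sequentially.
    \<forall>m\<in>Theta0 J S M\<^sub>S r\<^sub>S (psi_n S n). \<exists>A\<in>sets (M n). 1 - \<alpha> \<le> measure (M n) A \<and>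
      (\<forall>\<omega>\<in>A. \<bar>m_hat S K n (\<lambda>i. X n i \<omega>) (response V (X n) (eps n) m \<omega>) - m 0\<bar> \<le> C * h_nv S n ^ S \<and>
        c \<le> CV_hat S K n (\<lambda>i. X n i \<omega>) (response V (X n) (eps n) m \<omega>))"
    using estimation_on_good_event[OF K \<alpha>(1)] by blast
  define k where "k = (2 * ln (1 / \<alpha>) * c) powr p"
  have ln_pos: "0 < ln (1 / \<alpha>)" using \<alpha> by simp
  have k: "0 < k" using ln_pos c by (simp add: k_def)
  have "\<forall>\<^sub>F n in sequentially. max 0 (C / k) \<le> d n"
    using d unfolding filterlim_at_top by blast
  with good eventually_ge_at_top[of "1::nat"] show ?thesis
  proof eventually_elim
    case (elim n)
    show ?case
    proof (intro ballI)
      fix m t assume m: "m \<in> Theta0 J S M\<^sub>S r\<^sub>S (psi_n S n)" and t: "t \<in> {0<..\<alpha>}"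
      note h = h_nv_props[OF elim(2), of S]
      from elim(1) m obtain A where A: "A \<in> sets (M n)" "1 - \<alpha> \<le> measure (M n) A"
        and est: "\<And>\<omega>. \<omega> \<in> A \<Longrightarrow> \<bar>m_hat S K n (\<lambda>i. X n i \<omega>) (response V (X n) (eps n) m \<omega>) - m 0\<bar>
          \<le> C * h_nv S n ^ S"
        and CV: "\<And>\<omega>. \<omega> \<in> A \<Longrightarrow> c \<le> CV_hat S K n (\<lambda>i. X n i \<omega>) (response V (X n) (eps n) m \<omega>)"
        by blast
      have "\<bar>m_hat S K n (\<lambda>i. X n i \<omega>) (response V (X n) (eps n) m \<omega>) - m 0\<bar>
          \<le> r_hat S K d n (\<lambda>i. X n i \<omega>) (response V (X n) (eps n) m \<omega>) t" if \<omega>: "\<omega> \<in> A" for \<omega>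
      proof -
        let ?CV = "CV_hat S K n (\<lambda>i. X n i \<omega>) (response V (X n) (eps n) m \<omega>)"
        have "ln (1 / \<alpha>) \<le> ln (1 / t)"
          using t \<alpha> by (subst ln_le_cancel_iff) (auto simp: frac_le)
        then have "2 * ln (1 / \<alpha>) * c \<le> 2 * ln (1 / t) * ?CV"
          using CV[OF \<omega>] ln_pos c by (intro mult_mono) auto
        then have "2 * ln (1 / \<alpha>) * c / real n \<le> 2 * ln (1 / t) * ?CV / real n"
          by (rule divide_right_mono) simp
        then have "(2 * ln (1 / \<alpha>) * c / real n) powr p \<le> (2 * ln (1 / t) * ?CV / real n) powr p"
          using p ln_pos c by (intro powr_mono2) auto
        moreover have "(2 * ln (1 / \<alpha>) * c / real n) powr p = k * h_nv S n ^ S"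
        proof -
          have "(2 * ln (1 / \<alpha>) * c / real n) powr p = k / real n powr p"
            unfolding k_def by (rule powr_divide)
          also have "\<dots> = k * h_nv S n ^ S"
            unfolding h(4) p_def[symmetric] by (simp add: powr_minus divide_inverse)
          finally show ?thesis .
        qed
        ultimately have rate: "k * h_nv S n ^ S \<le> (2 * ln (1 / t) * ?CV / real n) powr p" by simp
        have "C * h_nv S n ^ S = C / k * (k * h_nv S n ^ S)" using k by simp
        also have "\<dots> \<le> d n * (k * h_nv S n ^ S)"
          using elim(3) k h(1) by (intro mult_right_mono) auto
        also have "\<dots> \<le> d n * (2 * ln (1 / t) * ?CV / real n) powr p"
          using rate elim(3) by (intro mult_left_mono) auto
        finally show ?thesis using est[OF \<omega>] by (simp add: r_hat_def p_def)
      qed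
      with A show "\<exists>A\<in>sets (M n). 1 - \<alpha> \<le> measure (M n) A \<and>
        (\<forall>\<omega>\<in>A. \<bar>m_hat S K n (\<lambda>i. X n i \<omega>) (response V (X n) (eps n) m \<omega>) - m 0\<bar>
          \<le> r_hat S K d n (\<lambda>i. X n i \<omega>) (response V (X n) (eps n) m \<omega>) t)"
        by blast
    qed
  qed
qed

end

theorem theorem2:
  fixes S :: nat and J :: "real set"
    and M :: "nat \<Rightarrow> 'a measure"
    and X eps :: "nat \<Rightarrow> nat \<Rightarrow> 'a \<Rightarrow> real"
    and fX V r\<^sub>S K :: "real \<Rightarrow> real"
    and Lf LV M\<^sub>S q E\<^sub>q \<alpha> :: real
    and d :: "nat \<Rightarrow> real"
  defines "\<Theta> \<equiv> \<lambda>n. Theta0 J S M\<^sub>S r\<^sub>S (psi_n S n)"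
    and "mhat \<equiv> \<lambda>n m \<omega>. m_hat S K n (\<lambda>i. X n i \<omega>) (response V (X n) (eps n) m \<omega>)"
    and "rhat \<equiv> \<lambda>t n m \<omega>. r_hat S K d n (\<lambda>i. X n i \<omega>) (response V (X n) (eps n) m \<omega>) t"
  assumes "regression_model S J M X eps fX V r\<^sub>S Lf LV M\<^sub>S q E\<^sub>q"
    and "kernel_cond S K"
    and "0 < \<alpha>" and "\<alpha> < 1"
    and "filterlim d at_top sequentially"
    and "filterlim (\<lambda>n. d n / sqrt (ln (real n))) at_top sequentially"
  shows "\<exists>CE CE' :: nat \<Rightarrow> real.
    (\<forall>n\<ge>1.
       (INF m\<in>\<Theta> n. measure (M n) {\<omega> \<in> space (M n).
          m 0 \<le> mhat n m \<omega> + rhat \<alpha> n m \<omega>}) \<ge> 1 - \<alpha> - CE n \<and>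
       (INF m\<in>\<Theta> n. measure (M n) {\<omega> \<in> space (M n).
          m 0 \<ge> mhat n m \<omega> - rhat \<alpha> n m \<omega>}) \<ge> 1 - \<alpha> - CE n \<and>
       (INF m\<in>\<Theta> n. measure (M n) {\<omega> \<in> space (M n).
          m 0 \<in> {mhat n m \<omega> - rhat (\<alpha> / 2) n m \<omega> .. mhat n m \<omega> + rhat (\<alpha> / 2) n m \<omega>}})
            \<ge> 1 - \<alpha> - CE' n) \<and>
    (\<lambda>n. max (CE n) (CE' n)) \<in> o(\<lambda>n. real n powr (- (2 * real S / (2 * real S + 1)))) \<and>
    (sub_gaussian_errors M eps \<longrightarrow>
       (\<exists>\<kappa>>0. (\<lambda>n. max (CE n) (CE' n)) \<in> O(\<lambda>n. exp (- (real n powr \<kappa>)))))"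
proof -
  interpret regression_model S J M X eps fX V r\<^sub>S Lf LV M\<^sub>S q E\<^sub>q by fact
  have K_meas: "K \<in> borel_measurable borel" by (rule kernel_measurable) fact
  obtain N where N: "\<And>n m t. N \<le> n \<Longrightarrow> m \<in> \<Theta> n \<Longrightarrow> t \<in> {0<..\<alpha>} \<Longrightarrow>
      \<exists>A\<in>sets (M n). 1 - \<alpha> \<le> measure (M n) A \<and> (\<forall>\<omega>\<in>A. \<bar>mhat n m \<omega> - m 0\<bar> \<le> rhat t n m \<omega>)"
    using coverage_eventually[OF assms(5-8)]
    unfolding eventually_sequentially \<Theta>_def mhat_def rhat_def by meson
  have nonempty: "\<Theta> n \<noteq> {}" for n using zero_in_Theta0 unfolding \<Theta>_def by blast
  have meas: "(\<lambda>\<omega>. mhat n m \<omega>) \<in> borel_measurable (M n)" "(\<lambda>\<omega>. rhat t n m \<omega>) \<in> borel_measurable (M n)"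
    if "m \<in> \<Theta> n" for n m t
    unfolding mhat_def rhat_def
    by (rule estimators_measurable[OF K_meas X_measurable response_measurable[OF that[unfolded \<Theta>_def]]];
        assumption)+
  \<comment> \<open>For \<open>n < N\<close> the error \<open>1\<close> makes the claim trivial, for \<open>n \<ge> N\<close> the coverage is at least \<open>1 - \<alpha>\<close>.\<close>
  define CE :: "nat \<Rightarrow> real" where "CE n = (if n < N then 1 else 0)" for n
  have INF_bound: "1 - \<alpha> - CE n \<le> (INF m\<in>\<Theta> n. measure (M n) {\<omega> \<in> space (M n). P n m \<omega>})"
    if P: "\<And>m \<omega>. \<bar>mhat n m \<omega> - m 0\<bar> \<le> rhat t n m \<omega> \<Longrightarrow> P n m \<omega>" and t: "t \<in> {0<..\<alpha>}"
      and P_meas: "\<And>m. m \<in> \<Theta> n \<Longrightarrow> {\<omega> \<in> space (M n). P n m \<omega>} \<in> sets (M n)" for P n t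
  proof (rule cINF_greatest[OF nonempty])
    fix m assume m: "m \<in> \<Theta> n"
    interpret prob_space "M n" by (rule prob_space_M)
    show "1 - \<alpha> - CE n \<le> measure (M n) {\<omega> \<in> space (M n). P n m \<omega>}"
    proof (cases "n < N")
      case True
      then have "1 - \<alpha> - CE n \<le> 0" using assms(6) by (simp add: CE_def)
      also have "0 \<le> measure (M n) {\<omega> \<in> space (M n). P n m \<omega>}" by simp
      finally show ?thesis .
    next
      case False
      then obtain A where A: "A \<in> sets (M n)" "1 - \<alpha> \<le> measure (M n) A"
        "\<And>\<omega>. \<omega> \<in> A \<Longrightarrow> \<bar>mhat n m \<omega> - m 0\<bar> \<le> rhat t n m \<omega>"
        using N[OF _ m t] by force
      have "A \<subseteq> {\<omega> \<in> space (M n). P n m \<omega>}"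
        using A(3) P sets.sets_into_space[OF A(1)] by blast
      then have "measure (M n) A \<le> measure (M n) {\<omega> \<in> space (M n). P n m \<omega>}"
        by (rule finite_measure_mono[OF _ P_meas[OF m]])
      then show ?thesis using A(2) False by (simp add: CE_def)
    qed
  qed
  have t: "\<alpha> \<in> {0<..\<alpha>}" "\<alpha> / 2 \<in> {0<..\<alpha>}" using assms(6) by auto
  have "\<forall>n\<ge>1.
       (INF m\<in>\<Theta> n. measure (M n) {\<omega> \<in> space (M n).
          m 0 \<le> mhat n m \<omega> + rhat \<alpha> n m \<omega>}) \<ge> 1 - \<alpha> - CE n \<and>
       (INF m\<in>\<Theta> n. measure (M n) {\<omega> \<in> space (M n).
          m 0 \<ge> mhat n m \<omega> - rhat \<alpha> n m \<omega>}) \<ge> 1 - \<alpha> - CE n \<and>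
       (INF m\<in>\<Theta> n. measure (M n) {\<omega> \<in> space (M n).
          m 0 \<in> {mhat n m \<omega> - rhat (\<alpha> / 2) n m \<omega> .. mhat n m \<omega> + rhat (\<alpha> / 2) n m \<omega>}})
            \<ge> 1 - \<alpha> - CE n"
  proof (intro allI impI conjI)
    fix n :: nat
    show "(INF m\<in>\<Theta> n. measure (M n) {\<omega> \<in> space (M n).
        m 0 \<le> mhat n m \<omega> + rhat \<alpha> n m \<omega>}) \<ge> 1 - \<alpha> - CE n"
    proof (rule INF_bound[OF _ t(1)])
      fix m assume "m \<in> \<Theta> n"
      note [measurable] = meas[OF this]
      show "{\<omega> \<in> space (M n). m 0 \<le> mhat n m \<omega> + rhat \<alpha> n m \<omega>} \<in> sets (M n)" by measurable
    qed linarith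
    show "(INF m\<in>\<Theta> n. measure (M n) {\<omega> \<in> space (M n).
        m 0 \<ge> mhat n m \<omega> - rhat \<alpha> n m \<omega>}) \<ge> 1 - \<alpha> - CE n"
    proof (rule INF_bound[OF _ t(1)])
      fix m assume "m \<in> \<Theta> n"
      note [measurable] = meas[OF this]
      show "{\<omega> \<in> space (M n). m 0 \<ge> mhat n m \<omega> - rhat \<alpha> n m \<omega>} \<in> sets (M n)" by measurable
    qed linarith
    show "(INF m\<in>\<Theta> n. measure (M n) {\<omega> \<in> space (M n).
        m 0 \<in> {mhat n m \<omega> - rhat (\<alpha> / 2) n m \<omega> .. mhat n m \<omega> + rhat (\<alpha> / 2) n m \<omega>}})
          \<ge> 1 - \<alpha> - CE n"
    proof (rule INF_bound[OF _ t(2)])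
      fix m assume "m \<in> \<Theta> n"
      note [measurable] = meas[OF this]
      have "{\<omega> \<in> space (M n). mhat n m \<omega> - rhat (\<alpha> / 2) n m \<omega> \<le> m 0 \<and>
          m 0 \<le> mhat n m \<omega> + rhat (\<alpha> / 2) n m \<omega>} \<in> sets (M n)" by measurable
      then show "{\<omega> \<in> space (M n). m 0 \<in> {mhat n m \<omega> - rhat (\<alpha> / 2) n m \<omega>
          .. mhat n m \<omega> + rhat (\<alpha> / 2) n m \<omega>}} \<in> sets (M n)" by simp
    qed (auto simp: abs_le_iff)
  qed
  moreover have "(\<lambda>n. max (CE n) (CE n)) \<in> o(g)" for g :: "nat \<Rightarrow> real"
  proof -
    have "\<forall>\<^sub>F n in sequentially. max (CE n) (CE n) = 0"
      using eventually_ge_at_top[of N] by eventually_elim (simp add: CE_def)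
    then show ?thesis by (subst landau_o.small.in_cong) auto
  qed
  moreover from this have "(\<lambda>n. max (CE n) (CE n)) \<in> O(\<lambda>n. exp (- (real n powr 1)))"
    by (rule landau_o.small_imp_big)
  ultimately show ?thesis
    by (intro exI[of _ CE] conjI impI exI[of _ "1::real"]) auto
qed

end
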